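(* Let $V:\mathbb{T}=\mathbb{R}/\mathbb{Z}\to\mathbb{R}$ be real analytic and let $a>0$. There exists $c=c(a)>0$ (for the fixed $V$) such that the following holds for any $\alpha\in\mathbb{R}\setminus\mathbb{Q}$ and any $\theta\in\mathbb{T}$. Let $H$ be the operator on $\ell^2(\mathbb{Z})$ given by $(Hu)_n=u_{n+1}+u_{n-1}+V(\theta+n\alpha)u_n$, with spectral measure $\mu$, and let $S\subset\mathbb{R}$ be a Borel set such that the Lyapunov exponent satisfies $L(E)>a$ for all $E\in S$. If $\gamma\in(0,1)$ satisfies $$\gamma>\frac{1}{1+\frac{c}{\beta(\alpha)}},$$ then the restriction $\mu_S$ of $\mu$ to $S$ is $\gamma$-spectral singular.
   Context: The spectral measure is $\mu=\mu_{\delta_0}+\mu_{\delta_1}$, where $\mu_{\delta_j}(B)=\langle\delta_j,\chi_B(H)\delta_j\rangle$. Lyapunov exponent (depending on $\alpha$): with $A(\theta,E)=\begin{pmatrix}E-V(\theta)&-1\\1&0\end{pmatrix}$ and $A_n(\theta,E)=A(\theta+n\alpha,E)\cdots A(\theta+\alpha,E)$, $L(E)=\lim_{n\to\infty}\frac1n\int_{\mathbb{T}}\log\|A_n(\theta,E)\|\,d\theta$. $\beta(\alpha)=\limsup_n\frac{\log q_{n+1}}{q_n}\in[0,\infty]$, where $p_n/q_n$ are the continued fraction approximants of $\alpha$. The expression $\frac{1}{1+c/\beta(\alpha)}$ is read as $0$ if $\beta(\alpha)=0$ and as $1$ if $\beta(\alpha)=\infty$. For a finite Borel measure $\mu$ on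 $\mathbb{R}$ let $M(E+i\varepsilon)=\int\frac{d\mu(E')}{E'-(E+i\varepsilon)}$. For $0<\gamma<1$, $\mu$ is $\gamma$-spectral singular if for $\mu$-a.e. $E$, $\liminf_{\varepsilon\downarrow0}\varepsilon^{1-\gamma}|M(E+i\varepsilon)|=+\infty$. *)

theory Defs
  imports "HOL-Analysis.Analysis"
begin

text \<open>Functions on the circle \<open>\<real>/\<int>\<close> are represented by 1-periodic functions on the real line.\<close>

definition periodic1 :: "(real \<Rightarrow> real) \<Rightarrow> bool" where
  "periodic1 f \<longleftrightarrow> (\<forall>x. f (x + 1) = f x)"

definition real_analytic :: "(real \<Rightarrow> real) \<Rightarrow> bool" where
  "real_analytic f \<longleftrightarrow>
     (\<forall>x0. \<exists>r>0. \<exists>c :: nat \<Rightarrow> real. \<forall>x. \<bar>x - x0\<bar> < r \<longrightarrow> (\<lambda>n. c n * (x - x0) ^ n) sums f x)"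

definition l2 :: "(int \<Rightarrow> complex) set" where
  "l2 = {u. (\<lambda>n. (cmod (u n))\<^sup>2) summable_on UNIV}"

definition l2_inner :: "(int \<Rightarrow> complex) \<Rightarrow> (int \<Rightarrow> complex) \<Rightarrow> complex" where
  "l2_inner u v = (\<Sum>\<^sub>\<infinity>n. cnj (u n) * v n)"

definition l2_norm :: "(int \<Rightarrow> complex) \<Rightarrow> real" where
  "l2_norm u = sqrt (\<Sum>\<^sub>\<infinity>n. (cmod (u n))\<^sup>2)"

definition delta :: "int \<Rightarrow> int \<Rightarrow> complex" where
  "delta j = (\<lambda>n. if n = j then 1 else 0)"

text \<open>Operators on \<open>\<ell>\<^sup>2(\<int>)\<close> are functions on sequences of which only the restriction to
  \<^const>\<open>l2\<close> is relevant.\<close>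

definition orthogonal_projection :: "((int \<Rightarrow> complex) \<Rightarrow> (int \<Rightarrow> complex)) \<Rightarrow> bool" where
  "orthogonal_projection Q \<longleftrightarrow>
     (\<forall>u\<in>l2. Q u \<in> l2) \<and>
     (\<forall>u\<in>l2. \<forall>v\<in>l2. \<forall>a b. Q (\<lambda>n. a * u n + b * v n) = (\<lambda>n. a * Q u n + b * Q v n)) \<and>
     (\<forall>u\<in>l2. Q (Q u) = Q u) \<and>
     (\<forall>u\<in>l2. \<forall>v\<in>l2. l2_inner u (Q v) = l2_inner (Q u) v)"

text \<open>Bounded projection-valued measures on the Borel sets of the real line, with countable
  additivity in the strong operator topology (Reed and Simon, Section VII.3).\<close>

definition projection_valued_measure ::
    "(real set \<Rightarrow> (int \<Rightarrow> complex) \<Rightarrow> (int \<Rightarrow> complex)) \<Rightarrow> bool" where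
  "projection_valued_measure P \<longleftrightarrow>
     (\<forall>B\<in>sets borel. orthogonal_projection (P B)) \<and>
     (\<forall>u\<in>l2. P {} u = (\<lambda>n. 0)) \<and>
     (\<exists>R>0. \<forall>u\<in>l2. P {-R<..<R} u = u) \<and>
     (\<forall>A\<in>sets borel. \<forall>B\<in>sets borel. \<forall>u\<in>l2. P (A \<inter> B) u = P A (P B u)) \<and>
     (\<forall>A :: nat \<Rightarrow> real set. range A \<subseteq> sets borel \<longrightarrow> disjoint_family A \<longrightarrow>
        (\<forall>u\<in>l2. (\<lambda>N. l2_norm (\<lambda>k. P (\<Union>i. A i) u k - (\<Sum>i<N. P (A i) u k)))
                   \<longlonglongrightarrow> 0))"

text \<open>The Borel measure \<open>B \<mapsto> \<langle>u, P(B) u\<rangle>\<close>.\<close>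

definition diag_measure ::
    "(real set \<Rightarrow> (int \<Rightarrow> complex) \<Rightarrow> (int \<Rightarrow> complex)) \<Rightarrow> (int \<Rightarrow> complex) \<Rightarrow> real measure" where
  "diag_measure P u = measure_of UNIV (sets borel) (\<lambda>B. ennreal (Re (l2_inner u (P B u))))"

text \<open>\<open>P\<close> is the spectral resolution \<open>B \<mapsto> \<chi>\<^sub>B(H)\<close> of the bounded self-adjoint operator \<open>H\<close>,
  that is, \<open>H = \<integral> E dP(E)\<close>. By the spectral theorem it exists and its restriction to
  \<^const>\<open>l2\<close> is unique.\<close>

definition spectral_resolution ::
    "((int \<Rightarrow> complex) \<Rightarrow> (int \<Rightarrow> complex)) \<Rightarrow>
     (real set \<Rightarrow> (int \<Rightarrow> complex) \<Rightarrow> (int \<Rightarrow> complex)) \<Rightarrow> bool" where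
  "spectral_resolution H P \<longleftrightarrow>
     projection_valued_measure P \<and>
     (\<forall>u\<in>l2. l2_inner u (H u) = of_real (\<integral>E. E \<partial>diag_measure P u))"

definition spectral_measure ::
    "(real set \<Rightarrow> (int \<Rightarrow> complex) \<Rightarrow> (int \<Rightarrow> complex)) \<Rightarrow> real measure" where
  "spectral_measure P =
     measure_of UNIV (sets borel)
       (\<lambda>B. emeasure (diag_measure P (delta 0)) B + emeasure (diag_measure P (delta 1)) B)"

definition borel_transform :: "real measure \<Rightarrow> complex \<Rightarrow> complex" where
  "borel_transform M z = (\<integral>E. 1 / (complex_of_real E - z) \<partial>M)"

definition spectral_singular :: "real \<Rightarrow> real measure \<Rightarrow> bool" where
  "spectral_singular \<gamma> M \<longleftrightarrow>
     (AE E in M. Liminf (at_right 0)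
        (\<lambda>\<epsilon>. ereal (\<epsilon> powr (1 - \<gamma>) * cmod (borel_transform M (Complex E \<epsilon>)))) = \<infinity>)"

text \<open>The measure \<open>B \<mapsto> M(B \<inter> S)\<close>, still on the whole line.\<close>

definition measure_restrict :: "real measure \<Rightarrow> real set \<Rightarrow> real measure" where
  "measure_restrict M S = density M (indicator S)"

definition schroedinger ::
    "(real \<Rightarrow> real) \<Rightarrow> real \<Rightarrow> real \<Rightarrow> (int \<Rightarrow> complex) \<Rightarrow> (int \<Rightarrow> complex)" where
  "schroedinger V \<alpha> \<theta> u =
     (\<lambda>n. u (n + 1) + u (n - 1) + of_real (V (\<theta> + of_int n * \<alpha>)) * u n)"

definition transfer_matrix :: "(real \<Rightarrow> real) \<Rightarrow> real \<Rightarrow> real \<Rightarrow> real^2^2" where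
  "transfer_matrix V \<theta> E = vector [vector [E - V \<theta>, -1], vector [1, 0]]"

primrec transfer_product :: "(real \<Rightarrow> real) \<Rightarrow> real \<Rightarrow> nat \<Rightarrow> real \<Rightarrow> real \<Rightarrow> real^2^2" where
  "transfer_product V \<alpha> 0 \<theta> E = mat 1"
| "transfer_product V \<alpha> (Suc n) \<theta> E =
     transfer_matrix V (\<theta> + real (Suc n) * \<alpha>) E ** transfer_product V \<alpha> n \<theta> E"

definition lyapunov :: "(real \<Rightarrow> real) \<Rightarrow> real \<Rightarrow> real \<Rightarrow> real" where
  "lyapunov V \<alpha> E =
     lim (\<lambda>n. 1 / real n *
        (LINT \<theta>:{0..1}|lborel. ln (onorm (\<lambda>x. transfer_product V \<alpha> n \<theta> E *v x))))"

text \<open>The complete quotients of an irrational number; their integer parts are the partial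
  quotients.\<close>

primrec complete_quotient :: "real \<Rightarrow> nat \<Rightarrow> real" where
  "complete_quotient \<alpha> 0 = \<alpha>"
| "complete_quotient \<alpha> (Suc n) = 1 / frac (complete_quotient \<alpha> n)"

definition partial_quotient :: "real \<Rightarrow> nat \<Rightarrow> int" where
  "partial_quotient \<alpha> n = \<lfloor>complete_quotient \<alpha> n\<rfloor>"

fun convergent_denom :: "real \<Rightarrow> nat \<Rightarrow> int" where
  "convergent_denom \<alpha> 0 = 1"
| "convergent_denom \<alpha> (Suc 0) = partial_quotient \<alpha> 1"
| "convergent_denom \<alpha> (Suc (Suc n)) =
     partial_quotient \<alpha> (Suc (Suc n)) * convergent_denom \<alpha> (Suc n) + convergent_denom \<alpha> n"

definition beta_exponent :: "real \<Rightarrow> ereal" where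
  "beta_exponent \<alpha> =
     limsup (\<lambda>n. ereal (ln (of_int (convergent_denom \<alpha> (Suc n))) / of_int (convergent_denom \<alpha> n)))"

text \<open>The number \<open>1 / (1 + c / b)\<close> with its limiting values at \<open>b = 0\<close> and \<open>b = \<infinity>\<close>.\<close>

definition singularity_threshold :: "real \<Rightarrow> ereal \<Rightarrow> real" where
  "singularity_threshold c b =
     (if b = 0 then 0 else if b = \<infinity> then 1 else 1 / (1 + c / real_of_ereal b))"

end

theory Submission
  imports Defs "HOL-Computational_Algebra.Polynomial" "HOL-Real_Asymp.Real_Asymp"
begin

text \<open>
  Write \<open>z = E + i\<epsilon>\<close>. The theorem asks for a lower bound of \<open>|M(z)|\<close> by a power of \<open>\<epsilon>\<close>, at almost
  every energy \<open>E\<close> of the spectral measure at which the Lyapunov exponent exceeds \<open>a\<close>. The imaginary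
  part of \<open>M(z)\<close> already satisfies it, because generalized eigenfunctions can be truncated well. For almost
  every \<open>E\<close> there is a solution \<open>u\<close> of \<open>Hu = Eu\<close> with \<open>|u(0)|\<close> or \<open>|u(1)|\<close> at least \<open>1 / 2\<close> whose
  square sum over \<open>[-l, l]\<close> is \<open>O(l\<^sup>1\<^sup>+\<^sup>\<sigma>)\<close> (\<open>generalized_eigenfunction\<close>).
  If \<open>f\<close> is supported in \<open>[-l, l]\<close>, bounded by \<open>|u|\<close>, agrees with \<open>u\<close> at \<open>0\<close>
  and \<open>1\<close>, and \<open>(H - E) f\<close> has norm at most \<open>\<epsilon>\<close> times the norm of \<open>u\<close> over \<open>[-l, l]\<close>, then writing
  \<open>u(j) = \<langle>\<delta>\<^sub>j, f\<rangle>\<close> as the inner product of a resolvent applied to \<open>\<delta>\<^sub>j\<close> with \<open>(H - z) f\<close> shows that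
  \<open>Im M(z)\<close> is at least of order \<open>1 / (\<epsilon> l\<^sup>1\<^sup>+\<^sup>\<sigma>)\<close> (\<open>resolvent_estimate\<close>,
  \<open>poisson_lower_bound_blocks\<close>). It remains to truncate at short lengths.

  Let \<open>q\<close> be the denominator of a convergent of \<open>\<alpha>\<close>. The mean over the circle of the logarithm of the
  norm of the transfer matrices of length \<open>k\<close> is at least \<open>a k\<close>. As \<open>V\<close> is analytic, the
  square of the Frobenius norm is, up to an error \<open>1\<close>, piecewise a polynomial of degree \<open>O(k)\<close>, so it
  cannot be small at all points of an orbit of length \<open>q\<close> if \<open>k\<close> is a small multiple of \<open>q\<close>: these points
  meet every interval of length \<open>3 / q\<close>, and there are too few roots to return to large values
  in most of these intervals (\<open>transfer_product_large_on_orbit\<close>). A solution on an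
  interval with an exponentially large transfer matrix must be exponentially small somewhere in it,
  relative to its size there (\<open>solution_small_somewhere\<close>).
  So in each block of \<open>2 q\<close> sites, \<open>u\<close> has a site at which it is smaller
  by the factor \<open>exp (- c q)\<close> than in the block, with a constant \<open>c\<close> depending only on \<open>V\<close> and \<open>a\<close>.
  Averaging the sharp truncations at these sites of \<open>N\<close> successive blocks gives
  \<open>(H - E) f\<close> of relative size \<open>exp (- c q) / N\<close> at the length \<open>l = 2 q N\<close>. With \<open>N\<close> about
  \<open>max 1 (exp (- c q) / \<epsilon>)\<close> this is at most \<open>\<epsilon>\<close>.

  If \<open>b > \<beta>(\<alpha>)\<close>, then \<open>q\<^sub>n\<^sub>+\<^sub>1 \<le> exp (b q\<^sub>n)\<close> for large \<open>n\<close>, and for every small \<open>\<epsilon>\<close> some \<open>n\<close> gives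
  a length \<open>l\<close> of at most \<open>\<epsilon> powr (- 1 / (1 + c / b))\<close> up to a logarithm (\<open>scale_selection\<close>). Here the
  threshold of the theorem appears: \<open>\<epsilon> powr (1 - \<gamma>) * Im M(z)\<close> tends to infinity if
  \<open>1 / (1 + c / b) < \<gamma>\<close> and \<open>\<sigma>\<close> is small. The passage from the spectral measure to its restriction to \<open>S\<close>
  costs an arbitrarily small power of \<open>\<epsilon>\<close> (\<open>poisson_comparison\<close>).
\<close>

section \<open>Continued fractions and orbits of rotations\<close>

fun convergent_num :: "real \<Rightarrow> nat \<Rightarrow> int" where
  "convergent_num \<alpha> 0 = partial_quotient \<alpha> 0"
| "convergent_num \<alpha> (Suc 0) = partial_quotient \<alpha> 1 * partial_quotient \<alpha> 0 + 1"
| "convergent_num \<alpha> (Suc (Suc n)) =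
     partial_quotient \<alpha> (Suc (Suc n)) * convergent_num \<alpha> (Suc n) + convergent_num \<alpha> n"

lemma complete_quotient_irrational:
  assumes "\<alpha> \<notin> \<rat>"
  shows "complete_quotient \<alpha> n \<notin> \<rat>"
proof (induction n)
  case (Suc n)
  have "frac (complete_quotient \<alpha> n) \<notin> \<rat>"
    using Suc by (metis Rats_add Rats_of_int add.commute diff_add_cancel frac_def)
  then have "inverse (frac (complete_quotient \<alpha> n)) \<notin> \<rat>"
    by (metis Rats_inverse inverse_inverse_eq)
  then show ?case by (simp add: inverse_eq_divide)
qed (use assms in auto)

lemma frac_complete_quotient_pos:
  assumes "\<alpha> \<notin> \<rat>"
  shows "frac (complete_quotient \<alpha> n) > 0"
  using complete_quotient_irrational[OF assms, of n]
  by (metis Ints_subset_Rats frac_gt_0_iff subsetD)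

lemma complete_quotient_gt_1:
  assumes "\<alpha> \<notin> \<rat>"
  shows "complete_quotient \<alpha> (Suc n) > 1"
  using frac_complete_quotient_pos[OF assms, of n] frac_lt_1[of "complete_quotient \<alpha> n"]
  by simp

lemma partial_quotient_ge_1:
  assumes "\<alpha> \<notin> \<rat>"
  shows "partial_quotient \<alpha> (Suc n) \<ge> 1"
  using complete_quotient_gt_1[OF assms, of n] unfolding partial_quotient_def
  by linarith

lemma convergent_denom_ge_1:
  assumes "\<alpha> \<notin> \<rat>"
  shows "convergent_denom \<alpha> n \<ge> 1"
proof (induction n rule: less_induct)
  case (less n)
  show ?case
  proof (cases "(\<alpha>, n)" rule: convergent_denom.cases)
    case (3 _ m)
    have "partial_quotient \<alpha> n * convergent_denom \<alpha> (Suc m) \<ge> 1 * 1"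
      using partial_quotient_ge_1[OF assms, of "Suc m"] less[of "Suc m"] 3
      by (intro mult_mono) auto
    then show ?thesis using 3 less[of m] by simp
  qed (use assms partial_quotient_ge_1[OF assms, of 0] in auto)
qed

lemma convergent_denom_Suc_ge:
  assumes "\<alpha> \<notin> \<rat>"
  shows "convergent_denom \<alpha> (Suc n) \<ge> convergent_denom \<alpha> n"
proof (cases n)
  case 0
  then show ?thesis using partial_quotient_ge_1[OF assms, of 0] by simp
next
  case (Suc m)
  have "partial_quotient \<alpha> (Suc n) * convergent_denom \<alpha> n \<ge> 1 * convergent_denom \<alpha> n"
    using partial_quotient_ge_1[OF assms, of n] convergent_denom_ge_1[OF assms, of n]
    by (intro mult_right_mono) auto
  then show ?thesis using Suc convergent_denom_ge_1[OF assms, of m] by simp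
qed

lemma convergent_denom_ge_index:
  assumes "\<alpha> \<notin> \<rat>"
  shows "convergent_denom \<alpha> n \<ge> int n"
proof (induction n)
  case (Suc n)
  show ?case
  proof (cases n)
    case 0
    then show ?thesis using partial_quotient_ge_1[OF assms, of 0] by simp
  next
    case (Suc m)
    have "partial_quotient \<alpha> (Suc n) * convergent_denom \<alpha> n \<ge> 1 * convergent_denom \<alpha> n"
      using partial_quotient_ge_1[OF assms, of n] convergent_denom_ge_1[OF assms, of n]
      by (intro mult_right_mono) auto
    moreover have "convergent_denom \<alpha> (Suc n)
        = partial_quotient \<alpha> (Suc n) * convergent_denom \<alpha> n + convergent_denom \<alpha> m"
      using Suc by simp
    ultimately show ?thesis using convergent_denom_ge_1[OF assms, of m] Suc.IH by linarith
  qed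
qed simp

lemma convergent_det:
  "convergent_num \<alpha> (Suc n) * convergent_denom \<alpha> n
     - convergent_num \<alpha> n * convergent_denom \<alpha> (Suc n) = (-1) ^ n"
proof (induction n)
  case (Suc n)
  then show ?case by (simp add: algebra_simps)
qed (simp add: algebra_simps)

lemma convergent_error_step:
  fixes \<alpha> :: real
  assumes "\<alpha> \<notin> \<rat>"
  shows "convergent_denom \<alpha> (Suc n) * \<alpha> - convergent_num \<alpha> (Suc n)
    = - frac (complete_quotient \<alpha> (Suc n)) * (convergent_denom \<alpha> n * \<alpha> - convergent_num \<alpha> n)"
proof (induction n)
  case 0
  have f: "frac \<alpha> > 0" using frac_complete_quotient_pos[OF assms, of 0] by simp
  have "of_int (partial_quotient \<alpha> 1) = 1 / frac \<alpha> - frac (1 / frac \<alpha>)"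
    by (simp add: partial_quotient_def frac_def)
  moreover have "of_int (partial_quotient \<alpha> 0) = \<alpha> - frac \<alpha>"
    by (simp add: partial_quotient_def frac_def)
  moreover have "convergent_denom \<alpha> 1 * \<alpha> - convergent_num \<alpha> 1
      = of_int (partial_quotient \<alpha> 1) * (\<alpha> - of_int (partial_quotient \<alpha> 0)) - 1"
    by (simp add: algebra_simps)
  ultimately have "convergent_denom \<alpha> 1 * \<alpha> - convergent_num \<alpha> 1
      = (1 / frac \<alpha> - frac (1 / frac \<alpha>)) * frac \<alpha> - 1"
    by simp
  also have "\<dots> = - frac (1 / frac \<alpha>) * frac \<alpha>" using f by (simp add: left_diff_distrib)
  finally show ?case by (simp add: partial_quotient_def frac_def)
next
  case (Suc n)
  define d where "d = (\<lambda>n. convergent_denom \<alpha> n * \<alpha> - convergent_num \<alpha> n)"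
  define x where "x = complete_quotient \<alpha> (Suc n)"
  have f: "frac x > 0" unfolding x_def by (rule frac_complete_quotient_pos[OF assms])
  have X: "complete_quotient \<alpha> (Suc (Suc n)) = 1 / frac x" by (simp add: x_def)
  have a: "of_int (partial_quotient \<alpha> (Suc (Suc n))) = 1 / frac x - frac (1 / frac x)"
    by (simp add: partial_quotient_def frac_def X del: complete_quotient.simps)
  have "d (Suc (Suc n)) = of_int (partial_quotient \<alpha> (Suc (Suc n))) * d (Suc n) + d n"
    by (simp add: d_def algebra_simps)
  moreover have IH: "d (Suc n) = - frac x * d n" using Suc by (simp add: d_def x_def)
  ultimately have "d (Suc (Suc n)) = (1 / frac x - frac (1 / frac x)) * d (Suc n) + d n"
    using a by simp
  also have "\<dots> = - frac (1 / frac x) * d (Suc n)" using f IH by (simp add: field_simps)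
  finally show ?case using X by (simp add: d_def)
qed

text \<open>Consecutive errors have opposite signs, so the determinant \<open>\<plusminus>1\<close> of two consecutive
  convergents is the sum of two terms of equal sign, the larger of which is
  \<open>q\<^sub>n\<^sub>+\<^sub>1 |q\<^sub>n \<alpha> - p\<^sub>n|\<close>.\<close>

lemma convergent_error:
  fixes \<alpha> :: real
  assumes "\<alpha> \<notin> \<rat>"
  shows "\<bar>convergent_denom \<alpha> n * \<alpha> - convergent_num \<alpha> n\<bar> < 1 / convergent_denom \<alpha> n"
proof -
  define d where "d = (\<lambda>n. convergent_denom \<alpha> n * \<alpha> - convergent_num \<alpha> n)"
  define q where "q = convergent_denom \<alpha>"
  define t where "t = frac (complete_quotient \<alpha> (Suc n))"
  have step: "d (Suc n) = - t * d n"
    unfolding d_def t_def by (rule convergent_error_step[OF assms])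
  have t: "t > 0" unfolding t_def by (rule frac_complete_quotient_pos[OF assms])
  have q: "q n \<ge> 1" "q (Suc n) \<ge> q n"
    using convergent_denom_ge_1[OF assms] convergent_denom_Suc_ge[OF assms] by (auto simp: q_def)
  have "real_of_int (q (Suc n)) * d n - q n * d (Suc n)
      = real_of_int (convergent_num \<alpha> (Suc n) * q n - convergent_num \<alpha> n * q (Suc n))"
    by (simp add: d_def q_def algebra_simps)
  also have "\<dots> = (-1) ^ n" unfolding q_def convergent_det by simp
  finally have "(q (Suc n) + q n * t) * d n = (-1) ^ n"
    using step by (simp add: algebra_simps)
  then have "\<bar>(q (Suc n) + q n * t) * d n\<bar> = 1" by (simp del: abs_mult)
  then have eq: "(q (Suc n) + q n * t) * \<bar>d n\<bar> = 1" using q t by (simp add: abs_mult)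
  then have "d n \<noteq> 0" by auto
  then have "q n * \<bar>d n\<bar> < (q (Suc n) + q n * t) * \<bar>d n\<bar>"
  proof (intro mult_strict_right_mono)
    have "real_of_int (q n) * t > 0" "real_of_int (q n) \<le> q (Suc n)" using q t by auto
    then show "real_of_int (q n) < q (Suc n) + q n * t" by linarith
  qed simp
  then show ?thesis using eq q by (simp add: d_def q_def field_simps)
qed

lemma coprime_convergent: "coprime (convergent_num \<alpha> n) (convergent_denom \<alpha> n)"
proof (rule coprimeI)
  fix c assume "c dvd convergent_num \<alpha> n" "c dvd convergent_denom \<alpha> n"
  then have "c dvd (-1) ^ n" unfolding convergent_det[of \<alpha> n, symmetric] by simp
  then show "is_unit c" by (metis dvd_trans is_unit_power_iff minus_dvd_iff dvd_refl)
qed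

text \<open>The multiples \<open>j p / q\<close> run through all multiples of \<open>1 / q\<close> modulo 1, and \<open>j \<alpha>\<close> differs from
  \<open>j p / q\<close> by less than \<open>1 / q\<close> for \<open>j < q\<close>.\<close>

lemma rotation_orbit_hits:
  fixes \<alpha> \<theta> x :: real and p q :: int
  assumes q: "q \<ge> 1" and co: "coprime p q" and appr: "\<bar>q * \<alpha> - p\<bar> < 1 / q"
  shows "\<exists>j m::int. 0 \<le> j \<and> j < q \<and> x \<le> \<theta> + j * \<alpha> + m \<and> \<theta> + j * \<alpha> + m < x + 3 / q"
proof -
  define r where "r = \<lceil>q * (x - \<theta>)\<rceil> + 1"
  obtain u v where uv: "u * p + v * q = 1"
    using bezout_int[of p q] co by (auto simp: coprime_iff_gcd_eq_1)
  define j where "j = (r * u) mod q"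
  define m where "m = (r * u) div q * p + r * v"
  have j: "0 \<le> j" "j < q" using q by (auto simp: j_def)
  have "j * p + m * q = ((r * u) div q * q + (r * u) mod q) * p + r * v * q"
    unfolding j_def m_def by (simp only: algebra_simps)
  also have "\<dots> = r * (u * p + v * q)" unfolding div_mult_mod_eq by (simp add: algebra_simps)
  finally have r: "j * p + m * q = r" using uv by simp
  have r2: "real_of_int j * p / q + m = r / q"
    using arg_cong[OF r, of real_of_int] q by (simp add: field_simps)
  have "\<bar>j * \<alpha> - j * p / q\<bar> = (j / q) * \<bar>q * \<alpha> - p\<bar>"
  proof -
    have "j * \<alpha> - j * p / q = (j / q) * (q * \<alpha> - p)" using q by (simp add: field_simps)
    then show ?thesis using q j by (simp add: abs_mult)
  qed
  also have "\<dots> \<le> 1 * \<bar>q * \<alpha> - p\<bar>" using j q by (intro mult_right_mono) auto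
  finally have e: "\<bar>j * \<alpha> - j * p / q\<bar> < 1 / q" using appr by simp
  have "r \<ge> q * (x - \<theta>) + 1" "r < q * (x - \<theta>) + 2" unfolding r_def by linarith+
  then have "(q * (x - \<theta>) + 1) / q \<le> r / q" "r / q < (q * (x - \<theta>) + 2) / q"
    using q by (auto intro: divide_right_mono divide_strict_right_mono)
  then have "r / q \<ge> x - \<theta> + 1 / q" "r / q < x - \<theta> + 2 / q"
    using q by (auto simp: add_divide_distrib)
  then have "x \<le> \<theta> + j * \<alpha> + m \<and> \<theta> + j * \<alpha> + m < x + 3 / q" using r2 e by (simp add: abs_less_iff)
  then show ?thesis using j by blast
qed

section \<open>Functions that are well approximated by polynomials\<close>

text \<open>A real-variable substitute for holomorphic functions bounded by \<open>K\<close> on a disc. The summands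
  are polynomials of degree at most \<open>n\<close> instead of monomials, so that the power series of an analytic
  function around one point can be used on intervals with nearby centres without
  expanding it again.\<close>

definition poly_series :: "real \<Rightarrow> real \<Rightarrow> (real \<Rightarrow> real) \<Rightarrow> bool" where
  "poly_series \<rho> K f \<longleftrightarrow>
     (\<exists>(p :: nat \<Rightarrow> real poly) b.
        (\<forall>n. degree (p n) \<le> n) \<and>
        (\<forall>n t. \<bar>t\<bar> \<le> \<rho> \<longrightarrow> \<bar>poly (p n) t\<bar> \<le> b n) \<and> (\<forall>n. 0 \<le> b n) \<and>
        summable (\<lambda>n. b n * 2 ^ n) \<and> (\<Sum>n. b n * 2 ^ n) \<le> K \<and>
        (\<forall>t. \<bar>t\<bar> \<le> \<rho> \<longrightarrow> (\<lambda>n. poly (p n) t) sums f t))"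

lemma poly_seriesI:
  assumes "\<And>n. degree (p n) \<le> n"
    and "\<And>n t. \<bar>t\<bar> \<le> \<rho> \<Longrightarrow> \<bar>poly (p n) t\<bar> \<le> b n" and "\<And>n. 0 \<le> b n"
    and "summable (\<lambda>n. b n * 2 ^ n)" and "(\<Sum>n. b n * 2 ^ n) \<le> K"
    and "\<And>t. \<bar>t\<bar> \<le> \<rho> \<Longrightarrow> (\<lambda>n. poly (p n) t) sums f t"
  shows "poly_series \<rho> K f"
  unfolding poly_series_def using assms by blast

lemma poly_series_mono:
  assumes "poly_series \<rho> K f" "\<rho>' \<le> \<rho>" "K \<le> K'"
  shows "poly_series \<rho>' K' f"
proof -
  obtain p b where "\<And>n. degree (p n) \<le> n"
    and "\<And>n t. \<bar>t\<bar> \<le> \<rho> \<Longrightarrow> \<bar>poly (p n) t\<bar> \<le> b n" and "\<And>n. 0 \<le> b n"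
    and "summable (\<lambda>n. b n * 2 ^ n)" and "(\<Sum>n. b n * 2 ^ n) \<le> K"
    and "\<And>t. \<bar>t\<bar> \<le> \<rho> \<Longrightarrow> (\<lambda>n. poly (p n) t) sums f t"
    using assms(1) unfolding poly_series_def by blast
  then show ?thesis using assms(2,3) by (intro poly_seriesI[of p _ b]) auto
qed

lemma poly_series_const:
  assumes "\<bar>c\<bar> \<le> K"
  shows "poly_series \<rho> K (\<lambda>t. c)"
proof (rule poly_seriesI[where p = "\<lambda>n. if n = 0 then [:c:] else 0" and b = "\<lambda>n. if n = 0 then \<bar>c\<bar> else 0"])
  have s: "(\<lambda>n. (if n = 0 then \<bar>c\<bar> else 0) * 2 ^ n) sums (\<bar>c\<bar> * 2 ^ 0)"
    using sums_If_finite_set[of "{0}" "\<lambda>n. \<bar>c\<bar> * 2 ^ n"] by (simp add: if_distrib[of "\<lambda>x. x * _"] cong: if_cong)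
  then show "summable (\<lambda>n. (if n = 0 then \<bar>c\<bar> else 0) * 2 ^ n)" by (rule sums_summable)
  show "(\<Sum>n. (if n = 0 then \<bar>c\<bar> else 0) * 2 ^ n) \<le> K" using sums_unique[OF s] assms by simp
  show "(\<lambda>n. poly (if n = 0 then [:c:] else 0) t) sums c" for t
    using sums_If_finite_set[of "{0}" "\<lambda>n. c"] by (simp add: if_distrib[of "\<lambda>p. poly p t"] cong: if_cong)
qed auto

lemma poly_series_add:
  assumes "poly_series \<rho> K f" "poly_series \<rho> L g"
  shows "poly_series \<rho> (K + L) (\<lambda>t. f t + g t)"
proof -
  obtain p b where p: "\<And>n. degree (p n) \<le> n"
    "\<And>n t. \<bar>t\<bar> \<le> \<rho> \<Longrightarrow> \<bar>poly (p n) t\<bar> \<le> b n" "\<And>n. 0 \<le> b n"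
    "summable (\<lambda>n. b n * 2 ^ n)" "(\<Sum>n. b n * 2 ^ n) \<le> K"
    "\<And>t. \<bar>t\<bar> \<le> \<rho> \<Longrightarrow> (\<lambda>n. poly (p n) t) sums f t"
    using assms(1) unfolding poly_series_def by blast
  obtain q c where q: "\<And>n. degree (q n) \<le> n"
    "\<And>n t. \<bar>t\<bar> \<le> \<rho> \<Longrightarrow> \<bar>poly (q n) t\<bar> \<le> c n" "\<And>n. 0 \<le> c n"
    "summable (\<lambda>n. c n * 2 ^ n)" "(\<Sum>n. c n * 2 ^ n) \<le> L"
    "\<And>t. \<bar>t\<bar> \<le> \<rho> \<Longrightarrow> (\<lambda>n. poly (q n) t) sums g t"
    using assms(2) unfolding poly_series_def by blast
  show ?thesis
  proof (rule poly_seriesI[where p = "\<lambda>n. p n + q n" and b = "\<lambda>n. b n + c n"])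
    show "\<bar>poly (p n + q n) t\<bar> \<le> b n + c n" if "\<bar>t\<bar> \<le> \<rho>" for n t
      using p(2)[OF that, of n] q(2)[OF that, of n] by simp
    show "summable (\<lambda>n. (b n + c n) * 2 ^ n)"
      using summable_add[OF p(4) q(4)] by (simp add: distrib_right)
    show "(\<Sum>n. (b n + c n) * 2 ^ n) \<le> K + L"
      using suminf_add[OF p(4) q(4)] p(5) q(5) by (simp add: distrib_right)
    show "(\<lambda>n. poly (p n + q n) t) sums (f t + g t)" if "\<bar>t\<bar> \<le> \<rho>" for t
      using sums_add[OF p(6)[OF that] q(6)[OF that]] by simp
  qed (use p q in \<open>auto intro: degree_add_le\<close>)
qed

text \<open>The weight \<open>2 ^ n\<close> is multiplicative in the degree, so Cauchy products do not
  increase the bound beyond the product of the bounds.\<close>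

lemma poly_series_mult:
  assumes "poly_series \<rho> K f" "poly_series \<rho> L g"
  shows "poly_series \<rho> (K * L) (\<lambda>t. f t * g t)"
proof -
  obtain p b where p: "\<And>n. degree (p n) \<le> n"
    "\<And>n t. \<bar>t\<bar> \<le> \<rho> \<Longrightarrow> \<bar>poly (p n) t\<bar> \<le> b n" "\<And>n. 0 \<le> b n"
    "summable (\<lambda>n. b n * 2 ^ n)" "(\<Sum>n. b n * 2 ^ n) \<le> K"
    "\<And>t. \<bar>t\<bar> \<le> \<rho> \<Longrightarrow> (\<lambda>n. poly (p n) t) sums f t"
    using assms(1) unfolding poly_series_def by blast
  obtain q c where q: "\<And>n. degree (q n) \<le> n"
    "\<And>n t. \<bar>t\<bar> \<le> \<rho> \<Longrightarrow> \<bar>poly (q n) t\<bar> \<le> c n" "\<And>n. 0 \<le> c n"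
    "summable (\<lambda>n. c n * 2 ^ n)" "(\<Sum>n. c n * 2 ^ n) \<le> L"
    "\<And>t. \<bar>t\<bar> \<le> \<rho> \<Longrightarrow> (\<lambda>n. poly (q n) t) sums g t"
    using assms(2) unfolding poly_series_def by blast
  define r where "r = (\<lambda>n. \<Sum>i\<le>n. p i * q (n - i))"
  define d where "d = (\<lambda>n. \<Sum>i\<le>n. b i * c (n - i))"
  have d2: "d n * 2 ^ n = (\<Sum>i\<le>n. (b i * 2 ^ i) * (c (n - i) * 2 ^ (n - i)))" for n
    unfolding d_def sum_distrib_right
    by (intro sum.cong refl) (simp add: mult.assoc mult.left_commute flip: power_add)
  have ds: "(\<lambda>n. d n * 2 ^ n) sums ((\<Sum>n. b n * 2 ^ n) * (\<Sum>n. c n * 2 ^ n))"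
    unfolding d2 using p q by (intro Cauchy_product_sums) auto
  have nn: "0 \<le> (\<Sum>n. b n * 2 ^ n)" "0 \<le> (\<Sum>n. c n * 2 ^ n)"
    using p q by (auto intro!: suminf_nonneg)
  have K0: "0 \<le> K" using nn p(5) by linarith
  have sm: "summable (\<lambda>n. norm (poly (p n) t))" "summable (\<lambda>n. norm (poly (q n) t))" if t: "\<bar>t\<bar> \<le> \<rho>" for t
  proof -
    have "norm (norm (poly (p n) t)) \<le> b n * 2 ^ n" for n
      using p(2)[OF t, of n] p(3)[of n] mult_left_mono[of 1 "2 ^ n" "b n"] by simp
    from summable_comparison_test'[OF p(4) this] show "summable (\<lambda>n. norm (poly (p n) t))" .
    have "norm (norm (poly (q n) t)) \<le> c n * 2 ^ n" for n
      using q(2)[OF t, of n] q(3)[of n] mult_left_mono[of 1 "2 ^ n" "c n"] by simp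
    from summable_comparison_test'[OF q(4) this] show "summable (\<lambda>n. norm (poly (q n) t))" .
  qed
  show ?thesis
  proof (rule poly_seriesI[where p = r and b = d])
    show "degree (r n) \<le> n" for n unfolding r_def
    proof (intro degree_sum_le)
      fix i assume "i \<in> {..n}"
      then show "degree (p i * q (n - i)) \<le> n"
        using degree_mult_le[of "p i" "q (n - i)"] p(1)[of i] q(1)[of "n - i"] by simp
    qed simp
    show "\<bar>poly (r n) t\<bar> \<le> d n" if t: "\<bar>t\<bar> \<le> \<rho>" for n t
      unfolding r_def d_def poly_sum poly_mult
      using p(2,3) q(2,3) t by (intro order_trans[OF sum_abs] sum_mono) (simp add: abs_mult mult_mono)
    show "0 \<le> d n" for n unfolding d_def using p(3) q(3) by (intro sum_nonneg) simp
    show "summable (\<lambda>n. d n * 2 ^ n)" using ds by (rule sums_summable)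
    show "(\<Sum>n. d n * 2 ^ n) \<le> K * L"
      unfolding sums_unique[OF ds, symmetric] by (intro mult_mono p(5) q(5) nn K0)
    show "(\<lambda>n. poly (r n) t) sums (f t * g t)" if t: "\<bar>t\<bar> \<le> \<rho>" for t
      unfolding r_def poly_sum poly_mult
      using Cauchy_product_sums[OF sm[OF t]] sums_unique[OF p(6)[OF t]] sums_unique[OF q(6)[OF t]] by simp
  qed
qed

text \<open>The factor \<open>2 ^ n\<close> in the bound is gained in the tail of the series.\<close>

lemma poly_series_bound:
  assumes "poly_series \<rho> K f" "\<bar>t\<bar> \<le> \<rho>"
  shows "\<exists>P :: real poly. degree P \<le> N \<and> (\<forall>t. \<bar>t\<bar> \<le> \<rho> \<longrightarrow> \<bar>f t - poly P t\<bar> \<le> K / 2 ^ N)"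
    and "\<bar>f t\<bar> \<le> K"
proof -
  obtain p b where p: "\<And>n. degree (p n) \<le> n"
    "\<And>n t. \<bar>t\<bar> \<le> \<rho> \<Longrightarrow> \<bar>poly (p n) t\<bar> \<le> b n" "\<And>n. 0 \<le> b n"
    "summable (\<lambda>n. b n * 2 ^ n)" "(\<Sum>n. b n * 2 ^ n) \<le> K"
    "\<And>t. \<bar>t\<bar> \<le> \<rho> \<Longrightarrow> (\<lambda>n. poly (p n) t) sums f t"
    using assms(1) unfolding poly_series_def by blast
  have main: "\<bar>f t - poly (\<Sum>n<N. p n) t\<bar> \<le> K / 2 ^ N" if t: "\<bar>t\<bar> \<le> \<rho>" for N t
  proof -
    have tail: "(\<lambda>n. poly (p (n + N)) t) sums (f t - (\<Sum>n<N. poly (p n) t))"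
      using sums_split_initial_segment[OF p(6)[OF t]] .
    have le: "norm (poly (p (n + N)) t) \<le> b (n + N) * 2 ^ (n + N) / 2 ^ N" for n
    proof -
      have "b (n + N) * 1 \<le> b (n + N) * 2 ^ n" using p(3) by (intro mult_left_mono) auto
      then show ?thesis using p(2)[OF t, of "n + N"] by (simp add: power_add)
    qed
    have s: "summable (\<lambda>n. b (n + N) * 2 ^ (n + N) / 2 ^ N)"
      by (intro summable_divide summable_ignore_initial_segment p(4))
    have "\<bar>f t - poly (\<Sum>n<N. p n) t\<bar> = norm (\<Sum>n. poly (p (n + N)) t)"
      using sums_unique[OF tail] by (simp add: poly_sum)
    also have "\<dots> \<le> (\<Sum>n. b (n + N) * 2 ^ (n + N) / 2 ^ N)" by (rule norm_suminf_le[OF le s])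
    also have "\<dots> = (\<Sum>n. b (n + N) * 2 ^ (n + N)) / 2 ^ N"
      by (intro suminf_divide summable_ignore_initial_segment p(4))
    also have "\<dots> \<le> K / 2 ^ N"
    proof (intro divide_right_mono)
      have "(\<Sum>n. b n * 2 ^ n) = (\<Sum>n. b (n + N) * 2 ^ (n + N)) + (\<Sum>n<N. b n * 2 ^ n)"
        by (rule suminf_split_initial_segment[OF p(4)])
      moreover have "0 \<le> (\<Sum>n<N. b n * 2 ^ n)" using p(3) by (intro sum_nonneg) auto
      ultimately show "(\<Sum>n. b (n + N) * 2 ^ (n + N)) \<le> K" using p(5) by linarith
    qed simp
    finally show ?thesis .
  qed
  show "\<exists>P :: real poly. degree P \<le> N \<and> (\<forall>t. \<bar>t\<bar> \<le> \<rho> \<longrightarrow> \<bar>f t - poly P t\<bar> \<le> K / 2 ^ N)"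
  proof (intro exI conjI allI impI)
    show "degree (\<Sum>n<N. p n) \<le> N" using p(1)
      by (intro degree_sum_le) (auto intro: order_trans[OF _ less_imp_le])
  qed (rule main)
  show "\<bar>f t\<bar> \<le> K" using main[OF assms(2), of 0] by simp
qed

lemma real_analytic_poly_series_local:
  assumes "real_analytic V"
  shows "\<exists>\<rho> K. \<rho> > 0 \<and> (\<forall>y. \<bar>y - x0\<bar> < \<rho> \<longrightarrow> poly_series \<rho> K (\<lambda>t. V (y + t)))"
proof -
  obtain r c where r: "r > 0" and c: "\<And>x. \<bar>x - x0\<bar> < r \<Longrightarrow> (\<lambda>n. c n * (x - x0) ^ n) sums V x"
    using assms unfolding real_analytic_def by blast
  define \<rho> where "\<rho> = r / 8"
  have "summable (\<lambda>n. c n * (3 / 4 * r) ^ n)"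
    using c[of "x0 + 3 / 4 * r"] r by (auto simp: sums_iff)
  then have "summable (\<lambda>n. norm (c n * (r / 2) ^ n))" using r by (intro powser_insidea) auto
  then have s: "summable (\<lambda>n. (\<bar>c n\<bar> * (r / 4) ^ n) * 2 ^ n)"
    using r by (simp add: abs_mult mult.assoc flip: power_mult_distrib)
  have "poly_series \<rho> (\<Sum>n. (\<bar>c n\<bar> * (r / 4) ^ n) * 2 ^ n) (\<lambda>t. V (y + t))" if y: "\<bar>y - x0\<bar> < \<rho>" for y
  proof (rule poly_seriesI[where p = "\<lambda>n. smult (c n) ([:y - x0, 1:] ^ n)" and b = "\<lambda>n. \<bar>c n\<bar> * (r / 4) ^ n"])
    show "degree (smult (c n) ([:y - x0, 1:] ^ n)) \<le> n" for n
      using degree_power_le[of "[:y - x0, 1:]" n] degree_smult_le[of "c n"] by (simp add: order_trans)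
    show "\<bar>poly (smult (c n) ([:y - x0, 1:] ^ n)) t\<bar> \<le> \<bar>c n\<bar> * (r / 4) ^ n" if "\<bar>t\<bar> \<le> \<rho>" for n t
    proof -
      have "\<bar>y - x0 + t\<bar> \<le> r / 4" using y that unfolding \<rho>_def by linarith
      then have "\<bar>y - x0 + t\<bar> ^ n \<le> (r / 4) ^ n" by (intro power_mono) auto
      then show ?thesis by (simp add: abs_mult power_abs mult_left_mono)
    qed
    show "(\<lambda>n. poly (smult (c n) ([:y - x0, 1:] ^ n)) t) sums V (y + t)" if "\<bar>t\<bar> \<le> \<rho>" for t
    proof -
      have "\<bar>y + t - x0\<bar> < r" using y that r unfolding \<rho>_def by linarith
      then show ?thesis using c[of "y + t"] by (simp add: algebra_simps)
    qed
  qed (use s r in auto)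
  moreover have "\<rho> > 0" using r by (simp add: \<rho>_def)
  ultimately show ?thesis by blast
qed

lemma periodic1_of_int:
  assumes "periodic1 V"
  shows "V (x + of_int m) = V x"
proof -
  have nat: "V (x + real n) = V x" for n x
  proof (induction n)
    case (Suc n)
    have "V (x + real (Suc n)) = V ((x + real n) + 1)" by (simp add: algebra_simps)
    also have "\<dots> = V x" using assms Suc unfolding periodic1_def by simp
    finally show ?case .
  qed simp
  show ?thesis
  proof (cases "m \<ge> 0")
    case True
    then show ?thesis using nat[of x "nat m"] by simp
  next
    case False
    then show ?thesis using nat[of "x + of_int m" "nat (- m)"] by simp
  qed
qed

text \<open>By compactness of the circle, finitely many local expansions suffice, which makes the
  radius and the bound uniform.\<close>

lemma real_analytic_poly_series:
  assumes "real_analytic V" "periodic1 V"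
  shows "\<exists>\<rho> K. \<rho> > 0 \<and> (\<forall>y. poly_series \<rho> K (\<lambda>t. V (y + t)))"
proof -
  obtain \<rho> K where \<rho>: "\<And>x0. \<rho> x0 > 0"
    and K: "\<And>x0 y. \<bar>y - x0\<bar> < \<rho> x0 \<Longrightarrow> poly_series (\<rho> x0) (K x0) (\<lambda>t. V (y + t))"
    using real_analytic_poly_series_local[OF assms(1)] by metis
  have cover: "{0..1} \<subseteq> (\<Union>x\<in>{0..1::real}. ball x (\<rho> x))"
  proof
    fix y :: real assume "y \<in> {0..1}"
    then show "y \<in> (\<Union>x\<in>{0..1}. ball x (\<rho> x))" using \<rho>[of y] by (intro UN_I[of y]) simp_all
  qed
  obtain T where T: "T \<subseteq> {0..1::real}" "finite T" "{0..1} \<subseteq> (\<Union>x\<in>T. ball x (\<rho> x))"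
    by (rule compactE_image[OF compact_Icc _ cover]) (auto intro: that)
  have ne: "T \<noteq> {}"
  proof
    assume "T = {}"
    then have "{0..1::real} \<subseteq> {}" using T(3) by simp
    then show False by simp
  qed
  have "poly_series (Min (\<rho> ` T)) (Max (K ` T)) (\<lambda>t. V (y + t))" for y
  proof -
    have "frac y \<in> {0..1}" using frac_lt_1[of y] by (simp add: less_imp_le)
    then obtain x where x: "x \<in> T" "\<bar>frac y - x\<bar> < \<rho> x"
      using subsetD[OF T(3), of "frac y"] by (auto simp: dist_real_def abs_minus_commute)
    have "poly_series (Min (\<rho> ` T)) (Max (K ` T)) (\<lambda>t. V (frac y + t))"
      using x T by (intro poly_series_mono[OF K[OF x(2)]]) auto
    moreover have "V (frac y + t) = V (y + t)" for t
      using periodic1_of_int[OF assms(2), of "frac y + t" "\<lfloor>y\<rfloor>"] by (simp add: frac_def)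
    ultimately show ?thesis by simp
  qed
  moreover have "Min (\<rho> ` T) > 0" using T ne \<rho> by simp
  ultimately show ?thesis by blast
qed

section \<open>Transfer matrices and the Lyapunov exponent\<close>

definition frobenius_sq :: "real^2^2 \<Rightarrow> real" where
  "frobenius_sq A = (A$1$1)\<^sup>2 + (A$1$2)\<^sup>2 + (A$2$1)\<^sup>2 + (A$2$2)\<^sup>2"

abbreviation opnorm :: "real^2^2 \<Rightarrow> real" where
  "opnorm A \<equiv> onorm (\<lambda>x. A *v x)"

lemma transfer_matrix_nth:
  "transfer_matrix V \<theta> E $ 1 $ 1 = E - V \<theta>" "transfer_matrix V \<theta> E $ 1 $ 2 = -1"
  "transfer_matrix V \<theta> E $ 2 $ 1 = 1" "transfer_matrix V \<theta> E $ 2 $ 2 = 0"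
  by (simp_all add: transfer_matrix_def)

lemma transfer_product_Suc_nth:
  "transfer_product V \<alpha> (Suc n) \<theta> E $ 1 $ j =
     (E - V (\<theta> + real (Suc n) * \<alpha>)) * transfer_product V \<alpha> n \<theta> E $ 1 $ j
       - transfer_product V \<alpha> n \<theta> E $ 2 $ j"
  "transfer_product V \<alpha> (Suc n) \<theta> E $ 2 $ j = transfer_product V \<alpha> n \<theta> E $ 1 $ j"
  by (simp_all add: matrix_matrix_mult_def sum_2 transfer_matrix_nth)

lemma det_transfer_product: "det (transfer_product V \<alpha> n \<theta> E) = 1"
proof (induction n)
  case (Suc n)
  then show ?case by (simp add: det_mul) (simp add: det_2 transfer_matrix_nth)
qed simp

lemma transfer_product_add:
  "transfer_product V \<alpha> (m + n) \<theta> E = transfer_product V \<alpha> n (\<theta> + real m * \<alpha>) E ** transfer_product V \<alpha> m \<theta> E"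
  by (induction n) (simp_all add: algebra_simps flip: matrix_mul_assoc)

lemma norm_mult_vec2_le: "norm ((A :: real^2^2) *v x) \<le> sqrt (frobenius_sq A) * norm x"
proof -
  have cs: "(a * x$1 + b * x$2)\<^sup>2 \<le> (a\<^sup>2 + b\<^sup>2) * ((x$1)\<^sup>2 + (x$2)\<^sup>2)" for a b
  proof -
    have "(a\<^sup>2 + b\<^sup>2) * ((x$1)\<^sup>2 + (x$2)\<^sup>2) - (a * x$1 + b * x$2)\<^sup>2 = (a * x$2 - b * x$1)\<^sup>2"
      by (simp add: power2_eq_square algebra_simps)
    then show ?thesis by (metis diff_ge_0_iff_ge zero_le_power2)
  qed
  have n: "norm v = sqrt ((v$1)\<^sup>2 + (v$2)\<^sup>2)" for v :: "real^2"
    by (simp add: norm_vec_def L2_set_def sum_2)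
  have "((A *v x)$1)\<^sup>2 + ((A *v x)$2)\<^sup>2 \<le> frobenius_sq A * ((x$1)\<^sup>2 + (x$2)\<^sup>2)"
    using cs[of "A$1$1" "A$1$2"] cs[of "A$2$1" "A$2$2"]
    by (simp add: matrix_vector_mult_def sum_2 frobenius_sq_def algebra_simps)
  then show ?thesis unfolding n real_sqrt_mult[symmetric] by (rule real_sqrt_le_mono)
qed

lemma opnorm_le_frobenius: "opnorm A \<le> sqrt (frobenius_sq A)"
  by (rule onorm_bound[OF _ norm_mult_vec2_le]) (simp add: frobenius_sq_def)

lemma bounded_linear_mult_vec2: "bounded_linear (\<lambda>x. (A :: real^2^2) *v x)"
  by (rule matrix_vector_mul_bounded_linear)

lemma opnorm_ge_1:
  assumes "det A = 1"
  shows "opnorm A \<ge> 1"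
proof (rule ccontr)
  assume c: "\<not> 1 \<le> opnorm A"
  have pos: "opnorm A \<ge> 0" by (rule onorm_pos_le[OF bounded_linear_mult_vec2])
  have col: "(A$1$i)\<^sup>2 + (A$2$i)\<^sup>2 < 1" for i
  proof -
    have "norm (A *v axis i 1) \<le> opnorm A * norm (axis i 1 :: real^2)"
      by (rule onorm[OF bounded_linear_mult_vec2])
    then have "norm (A *v axis i 1) < 1" using c by (simp add: norm_axis_1)
    then have "(norm (A *v axis i 1))\<^sup>2 < 1" by (simp add: abs_square_less_1)
    moreover have "(norm (A *v axis i 1))\<^sup>2 = (A$1$i)\<^sup>2 + (A$2$i)\<^sup>2"
      by (simp add: norm_vec_def L2_set_def sum_2 matrix_vector_mult_basis column_def)
    ultimately show ?thesis by simp
  qed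
  have "A$1$1 * A$2$2 - A$1$2 * A$2$1 = 1" using assms by (simp add: det_2)
  moreover have "2 * (A$1$1 * A$2$2) \<le> (A$1$1)\<^sup>2 + (A$2$2)\<^sup>2"
    using sum_squares_bound[of "A$1$1" "A$2$2"] by simp
  moreover have "- (2 * (A$1$2 * A$2$1)) \<le> (A$1$2)\<^sup>2 + (A$2$1)\<^sup>2"
    using sum_squares_bound[of "- A$1$2" "A$2$1"] by simp
  ultimately show False using col[of 1] col[of 2] by linarith
qed

lemma opnorm_mult_le: "opnorm (A ** B) \<le> opnorm A * opnorm B"
  using onorm_compose[OF bounded_linear_mult_vec2[of A] bounded_linear_mult_vec2[of B]]
  by (simp add: matrix_vector_mul_assoc o_def)

lemma opnorm_diff_le: "\<bar>opnorm A - opnorm B\<bar> \<le> sqrt (frobenius_sq (A - B))"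
proof -
  have t: "opnorm A \<le> opnorm B + sqrt (frobenius_sq (A - B))" for A B
  proof -
    have "opnorm A = onorm (\<lambda>x. B *v x + (A - B) *v x)"
      by (simp add: matrix_vector_mult_diff_rdistrib)
    also have "\<dots> \<le> opnorm B + opnorm (A - B)"
      by (rule onorm_triangle[OF bounded_linear_mult_vec2 bounded_linear_mult_vec2])
    finally show ?thesis using opnorm_le_frobenius[of "A - B"] by simp
  qed
  have "frobenius_sq (A - B) = frobenius_sq (B - A)"
    by (simp add: frobenius_sq_def power2_commute)
  then show ?thesis using t[of A B] t[of B A] by (simp add: abs_le_iff)
qed

lemma frobenius_transfer_ge_1: "frobenius_sq (transfer_product V \<alpha> n \<theta> E) \<ge> 1"
  using opnorm_ge_1[OF det_transfer_product] opnorm_le_frobenius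
  by (metis order_trans real_sqrt_ge_1_iff)

lemma real_analytic_continuous:
  assumes "real_analytic V"
  shows "continuous_on UNIV V"
proof -
  have "isCont V x0" for x0
  proof -
    obtain r c where r: "r > 0" and c: "\<And>x. \<bar>x - x0\<bar> < r \<Longrightarrow> (\<lambda>n. c n * (x - x0) ^ n) sums V x"
      using assms unfolding real_analytic_def by blast
    have "(\<lambda>n. c n * (r / 2) ^ n) sums V (x0 + r / 2)" using c[of "x0 + r / 2"] r by simp
    then have "summable (\<lambda>n. c n * (r / 2) ^ n)" by (rule sums_summable)
    then have "isCont (\<lambda>h. \<Sum>n. c n * h ^ n) 0" by (rule isCont_powser) (use r in simp)
    moreover have "isCont (\<lambda>x. x - x0) x0" by simp
    ultimately have "isCont (\<lambda>x. \<Sum>n. c n * (x - x0) ^ n) x0"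
      using isCont_o2[of x0 "\<lambda>x. x - x0" "\<lambda>h. \<Sum>n. c n * h ^ n"] by simp
    moreover have "\<forall>\<^sub>F x in nhds x0. V x = (\<Sum>n. c n * (x - x0) ^ n)"
      unfolding eventually_nhds_metric
    proof (intro exI[of _ r] conjI r allI impI)
      fix x assume "dist x x0 < r"
      then show "V x = (\<Sum>n. c n * (x - x0) ^ n)"
        by (intro sums_unique c) (simp add: dist_real_def)
    qed
    ultimately show ?thesis by (simp add: isCont_cong)
  qed
  then show ?thesis by (simp add: continuous_on_eq_continuous_at)
qed

lemma continuous_transfer_product_nth:
  assumes "continuous_on UNIV V"
  shows "continuous_on UNIV (\<lambda>\<theta>. transfer_product V \<alpha> n \<theta> E $ i $ j)"
proof (induction n arbitrary: i)
  case (Suc n)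
  have "continuous_on UNIV (\<lambda>\<theta>. V (\<theta> + real (Suc n) * \<alpha>))"
    by (rule continuous_on_compose2[OF assms]) (auto intro!: continuous_intros)
  then have "continuous_on UNIV (\<lambda>\<theta>. transfer_product V \<alpha> (Suc n) \<theta> E $ 1 $ j)"
    unfolding transfer_product_Suc_nth
    by (intro continuous_on_diff continuous_on_mult continuous_on_const Suc)
  moreover have "continuous_on UNIV (\<lambda>\<theta>. transfer_product V \<alpha> (Suc n) \<theta> E $ 2 $ j)"
    unfolding transfer_product_Suc_nth by (rule Suc)
  ultimately show ?case using exhaust_2[of i] by auto
qed simp

lemma continuous_ln_opnorm:
  assumes "continuous_on UNIV V"
  shows "continuous_on UNIV (\<lambda>\<theta>. ln (opnorm (transfer_product V \<alpha> n \<theta> E)))"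
proof -
  let ?T = "\<lambda>\<theta>. transfer_product V \<alpha> n \<theta> E"
  have "isCont (\<lambda>\<theta>. opnorm (?T \<theta>)) x" for x
  proof -
    have c: "isCont (\<lambda>\<theta>. ?T \<theta> $ i $ j) x" for i j
      using continuous_transfer_product_nth[OF assms] by (simp add: continuous_on_eq_continuous_at)
    have "isCont (\<lambda>\<theta>. sqrt (frobenius_sq (?T \<theta> - ?T x))) x"
      unfolding frobenius_sq_def by (auto intro!: continuous_intros c)
    then have "((\<lambda>\<theta>. sqrt (frobenius_sq (?T \<theta> - ?T x))) \<longlongrightarrow> 0) (at x)"
      unfolding isCont_def by (simp add: frobenius_sq_def)
    then have "((\<lambda>\<theta>. opnorm (?T \<theta>) - opnorm (?T x)) \<longlongrightarrow> 0) (at x)"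
      by (rule Lim_null_comparison[rotated]) (simp add: opnorm_diff_le)
    then show ?thesis unfolding isCont_def by (simp add: LIM_zero_cancel)
  qed
  then have "continuous_on UNIV (\<lambda>\<theta>. opnorm (?T \<theta>))" by (simp add: continuous_on_eq_continuous_at)
  moreover have "opnorm (?T \<theta>) \<noteq> 0" for \<theta>
    using opnorm_ge_1[OF det_transfer_product, of V \<alpha> n \<theta> E] by linarith
  ultimately show ?thesis by (intro continuous_on_ln) auto
qed

lemma transfer_product_periodic:
  assumes "periodic1 V"
  shows "transfer_product V \<alpha> n (\<theta> + of_int m) E = transfer_product V \<alpha> n \<theta> E"
proof (induction n)
  case (Suc n)
  have "V (\<theta> + of_int m + x) = V (\<theta> + x)" for x
    using periodic1_of_int[OF assms, of "\<theta> + x" m] by (simp add: algebra_simps)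
  then show ?case using Suc by (simp add: transfer_matrix_def)
qed simp

lemma integral_periodic_shift:
  fixes g :: "real \<Rightarrow> real"
  assumes g: "continuous_on UNIV g" and per: "\<And>x m. g (x + of_int m) = g x"
  shows "integral {0..1} (\<lambda>x. g (x + s)) = integral {0..1} g"
proof -
  have int: "g integrable_on {a..b}" for a b
    by (rule integrable_continuous_real) (rule continuous_on_subset[OF g], simp)
  have sh: "integral {a..b} (\<lambda>x. g (x + t)) = integral {a + t..b + t} g" for a b t
    using Henstock_Kurzweil_Integration.integral_shift[of a t b g] continuous_on_subset[OF g] by (simp add: o_def)
  define t where "t = frac s"
  have t: "0 \<le> t" "t \<le> 1" using frac_lt_1[of s] by (auto simp: t_def less_imp_le)
  have "g (x + s) = g (x + t)" for x
    using per[of "x + t" "\<lfloor>s\<rfloor>"] by (simp add: t_def frac_def)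
  then have "integral {0..1} (\<lambda>x. g (x + s)) = integral {t..1 + t} g" using sh[of 0 1 t] by simp
  also have "\<dots> = integral {t..1} g + integral {1..1 + t} g"
    using t by (intro Henstock_Kurzweil_Integration.integral_combine[symmetric] int) auto
  also have "integral {1..1 + t} g = integral {0..t} (\<lambda>x. g (x + of_int 1))"
    using sh[of 0 t 1] by (simp add: add.commute)
  also have "\<dots> = integral {0..t} g" using per[of _ 1] by simp
  also have "integral {t..1} g + integral {0..t} g = integral {0..1} g"
    using t by (subst add.commute) (intro Henstock_Kurzweil_Integration.integral_combine int; simp)
  finally show ?thesis .
qed

text \<open>Fekete's lemma: if \<open>a k / k\<close> is close to the infimum, division of \<open>n\<close> by \<open>k\<close> with remainder
  bounds \<open>a n / n\<close> by \<open>a k / k\<close> up to an error \<open>O(1 / n)\<close>.\<close>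

lemma subadditive_convergent:
  fixes a :: "nat \<Rightarrow> real"
  assumes sub: "\<And>m n. a (m + n) \<le> a m + a n" and nn: "\<And>n. 0 \<le> a n"
  shows "(\<lambda>n. a n / n) \<longlonglongrightarrow> (INF k\<in>{1..}. a k / k)"
proof -
  define l where "l = (INF k\<in>{1..}. a k / k)"
  have bdd: "bdd_below ((\<lambda>k. a k / real k) ` {1..})" using nn by (intro bdd_belowI[of _ 0]) auto
  have lower: "l \<le> a k / k" if "k \<ge> 1" for k
    unfolding l_def using that by (intro cINF_lower[OF bdd]) auto
  have mult: "a (m * k + r) \<le> m * a k + a r" for m k r
  proof (induction m)
    case (Suc m)
    have "a (Suc m * k + r) \<le> a k + a (m * k + r)" using sub[of k "m * k + r"] by (simp add: add.assoc)
    then show ?case using Suc by (simp add: algebra_simps)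
  qed simp
  have upper: "\<forall>\<^sub>F n in sequentially. a n / n < l + e" if e: "e > 0" for e
  proof -
    have "\<exists>k\<in>{1..}. a k / real k < l + e / 2"
      using e cINF_less_iff[OF _ bdd, of "l + e / 2"] unfolding l_def by auto
    then obtain k where k: "k \<ge> 1" "a k / real k < l + e / 2" by auto
    define M where "M = (\<Sum>r<k. a r)"
    have M: "a r \<le> M" if "r < k" for r unfolding M_def using that nn by (intro member_le_sum) auto
    have "(\<lambda>n. M / real n) \<longlonglongrightarrow> 0" by (rule lim_const_over_n)
    then have "\<forall>\<^sub>F n in sequentially. M / real n < e / 2"
      using e by (intro order_tendstoD) auto
    then show ?thesis using eventually_ge_at_top[of 1]
    proof eventually_elim
      case (elim n)
      have "a n \<le> (n div k) * a k + a (n mod k)" using mult[of "n div k" k "n mod k"] by simp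
      also have "\<dots> \<le> (n div k) * (k * (l + e / 2)) + M"
        using k M[of "n mod k"] by (intro add_mono mult_left_mono) (auto simp: field_simps)
      also have "(n div k) * (k * (l + e / 2)) = real (n div k * k) * (l + e / 2)" by simp
      also have "\<dots> \<le> n * (l + e / 2)"
      proof (intro mult_right_mono)
        show "real (n div k * k) \<le> n" by (simp only: of_nat_le_iff div_times_less_eq_dividend)
        have "0 \<le> a k / k" using nn[of k] by simp
        then show "0 \<le> l + e / 2" using k(2) by linarith
      qed
      finally have "a n / n \<le> (l + e / 2) + M / n" using elim by (simp add: field_simps)
      then show ?case using elim(1) by linarith
    qed
  qed
  show ?thesis unfolding l_def[symmetric]
  proof (rule LIMSEQ_I)
    fix e :: real assume e: "e > 0"
    have "\<forall>\<^sub>F n in sequentially. norm (a n / n - l) < e"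
      using upper[OF e] eventually_ge_at_top[of 1]
    proof eventually_elim
      case (elim n)
      then show ?case using lower[of n] e by (simp add: abs_if)
    qed
    then show "\<exists>no. \<forall>n\<ge>no. norm (a n / n - l) < e" by (simp add: eventually_sequentially)
  qed
qed

text \<open>By subadditivity the Lyapunov exponent is an infimum, so at every finite scale the mean of
  the logarithm of the norm is at least the exponent.\<close>

lemma lyapunov_le_mean:
  assumes V: "continuous_on UNIV V" and per: "periodic1 V" and k: "k \<ge> 1"
  shows "lyapunov V \<alpha> E * k \<le> (LINT \<theta>:{0..1}|lborel. ln (opnorm (transfer_product V \<alpha> k \<theta> E)))"
proof -
  define h where "h = (\<lambda>n \<theta>. ln (opnorm (transfer_product V \<alpha> n \<theta> E)))"
  have cont: "continuous_on UNIV (h n)" for n unfolding h_def by (rule continuous_ln_opnorm[OF V])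
  have int: "(\<lambda>\<theta>. h n (\<theta> + s)) integrable_on {0..1}" for n s
    by (rule integrable_continuous_real, rule continuous_on_compose2[OF cont, of "{0..1}" "\<lambda>\<theta>. \<theta> + s"])
      (auto intro: continuous_on_add)
  have per_h: "h n (\<theta> + of_int m) = h n \<theta>" for n \<theta> m
    unfolding h_def by (simp add: transfer_product_periodic[OF per])
  define a where "a = (\<lambda>n. integral {0..1} (h n))"
  have eq: "(LINT \<theta>:{0..1}|lborel. h n \<theta>) = a n" for n
    unfolding a_def
    by (rule set_borel_integral_eq_integral(2)[OF borel_integrable_atLeastAtMost'[OF continuous_on_subset[OF cont subset_UNIV]]])
  have "h (m + n) \<theta> \<le> h m \<theta> + h n (\<theta> + real m * \<alpha>)" for m n \<theta>
  proof -
    have g: "opnorm (transfer_product V \<alpha> n \<theta> E) \<ge> 1" for n \<theta> by (rule opnorm_ge_1[OF det_transfer_product])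
    have "ln (opnorm (transfer_product V \<alpha> (m + n) \<theta> E))
        \<le> ln (opnorm (transfer_product V \<alpha> n (\<theta> + real m * \<alpha>) E) * opnorm (transfer_product V \<alpha> m \<theta> E))"
    proof (intro ln_mono)
      show "opnorm (transfer_product V \<alpha> (m + n) \<theta> E)
          \<le> opnorm (transfer_product V \<alpha> n (\<theta> + real m * \<alpha>) E) * opnorm (transfer_product V \<alpha> m \<theta> E)"
        unfolding transfer_product_add by (rule opnorm_mult_le)
      show "0 < opnorm (transfer_product V \<alpha> (m + n) \<theta> E)" using g[of "m + n" \<theta>] by linarith
    qed
    also have "\<dots> = h n (\<theta> + real m * \<alpha>) + h m \<theta>"
      unfolding h_def using g[of n "\<theta> + real m * \<alpha>"] g[of m \<theta>] by (intro ln_mult_pos) linarith+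
    finally show ?thesis unfolding h_def by linarith
  qed
  then have le: "h (m + n) \<theta> \<le> h m \<theta> + h n (\<theta> + real m * \<alpha>)" for m n \<theta> .
  have int0: "h n integrable_on {0..1}" for n using int[of n 0] by simp
  have sub: "a (m + n) \<le> a m + a n" for m n
  proof -
    have "a (m + n) \<le> integral {0..1} (\<lambda>\<theta>. h m \<theta> + h n (\<theta> + real m * \<alpha>))"
      unfolding a_def by (rule integral_le[OF int0 integrable_add[OF int0 int] le])
    also have "\<dots> = a m + integral {0..1} (\<lambda>\<theta>. h n (\<theta> + real m * \<alpha>))"
      unfolding a_def by (rule integral_add[OF int0 int])
    also have "integral {0..1} (\<lambda>\<theta>. h n (\<theta> + real m * \<alpha>)) = a n"
      unfolding a_def by (rule integral_periodic_shift[OF cont per_h])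
    finally show ?thesis .
  qed
  have "0 \<le> h n \<theta>" for n \<theta>
    unfolding h_def by (rule ln_ge_zero[OF opnorm_ge_1[OF det_transfer_product]])
  then have nn: "0 \<le> a n" for n
    unfolding a_def by (intro Henstock_Kurzweil_Integration.integral_nonneg[OF int0])
  note lim = subadditive_convergent[OF sub nn]
  have "lyapunov V \<alpha> E = lim (\<lambda>n. a n / n)"
    unfolding lyapunov_def eq[unfolded h_def] by simp
  also have "\<dots> = (INF k\<in>{1..}. a k / k)" using lim by (rule limI)
  also have "\<dots> \<le> a k / k"
  proof (rule cINF_lower)
    show "bdd_below ((\<lambda>k. a k / real k) ` {1..})" using nn by (intro bdd_belowI[of _ 0]) auto
  qed (use k in simp)
  finally have "lyapunov V \<alpha> E * k \<le> a k" using k by (simp add: field_simps)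
  then show ?thesis unfolding eq[of k, unfolded h_def] .
qed

text \<open>The bound grows exponentially in \<open>k\<close>, so a truncation at a degree proportional to \<open>k\<close> has
  error at most 1.\<close>

lemma frobenius_poly_series:
  assumes ser: "\<And>y. poly_series \<rho> K (\<lambda>t. V (y + t))" and E: "\<bar>E\<bar> \<le> R"
    and L: "R + K + 1 \<le> L" "1 \<le> L"
  shows "poly_series \<rho> (4 * L ^ (2 * k)) (\<lambda>t. frobenius_sq (transfer_product V \<alpha> k (y + t) E))"
proof -
  have "poly_series \<rho> (L ^ k) (\<lambda>t. transfer_product V \<alpha> k (y + t) E $ 1 $ j) \<and>
        poly_series \<rho> (L ^ k) (\<lambda>t. transfer_product V \<alpha> k (y + t) E $ 2 $ j)" for j
  proof (induction k)
    case 0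
    show ?case by (auto intro!: poly_series_const simp: mat_def)
  next
    case (Suc k)
    have "poly_series \<rho> (1 * K) (\<lambda>t. (-1) * V ((y + real (Suc k) * \<alpha>) + t))"
      by (intro poly_series_mult poly_series_const ser) simp
    then have "poly_series \<rho> (R + 1 * K) (\<lambda>t. E + (-1) * V ((y + real (Suc k) * \<alpha>) + t))"
      by (intro poly_series_add poly_series_const E)
    then have "poly_series \<rho> ((R + 1 * K) * L ^ k + 1 * L ^ k)
        (\<lambda>t. (E + (-1) * V ((y + real (Suc k) * \<alpha>) + t)) * transfer_product V \<alpha> k (y + t) E $ 1 $ j
          + (-1) * transfer_product V \<alpha> k (y + t) E $ 2 $ j)"
      by (rule poly_series_add[OF poly_series_mult[OF _ Suc[THEN conjunct1]]
            poly_series_mult[OF poly_series_const Suc[THEN conjunct2]]]) simp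
    then have "poly_series \<rho> ((R + 1 * K) * L ^ k + 1 * L ^ k)
        (\<lambda>t. transfer_product V \<alpha> (Suc k) (y + t) E $ 1 $ j)"
      unfolding transfer_product_Suc_nth by (simp add: algebra_simps)
    moreover have "(R + 1 * K) * L ^ k + 1 * L ^ k \<le> L ^ Suc k"
      using mult_right_mono[OF L(1), of "L ^ k"] L(2) by (simp add: algebra_simps)
    ultimately have 1: "poly_series \<rho> (L ^ Suc k) (\<lambda>t. transfer_product V \<alpha> (Suc k) (y + t) E $ 1 $ j)"
      using poly_series_mono by blast
    have "L ^ k \<le> L ^ Suc k" using L(2) by (intro power_increasing) auto
    then have 2: "poly_series \<rho> (L ^ Suc k) (\<lambda>t. transfer_product V \<alpha> (Suc k) (y + t) E $ 2 $ j)"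
      unfolding transfer_product_Suc_nth using Suc poly_series_mono by blast
    show ?case using 1 2 by blast
  qed
  then have e: "poly_series \<rho> (L ^ k) (\<lambda>t. transfer_product V \<alpha> k (y + t) E $ i $ j)" for i j
    using exhaust_2[of i] by auto
  have sq: "poly_series \<rho> (L ^ k * L ^ k) (\<lambda>t. (transfer_product V \<alpha> k (y + t) E $ i $ j)\<^sup>2)" for i j
    unfolding power2_eq_square by (rule poly_series_mult[OF e e])
  let ?T = "\<lambda>t. transfer_product V \<alpha> k (y + t) E"
  note s1 = poly_series_add[OF sq[of 1 1] sq[of 1 2]]
  note s2 = poly_series_add[OF s1 sq[of 2 1]]
  note s3 = poly_series_add[OF s2 sq[of 2 2]]
  have eq: "L ^ k * L ^ k + L ^ k * L ^ k + L ^ k * L ^ k + L ^ k * L ^ k = 4 * L ^ (2 * k)"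
    by (simp add: power_even_eq power2_eq_square)
  have "poly_series \<rho> (L ^ k * L ^ k + L ^ k * L ^ k + L ^ k * L ^ k + L ^ k * L ^ k)
     (\<lambda>t. (?T t $ 1 $ 1)\<^sup>2 + (?T t $ 1 $ 2)\<^sup>2 + (?T t $ 2 $ 1)\<^sup>2 + (?T t $ 2 $ 2)\<^sup>2)"
    by (rule s3)
  then show ?thesis unfolding frobenius_sq_def eq .
qed

text \<open>Between a point of a cell at which \<open>F\<close> is small and one at which it is large, the
  approximating polynomial crosses an intermediate level. So the number of cells with both kinds
  of points is at most the total number of roots.\<close>

lemma few_cells_large:
  fixes F :: "real \<Rightarrow> real"
  assumes appr: "\<And>y. \<exists>P :: real poly. degree P \<le> N \<and> (\<forall>t. \<bar>t\<bar> \<le> \<rho> \<longrightarrow> \<bar>F (y + t) - poly P t\<bar> \<le> 1)"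
    and M: "M > 0" "2 \<le> real M * \<rho>" "M \<le> m"
    and low: "\<And>i. i < m \<Longrightarrow> \<exists>b. real i / m \<le> b \<and> b < (real i + 1) / m \<and> F b \<le> \<Lambda>"
  shows "card {i. i < m \<and> (\<exists>x. real i / m \<le> x \<and> x < (real i + 1) / m \<and> F x > \<Lambda> + 2)} \<le> M * N"
proof -
  define I where "I = {i. i < m \<and> (\<exists>x. real i / m \<le> x \<and> x < (real i + 1) / m \<and> F x > \<Lambda> + 2)}"
  have m: "m > 0" using M by simp
  obtain P where P: "\<And>y. degree (P y :: real poly) \<le> N"
    "\<And>y t. \<bar>t\<bar> \<le> \<rho> \<Longrightarrow> \<bar>F (y + t) - poly (P y) t\<bar> \<le> 1"
    using appr by metis
  define J where "J = (\<lambda>i. (i * M) div m)"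
  define y where "y = (\<lambda>j. real j / real M)"
  define Q where "Q = (\<lambda>j. P (y j) - [:\<Lambda> + 1:])"
  have JM: "J i < M" if "i < m" for i
    using that M unfolding J_def by (simp add: div_less_iff_less_mult mult.commute)
  have near: "\<bar>x - y (J i)\<bar> \<le> \<rho>" if "real i / m \<le> x" "x < (real i + 1) / m" for i x
  proof -
    have "J i * m \<le> i * M" unfolding J_def by (rule div_times_less_eq_dividend)
    then have "real (J i) * m \<le> real i * M" by (simp only: of_nat_le_iff flip: of_nat_mult)
    then have l: "y (J i) \<le> real i / m" using m M by (simp add: y_def field_simps)
    have "i * M < (J i + 1) * m" unfolding J_def using m by (metis Suc_eq_plus1 dividend_less_div_times add.commute mult.commute mult_Suc)
    then have "real i * M < (real (J i) + 1) * m"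
      by (metis of_nat_less_iff of_nat_mult of_nat_add of_nat_1)
    then have u: "real i / m < y (J i) + 1 / M" using m M by (simp add: y_def field_simps)
    have "1 / real m \<le> 1 / real M" using M by (simp add: frac_le)
    then have "\<bar>x - y (J i)\<bar> \<le> 2 / M" using l u that by (simp add: add_divide_distrib)
    also have "\<dots> \<le> \<rho>" using M by (simp add: field_simps)
    finally show ?thesis .
  qed
  have root: "\<exists>z. poly (Q (J i)) z = 0 \<and> Q (J i) \<noteq> 0 \<and>
      real i / m \<le> z + y (J i) \<and> z + y (J i) < (real i + 1) / m" if i: "i \<in> I" for i
  proof -
    obtain x where x: "real i / m \<le> x" "x < (real i + 1) / m" "F x > \<Lambda> + 2" and im: "i < m"
      using i unfolding I_def by blast
    obtain b where b: "real i / m \<le> b" "b < (real i + 1) / m" "F b \<le> \<Lambda>" using low[OF im] by blast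
    have px: "poly (Q (J i)) (x - y (J i)) > 0"
      using P(2)[OF near[OF x(1,2)], of "y (J i)"] x(3) by (simp add: Q_def abs_le_iff)
    have pb: "poly (Q (J i)) (b - y (J i)) \<le> 0"
      using P(2)[OF near[OF b(1,2)], of "y (J i)"] b(3) by (simp add: Q_def abs_le_iff)
    let ?S = "{min x b - y (J i)..max x b - y (J i)}"
    have "\<exists>z \<in> ?S. poly (Q (J i)) z = 0"
    proof (cases "x \<le> b")
      case True
      then show ?thesis
        using IVT2'[of "poly (Q (J i))" "b - y (J i)" 0 "x - y (J i)"] px pb
        by (auto simp: continuous_on_poly)
    next
      case False
      then show ?thesis
        using IVT'[of "poly (Q (J i))" "b - y (J i)" 0 "x - y (J i)"] px pb
        by (auto simp: continuous_on_poly)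
    qed
    then obtain z where z: "z \<in> ?S" "poly (Q (J i)) z = 0" by blast
    have "Q (J i) \<noteq> 0" using px by auto
    moreover have "real i / m \<le> z + y (J i)" "z + y (J i) < (real i + 1) / m"
      using z(1) x b by auto
    ultimately show ?thesis using z(2) by blast
  qed
  obtain z where z: "\<And>i. i \<in> I \<Longrightarrow> poly (Q (J i)) (z i) = 0 \<and> Q (J i) \<noteq> 0 \<and>
      real i / m \<le> z i + y (J i) \<and> z i + y (J i) < (real i + 1) / m"
    using root by metis
  define R where "R = (\<lambda>j. if Q j = 0 then {} else {x. poly (Q j) x = 0})"
  have R: "finite (R j)" "card (R j) \<le> N" for j
  proof -
    show "finite (R j)" by (simp add: R_def poly_roots_finite)
    have "card (R j) \<le> degree (Q j)" by (auto simp: R_def card_poly_roots_bound)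
    also have "\<dots> \<le> N" unfolding Q_def using P(1) by (intro degree_diff_le) auto
    finally show "card (R j) \<le> N" .
  qed
  have inj: "inj_on (\<lambda>i. (J i, z i)) I"
  proof (rule inj_onI)
    fix i i' assume i: "i \<in> I" "i' \<in> I" and eq: "(J i, z i) = (J i', z i')"
    have "real i < real i' + 1"
      using le_less_trans[of "real i / m" "z i + y (J i)" "(real i' + 1) / m"] z[OF i(1)] z[OF i(2)] eq m
      by (simp add: divide_less_cancel)
    moreover have "real i' < real i + 1"
      using le_less_trans[of "real i' / m" "z i + y (J i)" "(real i + 1) / m"] z[OF i(1)] z[OF i(2)] eq m
      by (simp add: divide_less_cancel)
    ultimately show "i = i'" by linarith
  qed
  have "card I = card ((\<lambda>i. (J i, z i)) ` I)" by (simp add: card_image[OF inj])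
  also have "\<dots> \<le> card (Sigma {..<M} R)"
  proof (rule card_mono)
    show "(\<lambda>i. (J i, z i)) ` I \<subseteq> Sigma {..<M} R"
    proof clarify
      fix i assume i: "i \<in> I"
      then have "i < m" by (simp add: I_def)
      then show "J i \<in> {..<M} \<and> z i \<in> R (J i)" using z[OF i] JM by (simp add: R_def)
    qed
  qed (use R in auto)
  also have "\<dots> = (\<Sum>j<M. card (R j))" using R by simp
  also have "\<dots> \<le> (\<Sum>j<M. N)" using R by (intro sum_mono) auto
  finally show ?thesis by (simp add: I_def)
qed

lemma integral_le_few_cells:
  fixes h :: "real \<Rightarrow> real"
  assumes cont: "continuous_on UNIV h" and m: "m > 0" and I: "I \<subseteq> {..<m}" and B: "B \<ge> 0"
    and A: "\<And>i x. i < m \<Longrightarrow> i \<notin> I \<Longrightarrow> real i / m \<le> x \<Longrightarrow> x < (real i + 1) / m \<Longrightarrow> h x \<le> A"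
    and AB: "\<And>x. h x \<le> A + B"
  shows "(LINT x:{0..1}|lborel. h x) \<le> A + B * card I / m"
proof -
  define c where "c = (\<lambda>i. {real i / m..<(real i + 1) / m})"
  have fin: "finite I" using I finite_subset by blast
  have c01: "c i \<subseteq> {0..1}" if "i < m" for i
  proof -
    have "real i + 1 \<le> m" using that by linarith
    then have "(real i + 1) / m \<le> 1" using m by simp
    moreover have "0 \<le> real i / m" by simp
    ultimately show ?thesis unfolding c_def atLeastLessThan_def
      by (intro subsetI) (simp only: Int_iff atLeast_iff lessThan_iff atLeastAtMost_iff, linarith)
  qed
  have int_c: "integrable lborel (indicator (c i) :: real \<Rightarrow> real)" for i
    unfolding c_def using m
    by (intro integrable_real_indicator) (auto simp: emeasure_lborel_Ico divide_right_mono)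
  have "(LINT x:{0..1}|lborel. h x) = (LINT x|lborel. indicator {0..1} x * h x)"
    by (simp add: set_lebesgue_integral_def)
  also have "\<dots> \<le> (LINT x|lborel. A * indicator {0..1} x + (\<Sum>i\<in>I. B * indicator (c i) x))"
  proof (rule integral_mono_AE)
    show "integrable lborel (\<lambda>x. indicator {0..1} x * h x)"
      using borel_integrable_atLeastAtMost'[OF continuous_on_subset[OF cont subset_UNIV], of 0 1]
      by (simp add: set_integrable_def)
    show "integrable lborel (\<lambda>x. A * indicator {0..1} x + (\<Sum>i\<in>I. B * indicator (c i) x))"
      using int_c by (intro Bochner_Integration.integrable_add Bochner_Integration.integrable_sum integrable_mult_right) auto
    have "AE x in lborel. x \<noteq> (1::real)" by (rule AE_lborel_singleton)
    then show "AE x in lborel. indicator {0..1} x * h x \<le> A * indicator {0..1} x + (\<Sum>i\<in>I. B * indicator (c i) x)"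
    proof eventually_elim
      case (elim x)
      have nn: "0 \<le> (\<Sum>i\<in>I. B * indicator (c i) x)" using B by (intro sum_nonneg) auto
      show ?case
      proof (cases "x \<in> {0..1}")
        case False
        then show ?thesis using nn by simp
      next
        case True
        then have x: "0 \<le> x" "x < 1" using elim by auto
        define i where "i = nat \<lfloor>m * x\<rfloor>"
        have fl: "real i \<le> m * x" "m * x < real i + 1" using x unfolding i_def by (simp_all add: of_nat_nat)
        have "real m * x < real m * 1" using x m by (intro mult_strict_left_mono) auto
        then have im: "i < m" using fl by linarith
        have xc: "real i / m \<le> x" "x < (real i + 1) / m" using fl m by (simp_all add: field_simps)
        show ?thesis
        proof (cases "i \<in> I")
          case True
          have "B * indicator (c i) x \<le> (\<Sum>i\<in>I. B * indicator (c i) x)"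
            using True fin B by (intro member_le_sum) auto
          then show ?thesis using AB[of x] \<open>x \<in> {0..1}\<close> xc by (simp add: c_def)
        next
          case False
          then show ?thesis using A[OF im False xc] \<open>x \<in> {0..1}\<close> nn by simp
        qed
      qed
    qed
  qed
  also have "\<dots> = A * 1 + (\<Sum>i\<in>I. B * (1 / m))"
  proof -
    have "(LINT x|lborel. indicator (c i) x) = 1 / real m" for i
      using m by (simp add: c_def field_simps)
    then show ?thesis using int_c by (simp add: Bochner_Integration.integral_add Bochner_Integration.integral_sum)
  qed
  finally show ?thesis by (simp add: field_simps)
qed

text \<open>Suppose that the transfer matrices of length \<open>k\<close> were small at all points of an orbit of length
  \<open>q\<close>. Then each of about \<open>q / 3\<close> cells would contain such a point, so by the count of roots all but
  a small proportion of the cells would consist of points with small transfer matrices. The mean of the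
  logarithm would then be less than \<open>a k\<close>.\<close>

lemma transfer_product_large_on_orbit:
  assumes an: "real_analytic V" and per: "periodic1 V" and a: "a > 0" and R: "R \<ge> 0"
  obtains c :: real and q0 :: int where "0 < c" "c \<le> 1"
    "\<And>\<alpha> E \<theta> p q. \<bar>E\<bar> \<le> R \<Longrightarrow> lyapunov V \<alpha> E > a \<Longrightarrow> q \<ge> q0 \<Longrightarrow> coprime p q \<Longrightarrow>
       \<bar>of_int q * \<alpha> - of_int p\<bar> < 1 / of_int q \<Longrightarrow>
       \<exists>j. int j < q \<and> exp (real (nat \<lfloor>c * of_int q\<rfloor>) * a / 2)
          < frobenius_sq (transfer_product V \<alpha> (nat \<lfloor>c * of_int q\<rfloor>) (\<theta> + real j * \<alpha>) E)"
proof -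
  have V: "continuous_on UNIV V" by (rule real_analytic_continuous[OF an])
  obtain \<rho> K where \<rho>: "\<rho> > 0" and ser: "\<And>y. poly_series \<rho> K (\<lambda>t. V (y + t))"
    using real_analytic_poly_series[OF an per] by blast
  have K: "K \<ge> 0" using poly_series_bound(2)[OF ser, of 0 0] \<rho> by force
  define L where "L = R + K + 1"
  have L: "L \<ge> 1" using R K by (simp add: L_def)
  \<comment> \<open>Degree \<open>D k\<close> is enough to beat the bound \<open>4 L\<^sup>2\<^sup>k\<close>.\<close>
  define D where "D = nat \<lceil>log 2 (4 * L\<^sup>2)\<rceil>"
  have "4 * L\<^sup>2 \<ge> 1" using one_le_power[OF L, of 2] by simp
  moreover have "2 powr log 2 (4 * L\<^sup>2) = 4 * L\<^sup>2" using L by (intro powr_log_cancel) auto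
  moreover have "log 2 (4 * L\<^sup>2) \<le> real D" unfolding D_def by linarith
  ultimately have D: "4 * L\<^sup>2 \<le> 2 ^ D"
    using powr_mono[of "log 2 (4 * L\<^sup>2)" "real D" 2] by (simp add: powr_realpow)
  have D1: "D \<ge> 1"
  proof (rule ccontr)
    assume "\<not> D \<ge> 1"
    then have "D = 0" by simp
    then have "4 * L\<^sup>2 \<le> 1" using D by simp
    then show False using one_le_power[OF L, of 2] by simp
  qed
  define M where "M = nat \<lceil>2 / \<rho>\<rceil>"
  have M: "M > 0" "2 \<le> real M * \<rho>"
  proof -
    have "2 / \<rho> \<le> real M" unfolding M_def by linarith
    then show "2 \<le> real M * \<rho>" using \<rho> by (simp add: field_simps)
    then show "M > 0" by (cases "M = 0") auto
  qed
  define C where "C = ln (2 * L)"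
  have C: "C > 0" unfolding C_def using L by simp
  \<comment> \<open>At most \<open>M D k\<close> of at least \<open>q / 4\<close> cells contain large values, and the logarithm is at
    most \<open>C k\<close> there. The choice of \<open>c\<close> makes their contribution to the mean at most \<open>a k / 4\<close>.\<close>
  define c where "c = min 1 (a / (16 * C * M * D))"
  have c: "0 < c" "c \<le> 1" "c * (16 * C * M * D) \<le> a"
  proof -
    have p: "0 < 16 * C * M * D" using C M D1 by simp
    then show "0 < c" "c \<le> 1" using a by (auto simp: c_def)
    have "c \<le> a / (16 * C * M * D)" by (simp add: c_def)
    then show "c * (16 * C * M * D) \<le> a" using p by (simp add: pos_le_divide_eq)
  qed
  define q0 where "q0 = \<lceil>(2 / a + 2) / c\<rceil> + 12 + 4 * int M"
  show ?thesis
  proof (rule that[OF c(1,2), of q0], rule ccontr)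
    fix \<alpha> E \<theta> :: real and p q :: int
    assume E: "\<bar>E\<bar> \<le> R" and lyap: "lyapunov V \<alpha> E > a" and q: "q \<ge> q0"
      and co: "coprime p q" and ap: "\<bar>of_int q * \<alpha> - of_int p\<bar> < 1 / of_int q"
    define k where "k = nat \<lfloor>c * of_int q\<rfloor>"
    define T where "T = (\<lambda>x. transfer_product V \<alpha> k x E)"
    define F where "F = (\<lambda>x. frobenius_sq (T x))"
    define \<Lambda> where "\<Lambda> = exp (real k * a / 2)"
    assume "\<not> (\<exists>j. int j < q \<and> exp (real (nat \<lfloor>c * of_int q\<rfloor>) * a / 2)
          < frobenius_sq (transfer_product V \<alpha> (nat \<lfloor>c * of_int q\<rfloor>) (\<theta> + real j * \<alpha>) E))"
    then have small: "F (\<theta> + real j * \<alpha>) \<le> \<Lambda>" if "int j < q" for j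
      using that unfolding F_def T_def k_def \<Lambda>_def by (meson not_le)
    have q12: "q \<ge> 12 + 4 * int M"
    proof -
      have "0 \<le> (2 / a + 2) / c" using a c by (intro divide_nonneg_pos add_nonneg_nonneg) auto
      then have "\<lceil>(2 / a + 2) / c\<rceil> \<ge> 0" by linarith
      then show ?thesis using q unfolding q0_def by linarith
    qed
    have cq: "c * q \<ge> 2 / a + 2"
    proof -
      have "(2 / a + 2) / c \<le> q" using q unfolding q0_def by linarith
      then show ?thesis using c by (simp add: field_simps)
    qed
    have k: "real k > 2 / a" "real k \<le> c * q" "k \<ge> 1"
    proof -
      have "2 / a > 0" using a by simp
      then have "0 \<le> c * q" using cq by linarith
      then have "real k = of_int \<lfloor>c * of_int q\<rfloor>" unfolding k_def by simp
      then show "real k > 2 / a" "real k \<le> c * q" using cq by linarith+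
      then show "k \<ge> 1" using \<open>2 / a > 0\<close> by (cases "k = 0") auto
    qed
    define m where "m = nat (q div 3)"
    have m: "m \<ge> M" "m > 0" "real m \<ge> q / 4" "3 / q \<le> 1 / m"
    proof -
      have "int m = q div 3" using q12 by (simp add: m_def)
      then have b: "3 * int m \<le> q" "q < 3 * int m + 3" by linarith+
      then show "m \<ge> M" "m > 0" using q12 by linarith+
      have "4 * int m \<ge> q" using b q12 by linarith
      then show "real m \<ge> q / 4" by linarith
      have "3 * real m \<le> q" using b by linarith
      then show "3 / q \<le> 1 / m" using \<open>m > 0\<close> q12 by (simp add: field_simps)
    qed
    have perF: "F (x + of_int n) = F x" for x n
      by (simp add: F_def T_def transfer_product_periodic[OF per])
    have low: "\<exists>b. real i / m \<le> b \<and> b < (real i + 1) / m \<and> F b \<le> \<Lambda>" for i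
    proof -
      obtain j n where j: "0 \<le> j" "j < q" "real i / m \<le> \<theta> + of_int j * \<alpha> + of_int n"
        "\<theta> + of_int j * \<alpha> + of_int n < real i / m + 3 / q"
        using rotation_orbit_hits[OF _ co ap, of "real i / m" \<theta>] q12 by auto
      have "F (\<theta> + of_int j * \<alpha> + of_int n) \<le> \<Lambda>"
        using small[of "nat j"] j(1,2) by (simp add: perF)
      moreover have "\<theta> + of_int j * \<alpha> + of_int n < (real i + 1) / m"
        using j(4) m(4) by (simp add: add_divide_distrib)
      ultimately show ?thesis using j(3) by blast
    qed
    have serF: "poly_series \<rho> (4 * L ^ (2 * k)) (\<lambda>t. F (y + t))" for y
      unfolding F_def T_def using frobenius_poly_series[OF ser E] L by (simp add: L_def)
    have tail: "4 * L ^ (2 * k) / 2 ^ (D * k) \<le> 1"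
    proof -
      have "4 * L ^ (2 * k) \<le> 4 ^ k * (L\<^sup>2) ^ k"
        using L k(3) power_increasing[of 1 k "4::real"] by (simp add: power_mult)
      also have "\<dots> = (4 * L\<^sup>2) ^ k" by (simp add: power_mult_distrib)
      also have "\<dots> \<le> (2 ^ D) ^ k" using D L by (intro power_mono) auto
      finally show ?thesis by (simp add: power_mult)
    qed
    define I where "I = {i. i < m \<and> (\<exists>x. real i / m \<le> x \<and> x < (real i + 1) / m \<and> F x > \<Lambda> + 2)}"
    have cardI: "card I \<le> M * (D * k)"
      unfolding I_def
    proof (rule few_cells_large[OF _ M m(1) low])
      fix y
      obtain P where P: "degree P \<le> D * k"
        "\<And>t. \<bar>t\<bar> \<le> \<rho> \<Longrightarrow> \<bar>F (y + t) - poly P t\<bar> \<le> 4 * L ^ (2 * k) / 2 ^ (D * k)"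
        using poly_series_bound(1)[OF serF[of y], where t = 0 and N = "D * k"] \<rho> by auto
      then show "\<exists>P :: real poly. degree P \<le> D * k \<and> (\<forall>t. \<bar>t\<bar> \<le> \<rho> \<longrightarrow> \<bar>F (y + t) - poly P t\<bar> \<le> 1)"
        using order_trans[OF P(2) tail] by blast
    qed
    define h where "h = (\<lambda>x. ln (opnorm (T x)))"
    have F1: "F x \<ge> 1" for x unfolding F_def T_def by (rule frobenius_transfer_ge_1)
    have hF: "h x \<le> ln (F x) / 2" for x
    proof -
      have "h x \<le> ln (sqrt (F x))"
        unfolding h_def F_def
        using opnorm_le_frobenius opnorm_ge_1[OF det_transfer_product, of V \<alpha> k x E]
        by (intro ln_mono) (auto simp: T_def)
      then show ?thesis using F1[of x] by (simp add: ln_sqrt)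
    qed
    have L1: "\<Lambda> \<ge> 1" unfolding \<Lambda>_def using a by simp
    have up: "h x \<le> (real k * a / 4 + 1) + C * k" for x
    proof -
      have "F x \<le> 4 * L ^ (2 * k)" using poly_series_bound(2)[OF serF, of 0 x] \<rho> by simp
      also have "\<dots> \<le> (2 * L) ^ (2 * k)"
        using L k(3) power_increasing[of 2 "2 * k" "2::real"] by (simp add: power_mult_distrib)
      finally have "ln (F x) \<le> ln ((2 * L) ^ (2 * k))" using F1[of x] by (intro ln_mono) auto
      also have "\<dots> = 2 * (k * C)" by (subst ln_realpow) (use L in \<open>simp_all add: C_def\<close>)
      finally have "h x \<le> C * k" using hF[of x] by (simp add: mult.commute)
      moreover have "0 \<le> real k * a / 4" using a by simp
      ultimately show ?thesis by linarith
    qed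
    have lowh: "h x \<le> real k * a / 4 + 1" if "i < m" "i \<notin> I" "real i / m \<le> x" "x < (real i + 1) / m" for i x
    proof -
      have "F x \<le> \<Lambda> + 2" using that unfolding I_def by force
      also have "\<dots> \<le> exp 2 * \<Lambda>"
      proof -
        have "3 \<le> exp (2::real)" using exp_ge_add_one_self[of 2] by simp
        then have "3 * \<Lambda> \<le> exp 2 * \<Lambda>" using L1 by (intro mult_right_mono) auto
        then show ?thesis using L1 by linarith
      qed
      finally have "ln (F x) \<le> ln (exp 2 * \<Lambda>)" using F1[of x] by (intro ln_mono) auto
      also have "\<dots> = 2 + real k * a / 2" by (simp add: \<Lambda>_def flip: exp_add)
      finally show ?thesis using hF[of x] by simp
    qed
    have "a * k < lyapunov V \<alpha> E * k" using lyap k(3) by simp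
    also have "\<dots> \<le> (LINT x:{0..1}|lborel. h x)"
      unfolding h_def T_def by (rule lyapunov_le_mean[OF V per k(3)])
    also have "\<dots> \<le> (real k * a / 4 + 1) + C * k * card I / m"
      using lowh up C
      by (intro integral_le_few_cells[OF _ m(2)]) (auto simp: I_def h_def T_def intro!: continuous_ln_opnorm[OF V])
    also have "C * k * card I / m \<le> k * (a / 4)"
    proof -
      have "real (card I) \<le> real M * (real D * real k)" using of_nat_mono[OF cardI, where 'a = real] by simp
      also have "\<dots> \<le> M * (D * (c * q))" using k(2) by (intro mult_left_mono) auto
      also have "\<dots> \<le> M * (D * (c * (4 * m)))" using m(3) c by (intro mult_left_mono) auto
      finally have "C * card I \<le> C * (M * (D * (c * (4 * m))))" using C by (intro mult_left_mono) auto
      also have "\<dots> = (c * (16 * C * M * D)) * (m / 4)" by simp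
      also have "\<dots> \<le> a * (m / 4)" using c(3) by (intro mult_right_mono) auto
      finally have "C * card I / m \<le> a / 4" using m(2) by (simp add: field_simps)
      from mult_left_mono[OF this, of "real k"] show ?thesis by (simp add: mult_ac)
    qed
    finally have "a * k / 2 < 1" by (simp add: algebra_simps)
    then show False using k(1) a by (simp add: field_simps)
  qed
qed

section \<open>Decay and truncation of solutions\<close>

definition solution :: "(int \<Rightarrow> real) \<Rightarrow> real \<Rightarrow> (int \<Rightarrow> real) \<Rightarrow> bool" where
  "solution v E u \<longleftrightarrow> (\<forall>n. u (n + 1) + u (n - 1) + v n * u n = E * u n)"

abbreviation pair_sq :: "(int \<Rightarrow> real) \<Rightarrow> int \<Rightarrow> real" where
  "pair_sq u n \<equiv> (u (n + 1))\<^sup>2 + (u n)\<^sup>2"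

lemma solution_transfer:
  fixes s :: int
  assumes sol: "solution (\<lambda>n. V (\<theta> + of_int n * \<alpha>)) E u"
  defines "T \<equiv> \<lambda>k. transfer_product V \<alpha> k (\<theta> + of_int s * \<alpha>) E"
  shows "u (s + int k + 1) = T k $ 1 $ 1 * u (s + 1) + T k $ 1 $ 2 * u s \<and>
         u (s + int k) = T k $ 2 $ 1 * u (s + 1) + T k $ 2 $ 2 * u s"
proof (induction k)
  case 0
  then show ?case by (simp add: T_def mat_def)
next
  case (Suc k)
  define n where "n = s + int k + 1"
  have "u (n + 1) = (E - V (\<theta> + of_int n * \<alpha>)) * u n - u (n - 1)"
    using sol unfolding solution_def by (simp add: left_diff_distrib) (metis add.commute add_diff_cancel diff_diff_eq2)
  moreover have "\<theta> + of_int s * \<alpha> + real (Suc k) * \<alpha> = \<theta> + of_int n * \<alpha>"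
    by (simp add: n_def algebra_simps)
  moreover have "n - 1 = s + int k" "s + int (Suc k) = n" by (auto simp: n_def)
  ultimately show ?case using Suc
    unfolding T_def transfer_product_Suc_nth by (simp add: n_def algebra_simps)
qed

text \<open>As the determinant is 1, the vector \<open>(z, t)\<close> is fixed by its component along \<open>(x, y)\<close>. This
  component, relative to the length of \<open>(x, y)\<close>, changes in each step by at most a constant over
  the least square of that length. So \<open>(z, t)\<close> can only become large if \<open>(x, y)\<close> becomes small.\<close>

lemma second_solution_bound:
  fixes x y z t e :: "nat \<Rightarrow> real"
  assumes rec: "\<And>k. k < n \<Longrightarrow> x (Suc k) = e k * x k - y k" "\<And>k. k < n \<Longrightarrow> y (Suc k) = x k"
      "\<And>k. k < n \<Longrightarrow> z (Suc k) = e k * z k - t k" "\<And>k. k < n \<Longrightarrow> t (Suc k) = z k"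
    and e: "\<And>k. \<bar>e k\<bar> \<le> C" and d: "d > 0" "\<And>k. k \<le> n \<Longrightarrow> d \<le> (x k)\<^sup>2 + (y k)\<^sup>2"
    and init: "x 0 * t 0 - y 0 * z 0 = 1" "x 0 * z 0 + y 0 * t 0 = 0"
  shows "(z n)\<^sup>2 + (t n)\<^sup>2 \<le> (n * (C + 2) / d)\<^sup>2 * ((x n)\<^sup>2 + (y n)\<^sup>2) + 1 / d"
proof -
  define D where "D = (\<lambda>k. (x k)\<^sup>2 + (y k)\<^sup>2)"
  define s where "s = (\<lambda>k. (x k * z k + y k * t k) / D k)"
  have D: "D k \<ge> d" "D k > 0" if "k \<le> n" for k using d(1) d(2)[OF that] by (auto simp: D_def)
  have det: "x k * t k - y k * z k = 1" if "k \<le> n" for k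
    using that
  proof (induction k)
    case (Suc k)
    then show ?case by (simp add: rec algebra_simps)
  qed (rule init)
  have zt: "z k = s k * x k - y k / D k" "t k = s k * y k + x k / D k" if k: "k \<le> n" for k
  proof -
    have "z k * D k = (x k * z k + y k * t k) * x k - y k * (x k * t k - y k * z k)"
      by (simp add: D_def power2_eq_square algebra_simps)
    then have "z k * D k = (x k * z k + y k * t k) * x k - y k" using det[OF k] by simp
    then have "z k = ((x k * z k + y k * t k) * x k - y k) / D k"
      using D(2)[OF k] by (simp only: nonzero_eq_divide_eq)
    then show "z k = s k * x k - y k / D k" unfolding s_def by (simp add: diff_divide_distrib)
    have "t k * D k = (x k * z k + y k * t k) * y k + x k * (x k * t k - y k * z k)"
      by (simp add: D_def power2_eq_square algebra_simps)
    then have "t k * D k = (x k * z k + y k * t k) * y k + x k" using det[OF k] by simp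
    then have "t k = ((x k * z k + y k * t k) * y k + x k) / D k"
      using D(2)[OF k] by (simp only: nonzero_eq_divide_eq)
    then show "t k = s k * y k + x k / D k" 
      by (simp only: s_def times_divide_eq_left
          add_divide_distrib[of "(x k * z k + y k * t k) * y k" "x k"])
  qed
  have step: "\<bar>s (Suc k) - s k\<bar> \<le> (C + 2) / d" if k: "k < n" for k
  proof -
    let ?P = "sqrt (D k)" and ?Q = "sqrt (D (Suc k))"
    have k': "k \<le> n" "Suc k \<le> n" using k by auto
    have "s (Suc k) * D (Suc k) = x (Suc k) * z (Suc k) + y (Suc k) * t (Suc k)"
      using D(2)[OF k'(2)] by (simp add: s_def)
    also have "\<dots> = x (Suc k) * (e k * z k - t k) + y (Suc k) * z k" using rec k by simp
    also have "\<dots> = s k * (x (Suc k) * (e k * x k - y k) + y (Suc k) * x k)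
        + (x (Suc k) * (- e k * y k - x k) - y (Suc k) * y k) / D k"
      unfolding zt[OF k'(1)] by (simp add: algebra_simps diff_divide_distrib add_divide_distrib)
    also have "x (Suc k) * (e k * x k - y k) + y (Suc k) * x k = D (Suc k)"
      using rec(1,2)[OF k] by (simp add: D_def power2_eq_square)
    finally have eq: "(s (Suc k) - s k) * (D k * D (Suc k)) = x (Suc k) * (- e k * y k - x k) - y (Suc k) * y k"
      using D(2)[OF k'(1)] by (simp add: field_simps)
    have b: "\<bar>x k\<bar> \<le> ?P" "\<bar>y k\<bar> \<le> ?P" "\<bar>x (Suc k)\<bar> \<le> ?Q" "\<bar>y (Suc k)\<bar> \<le> ?Q"
      by (auto simp: D_def intro!: real_le_rsqrt)
    have C: "C \<ge> 0" using e[of 0] by linarith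
    have "\<bar>- e k * y k - x k\<bar> \<le> \<bar>e k\<bar> * \<bar>y k\<bar> + \<bar>x k\<bar>"
      by (metis abs_minus_commute abs_mult abs_triangle_ineq4 abs_minus_cancel)
    also have "\<dots> \<le> C * ?P + ?P" using b e[of k] C by (intro add_mono mult_mono) auto
    finally have c: "\<bar>- e k * y k - x k\<bar> \<le> (C + 1) * ?P" by (simp add: algebra_simps)
    have "\<bar>s (Suc k) - s k\<bar> * (D k * D (Suc k)) = \<bar>x (Suc k) * (- e k * y k - x k) - y (Suc k) * y k\<bar>"
      unfolding eq[symmetric] using D(2)[OF k'(1)] D(2)[OF k'(2)] by (simp add: abs_mult)
    also have "\<dots> \<le> \<bar>x (Suc k)\<bar> * \<bar>- e k * y k - x k\<bar> + \<bar>y (Suc k)\<bar> * \<bar>y k\<bar>"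
      by (metis abs_mult abs_triangle_ineq4)
    also have "\<dots> \<le> ?Q * ((C + 1) * ?P) + ?Q * ?P"
      using b c D(2)[OF k'(1)] D(2)[OF k'(2)] by (intro add_mono mult_mono) auto
    also have "\<dots> = (C + 2) * (?P * ?Q)" by (simp add: algebra_simps)
    finally have "\<bar>s (Suc k) - s k\<bar> * ((?P * ?Q) * (?P * ?Q)) \<le> (C + 2) * (?P * ?Q)"
      using D(2)[OF k'(1)] D(2)[OF k'(2)] by (simp add: mult_ac)
    moreover have PQ: "?P * ?Q > 0" using D(2)[OF k'(1)] D(2)[OF k'(2)] by simp
    ultimately have "\<bar>s (Suc k) - s k\<bar> * (?P * ?Q) \<le> C + 2"
      by (intro mult_right_le_imp_le[of "\<bar>s (Suc k) - s k\<bar> * (?P * ?Q)" "?P * ?Q"]) (simp_all only: mult.assoc)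
    moreover have "d \<le> ?P * ?Q"
    proof -
      have "sqrt d * sqrt d \<le> ?P * ?Q" using D(1)[OF k'(1)] D(1)[OF k'(2)] d(1) by (intro mult_mono) auto
      then show ?thesis using d(1) by simp
    qed
    then have "\<bar>s (Suc k) - s k\<bar> * d \<le> \<bar>s (Suc k) - s k\<bar> * (?P * ?Q)" by (intro mult_left_mono) auto
    ultimately show ?thesis using d(1) by (simp add: field_simps)
  qed
  have sk: "\<bar>s k\<bar> \<le> k * ((C + 2) / d)" if "k \<le> n" for k
    using that
  proof (induction k)
    case 0
    then show ?case using init by (simp add: s_def)
  next
    case (Suc k)
    have "real (Suc k) * ((C + 2) / d) = real k * ((C + 2) / d) + (C + 2) / d"
      by (simp add: distrib_right add_divide_distrib add.commute)
    then show ?case using Suc step[of k] by linarith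
  qed
  have "(z n)\<^sup>2 + (t n)\<^sup>2 = (s n)\<^sup>2 * D n + D n / (D n)\<^sup>2"
  proof -
    have "(a * p - b * q)\<^sup>2 + (a * b + p * q)\<^sup>2 = a\<^sup>2 * (p\<^sup>2 + b\<^sup>2) + (p\<^sup>2 + b\<^sup>2) * q\<^sup>2"
      for a b p q :: real by algebra
    from this[of "s n" "x n" "y n" "1 / D n"] show ?thesis
      unfolding zt[OF order_refl] D_def by (simp add: power_divide)
  qed
  also have "D n / (D n)\<^sup>2 = 1 / D n" by (simp add: power2_eq_square)
  also have "1 / D n \<le> 1 / d" using D[of n] d by (simp add: frac_le)
  also have "(s n)\<^sup>2 * D n \<le> (n * (C + 2) / d)\<^sup>2 * D n"
  proof (rule mult_right_mono)
    have "\<bar>s n\<bar> \<le> n * (C + 2) / d" using sk[of n] by simp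
    from power_mono[OF this, of 2] show "(s n)\<^sup>2 \<le> (n * (C + 2) / d)\<^sup>2" by simp
  qed (use D(2)[of n] in simp)
  finally show ?thesis by (simp add: D_def)
qed

text \<open>The Frobenius norm of the transfer matrix can be computed in the orthonormal basis given by the
  initial vector of the solution and its perpendicular. The images of both are controlled by
  \<open>second_solution_bound\<close> in terms of the least value of \<open>pair_sq\<close> on the interval.\<close>

lemma solution_small_somewhere:
  assumes sol: "solution (\<lambda>n. V (\<theta> + of_int n * \<alpha>)) E u"
    and C: "\<And>x. \<bar>E - V x\<bar> \<le> C"
    and big: "\<Lambda> \<le> frobenius_sq (transfer_product V \<alpha> n (\<theta> + of_int s * \<alpha>) E)"
    and \<Lambda>: "\<Lambda> \<ge> 0"
    and B: "\<And>k. k \<le> n \<Longrightarrow> pair_sq u (s + int k) \<le> B"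
  shows "\<exists>k\<le>n. pair_sq u (s + int k) * sqrt \<Lambda> \<le> B * (2 + n * (C + 2))"
proof -
  define d where "d = Min ((\<lambda>k. pair_sq u (s + int k)) ` {..n})"
  have "d \<in> (\<lambda>k. pair_sq u (s + int k)) ` {..n}" unfolding d_def by (rule Min_in) auto
  then obtain k where k: "k \<le> n" "d = pair_sq u (s + int k)" by auto
  have dmin: "d \<le> pair_sq u (s + int j)" if "j \<le> n" for j
    unfolding d_def using that by (intro Min_le) auto
  have C0: "C \<ge> 0" using C[of 0] by linarith
  have B0: "B \<ge> 0" using B[of 0] by (meson order_trans add_nonneg_nonneg zero_le_power2 le0)
  have "d * sqrt \<Lambda> \<le> B * (2 + n * (C + 2))"
  proof (cases "d = 0")
    case True
    then show ?thesis using B0 C0 by simp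
  next
    case False
    then have d: "d > 0" using k(2) by (simp add: less_le)
    define a where "a = u (s + 1)"
    define b where "b = u s"
    define D0 where "D0 = a\<^sup>2 + b\<^sup>2"
    have D0: "d \<le> D0" "D0 \<le> B" using dmin[of 0] B[of 0] by (auto simp: D0_def a_def b_def)
    define T where "T = (\<lambda>k. transfer_product V \<alpha> k (\<theta> + of_int s * \<alpha>) E)"
    define x where "x = (\<lambda>k. T k $ 1 $ 1 * a + T k $ 1 $ 2 * b)"
    define y where "y = (\<lambda>k. T k $ 2 $ 1 * a + T k $ 2 $ 2 * b)"
    define z where "z = (\<lambda>k. (T k $ 1 $ 2 * a - T k $ 1 $ 1 * b) / D0)"
    define t where "t = (\<lambda>k. (T k $ 2 $ 2 * a - T k $ 2 $ 1 * b) / D0)"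
    define e where "e = (\<lambda>k. E - V (\<theta> + of_int s * \<alpha> + real (Suc k) * \<alpha>))"
    have xy: "(x k)\<^sup>2 + (y k)\<^sup>2 = pair_sq u (s + int k)" for k
      using solution_transfer[OF sol, of s k] by (simp add: x_def y_def T_def a_def b_def)
    have rec: "x (Suc k) = e k * x k - y k" "y (Suc k) = x k"
      "z (Suc k) = e k * z k - t k" "t (Suc k) = z k" for k
      using D0 d by (simp_all add: x_def y_def z_def t_def T_def e_def transfer_product_Suc_nth algebra_simps
          diff_divide_distrib add_divide_distrib del: transfer_product.simps of_nat_Suc)
    have init: "x 0 * t 0 - y 0 * z 0 = 1" "x 0 * z 0 + y 0 * t 0 = 0"
    proof -
      have "x 0 = a" "y 0 = b" "z 0 = - b / D0" "t 0 = a / D0"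
        by (simp_all add: x_def y_def z_def t_def T_def mat_def)
      moreover have "D0 \<noteq> 0" using D0 d by simp
      ultimately show "x 0 * t 0 - y 0 * z 0 = 1" "x 0 * z 0 + y 0 * t 0 = 0"
        by (simp_all add: D0_def power2_eq_square add_divide_distrib[symmetric])
    qed
    have zt: "(z n)\<^sup>2 + (t n)\<^sup>2 \<le> (n * (C + 2) / d)\<^sup>2 * ((x n)\<^sup>2 + (y n)\<^sup>2) + 1 / d"
      using rec C d init dmin by (intro second_solution_bound[where e = e]) (auto simp: e_def xy)
    have Bn: "(x n)\<^sup>2 + (y n)\<^sup>2 \<le> B" using B[of n] by (simp add: xy)
    have "D0 * frobenius_sq (T n) = (x n)\<^sup>2 + (y n)\<^sup>2 + D0\<^sup>2 * ((z n)\<^sup>2 + (t n)\<^sup>2)"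
    proof -
      have "D0 * z n = T n $ 1 $ 2 * a - T n $ 1 $ 1 * b" "D0 * t n = T n $ 2 $ 2 * a - T n $ 2 $ 1 * b"
        using D0 d by (auto simp: z_def t_def)
      then have "D0\<^sup>2 * ((z n)\<^sup>2 + (t n)\<^sup>2)
          = (T n $ 1 $ 2 * a - T n $ 1 $ 1 * b)\<^sup>2 + (T n $ 2 $ 2 * a - T n $ 2 $ 1 * b)\<^sup>2"
        by (simp add: distrib_left flip: power_mult_distrib)
      then show ?thesis unfolding x_def y_def D0_def frobenius_sq_def
        by (simp add: power2_eq_square algebra_simps)
    qed
    also have "\<dots> \<le> B + D0\<^sup>2 * ((n * (C + 2) / d)\<^sup>2 * B + 1 / d)"
    proof (rule add_mono[OF Bn mult_left_mono])
      show "(z n)\<^sup>2 + (t n)\<^sup>2 \<le> (n * (C + 2) / d)\<^sup>2 * B + 1 / d"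
        using zt mult_left_mono[OF Bn, of "(n * (C + 2) / d)\<^sup>2"] by simp
    qed simp
    finally have "frobenius_sq (T n) \<le> (B + D0\<^sup>2 * ((n * (C + 2) / d)\<^sup>2 * B + 1 / d)) / D0"
      using D0 d by (simp add: field_simps)
    also have "\<dots> = B / D0 + D0 * ((n * (C + 2) / d)\<^sup>2 * B + 1 / d)"
      using D0 d by (simp add: field_simps power2_eq_square)
    also have "\<dots> \<le> B / d + B * ((n * (C + 2) / d)\<^sup>2 * B + 1 / d)"
      using D0 d B0 by (intro add_mono mult_right_mono frac_le) auto
    also have "\<dots> = 2 * (B / d) + (B / d)\<^sup>2 * (n * (C + 2))\<^sup>2"
      by (simp add: field_simps power2_eq_square)
    also have "\<dots> \<le> 2 * (B / d)\<^sup>2 + (B / d)\<^sup>2 * (n * (C + 2))\<^sup>2"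
    proof -
      have "1 * (B / d) \<le> (B / d) * (B / d)" using D0 d by (intro mult_right_mono) (auto simp: field_simps)
      then show ?thesis by (simp add: power2_eq_square)
    qed
    also have "\<dots> \<le> (B / d * (2 + n * (C + 2)))\<^sup>2"
    proof -
      have "2 + (n * (C + 2))\<^sup>2 \<le> (2 + n * (C + 2))\<^sup>2"
        using C0 by (simp add: power2_sum)
      from mult_left_mono[OF this, of "(B / d)\<^sup>2"]
      have "(B / d)\<^sup>2 * (2 + (n * (C + 2))\<^sup>2) \<le> (B / d * (2 + n * (C + 2)))\<^sup>2"
        by (simp only: power_mult_distrib zero_le_power2)
      moreover have "2 * X + X * Y = X * (2 + Y)" for X Y :: real by algebra
      ultimately show ?thesis by metis
    qed
    finally have "\<Lambda> \<le> (B / d * (2 + n * (C + 2)))\<^sup>2" using big by (simp add: T_def)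
    then have "sqrt \<Lambda> \<le> B / d * (2 + n * (C + 2))"
      using B0 C0 d by (intro real_le_lsqrt) auto
    then show ?thesis using d by (simp add: field_simps)
  qed
  then show ?thesis using k by metis
qed

text \<open>Averaging the sharp truncations at \<open>N\<close> pairs of sites reduces the error by the factor
  \<open>N\<close> in amplitude at each site, hence by \<open>N\<^sup>2\<close> in the sum of squares.\<close>

lemma truncated_solution:
  fixes u v :: "int \<Rightarrow> real" and l r :: "nat \<Rightarrow> int"
  assumes sol: "solution v E u" and N: "N \<ge> 1"
    and l: "\<And>i. i < N \<Longrightarrow> - L \<le> l i \<and> l i < 0" "inj_on l {..<N}"
    and r: "\<And>i. i < N \<Longrightarrow> 0 < r i \<and> r i \<le> L" "inj_on r {..<N}"
  obtains f :: "int \<Rightarrow> real" where "f 0 = u 0" "f 1 = u 1" "\<And>n. \<bar>f n\<bar> \<le> \<bar>u n\<bar>" "\<And>n. \<bar>n\<bar> > L \<Longrightarrow> f n = 0"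
    "(\<Sum>n\<in>{- L - 1..L + 1}. (f (n + 1) + f (n - 1) + v n * f n - E * f n)\<^sup>2)
       \<le> 2 / (real N)\<^sup>2 * ((\<Sum>i<N. pair_sq u (l i)) + (\<Sum>i<N. pair_sq u (r i)))"
proof -
  define ch where "ch = (\<lambda>i n. if l i < n \<and> n \<le> r i then 1 else 0 :: real)"
  define \<phi> where "\<phi> = (\<lambda>n. (\<Sum>i<N. ch i n) / N)"
  define f where "f = (\<lambda>n. \<phi> n * u n)"
  define Z where "Z = l ` {..<N} \<union> r ` {..<N}"
  have \<phi>01: "0 \<le> \<phi> n" "\<phi> n \<le> 1" for n
  proof -
    show "0 \<le> \<phi> n" unfolding \<phi>_def ch_def by (intro divide_nonneg_nonneg sum_nonneg) auto
    have "(\<Sum>i<N. ch i n) \<le> (\<Sum>i<N. 1)" by (intro sum_mono) (auto simp: ch_def)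
    then show "\<phi> n \<le> 1" using N by (simp add: \<phi>_def)
  qed
  have one: "\<phi> n = 1" if "n = 0 \<or> n = 1" for n
  proof -
    have "(\<Sum>i<N. ch i n) = (\<Sum>i<N. 1)"
      using that l(1) r(1) by (intro sum.cong refl) (force simp: ch_def)
    then show ?thesis using N by (simp add: \<phi>_def)
  qed
  have zero: "\<phi> n = 0" if "\<bar>n\<bar> > L" for n
  proof -
    have "ch i n = 0" if "i < N" for i using \<open>\<bar>n\<bar> > L\<close> l(1)[OF that] r(1)[OF that] by (auto simp: ch_def)
    then show ?thesis by (simp add: \<phi>_def)
  qed
  define \<Delta> where "\<Delta> = (\<lambda>n. \<phi> (n + 1) - \<phi> n)"
  have \<Delta>: "(\<Delta> n)\<^sup>2 = (if n \<in> Z then 1 / (real N)\<^sup>2 else 0)" for n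
  proof -
    have ind: "(\<Sum>i<N. if n = g i then 1 else 0 :: real) = (if n \<in> g ` {..<N} then 1 else 0)"
      if "inj_on g {..<N}" for g :: "nat \<Rightarrow> int"
    proof (cases "n \<in> g ` {..<N}")
      case True
      then obtain j where j: "j < N" "n = g j" by auto
      have "(\<Sum>i<N. if n = g i then 1 else 0 :: real) = (\<Sum>i<N. if i = j then 1 else 0)"
        using j that by (intro sum.cong refl) (auto dest: inj_onD)
      then show ?thesis using j by simp
    next
      case False
      then show ?thesis by (auto intro!: sum.neutral)
    qed
    have "ch i (n + 1) - ch i n = (if n = l i then 1 else 0) - (if n = r i then 1 else 0)" if "i < N" for i
      using l(1)[OF that] r(1)[OF that] by (auto simp: ch_def)
    then have "(\<Sum>i<N. ch i (n + 1) - ch i n)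
        = (\<Sum>i<N. (if n = l i then 1 else 0) - (if n = r i then 1 else 0))"
      by (intro sum.cong refl) auto
    then have "\<Delta> n = ((if n \<in> l ` {..<N} then 1 else 0) - (if n \<in> r ` {..<N} then 1 else 0)) / N"
      unfolding \<Delta>_def \<phi>_def by (simp add: sum_subtractf ind l(2) r(2) diff_divide_distrib[symmetric])
    moreover have "n \<in> l ` {..<N} \<Longrightarrow> n \<notin> r ` {..<N}" using l(1) r(1) by force
    ultimately show ?thesis by (auto simp: Z_def power_divide)
  qed
  have finZ: "finite Z" by (simp add: Z_def)
  have ZL: "Z \<subseteq> {- L..L}" using l(1) r(1) by (force simp: Z_def)
  define g where "g = (\<lambda>n. f (n + 1) + f (n - 1) + v n * f n - E * f n)"
  have g2: "(g n)\<^sup>2 \<le> 2 * ((\<Delta> n)\<^sup>2 * (u (n + 1))\<^sup>2) + 2 * ((\<Delta> (n - 1))\<^sup>2 * (u (n - 1))\<^sup>2)" for n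
  proof -
    have "v n * u n - E * u n = - u (n + 1) - u (n - 1)"
      using sol unfolding solution_def by (metis add.commute add_diff_cancel_left' diff_diff_eq2 minus_diff_eq add_uminus_conv_diff diff_add_eq_diff_diff_swap)
    then have "\<phi> n * (v n * u n - E * u n) = \<phi> n * (- u (n + 1) - u (n - 1))" by simp
    then have "g n = \<Delta> n * u (n + 1) - \<Delta> (n - 1) * u (n - 1)"
      by (simp add: g_def f_def \<Delta>_def algebra_simps)
    then show ?thesis
      using sum_squares_bound[of "\<Delta> n * u (n + 1)" "- (\<Delta> (n - 1) * u (n - 1))"]
      by (simp add: power2_diff power_mult_distrib)
  qed
  have S: "(\<Sum>n\<in>A. (\<Delta> n)\<^sup>2 * w n) \<le> (\<Sum>n\<in>Z. 1 / (real N)\<^sup>2 * w n)"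
    if A: "finite A" and w: "\<And>n. 0 \<le> w n" for A and w :: "int \<Rightarrow> real"
  proof -
    have "(\<Sum>n\<in>A. (\<Delta> n)\<^sup>2 * w n) = (\<Sum>n\<in>A \<inter> Z. 1 / (real N)\<^sup>2 * w n)"
      unfolding \<Delta> by (simp add: sum.inter_restrict[OF A] if_distrib[of "\<lambda>x. x * _"] cong: if_cong)
    also have "\<dots> \<le> (\<Sum>n\<in>Z. 1 / (real N)\<^sup>2 * w n)" using finZ w by (intro sum_mono2) auto
    finally show ?thesis .
  qed
  have "(\<Sum>n\<in>{- L - 1..L + 1}. (g n)\<^sup>2)
      \<le> (\<Sum>n\<in>{- L - 1..L + 1}. 2 * ((\<Delta> n)\<^sup>2 * (u (n + 1))\<^sup>2) + 2 * ((\<Delta> (n - 1))\<^sup>2 * (u (n - 1))\<^sup>2))"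
    by (intro sum_mono g2)
  also have "\<dots> = 2 * (\<Sum>n\<in>{- L - 1..L + 1}. (\<Delta> n)\<^sup>2 * (u (n + 1))\<^sup>2)
      + 2 * (\<Sum>n\<in>{- L - 1..L + 1}. (\<Delta> (n - 1))\<^sup>2 * (u (n - 1))\<^sup>2)"
    by (simp add: sum.distrib sum_distrib_left)
  also have "(\<Sum>n\<in>{- L - 1..L + 1}. (\<Delta> (n - 1))\<^sup>2 * (u (n - 1))\<^sup>2)
      = (\<Sum>m\<in>(\<lambda>n. n - 1) ` {- L - 1..L + 1}. (\<Delta> m)\<^sup>2 * (u m)\<^sup>2)"
    by (subst sum.reindex) (auto simp: inj_on_def)
  also have "2 * (\<Sum>n\<in>{- L - 1..L + 1}. (\<Delta> n)\<^sup>2 * (u (n + 1))\<^sup>2) + 2 * \<dots>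
      \<le> 2 * (\<Sum>n\<in>Z. 1 / (real N)\<^sup>2 * (u (n + 1))\<^sup>2) + 2 * (\<Sum>n\<in>Z. 1 / (real N)\<^sup>2 * (u n)\<^sup>2)"
    by (intro add_mono mult_left_mono S) auto
  also have "\<dots> = 2 / (real N)\<^sup>2 * (\<Sum>n\<in>Z. pair_sq u n)"
    by (simp add: sum.distrib add_divide_distrib distrib_left flip: sum_divide_distrib)
  also have "(\<Sum>n\<in>Z. pair_sq u n) = (\<Sum>n\<in>l ` {..<N}. pair_sq u n) + (\<Sum>n\<in>r ` {..<N}. pair_sq u n)"
    unfolding Z_def using l(1) r(1) by (intro sum.union_disjoint) force+
  also have "\<dots> = (\<Sum>i<N. pair_sq u (l i)) + (\<Sum>i<N. pair_sq u (r i))"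
    by (simp add: sum.reindex l(2) r(2))
  finally have main: "(\<Sum>n\<in>{- L - 1..L + 1}. (g n)\<^sup>2)
      \<le> 2 / (real N)\<^sup>2 * ((\<Sum>i<N. pair_sq u (l i)) + (\<Sum>i<N. pair_sq u (r i)))" .
  show ?thesis
  proof (rule that[of f])
    show "\<bar>f n\<bar> \<le> \<bar>u n\<bar>" for n
      unfolding f_def abs_mult using mult_right_mono[OF \<phi>01(2), of "\<bar>u n\<bar>" n] \<phi>01(1)[of n] by simp
  qed (use one zero main in \<open>auto simp: f_def g_def\<close>)
qed

section \<open>Projection-valued measures on a real inner product space\<close>

text \<open>Only the real part of the inner product enters the estimates, so the scalars are real. The
  projections determine the operator through its quadratic form.\<close>

locale spectral_family =
  fixes Q :: "real set \<Rightarrow> 'h::real_inner \<Rightarrow> 'h" and H :: "'h \<Rightarrow> 'h" and R :: real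
  assumes linear_Q: "\<And>B. B \<in> sets borel \<Longrightarrow> linear (Q B)"
    and idem: "\<And>B x. B \<in> sets borel \<Longrightarrow> Q B (Q B x) = Q B x"
    and sym: "\<And>B x y. B \<in> sets borel \<Longrightarrow> Q B x \<bullet> y = x \<bullet> Q B y"
    and Q_empty: "\<And>x. Q {} x = 0"
    and Q_support: "\<And>x. Q {-R<..<R} x = x"
    and Q_Int: "\<And>A B x. A \<in> sets borel \<Longrightarrow> B \<in> sets borel \<Longrightarrow> Q (A \<inter> B) x = Q A (Q B x)"
    and sigma: "\<And>(A :: nat \<Rightarrow> real set) x. range A \<subseteq> sets borel \<Longrightarrow> disjoint_family A \<Longrightarrow>
      (\<lambda>N. norm (Q (\<Union>i. A i) x - (\<Sum>i<N. Q (A i) x))) \<longlonglongrightarrow> 0"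
    and linear_H: "linear H"
    and H_sym: "\<And>x y. H x \<bullet> y = x \<bullet> H y"
    and form: "\<And>x. x \<bullet> H x = (\<integral>E. E \<partial>measure_of UNIV (sets borel) (\<lambda>B. ennreal (x \<bullet> Q B x)))"
begin

definition diag :: "'h \<Rightarrow> real measure" where
  "diag x = measure_of UNIV (sets borel) (\<lambda>B. ennreal (x \<bullet> Q B x))"

lemma sets_diag [simp, measurable_cong]: "sets (diag x) = sets borel"
  and space_diag [simp]: "space (diag x) = UNIV"
  unfolding diag_def using sets.sigma_sets_eq[of "borel :: real measure"]
  by (simp_all add: sets_measure_of space_measure_of)

lemma inner_Q_self: "B \<in> sets borel \<Longrightarrow> x \<bullet> Q B x = (norm (Q B x))\<^sup>2"
  by (metis dot_square_norm idem sym)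

lemma emeasure_diag:
  assumes "B \<in> sets borel"
  shows "emeasure (diag x) B = ennreal ((norm (Q B x))\<^sup>2)"
proof -
  have "emeasure (diag x) B = ennreal (x \<bullet> Q B x)"
  proof (rule emeasure_measure_of[OF diag_def])
    show "positive (sets (diag x)) (\<lambda>B. ennreal (x \<bullet> Q B x))"
      by (simp add: positive_def Q_empty)
    show "countably_additive (sets (diag x)) (\<lambda>B. ennreal (x \<bullet> Q B x))"
    proof (rule countably_additiveI)
      fix A :: "nat \<Rightarrow> real set"
      assume A: "range A \<subseteq> sets (diag x)" "disjoint_family A"
      then have A': "range A \<subseteq> sets borel" by simp
      have "(\<lambda>N. x \<bullet> Q (\<Union>i. A i) x - (\<Sum>i<N. x \<bullet> Q (A i) x)) \<longlonglongrightarrow> 0"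
      proof (rule Lim_null_comparison)
        have "(\<lambda>N. norm x * norm (Q (\<Union>i. A i) x - (\<Sum>i<N. Q (A i) x))) \<longlonglongrightarrow> norm x * 0"
          by (intro tendsto_mult tendsto_const sigma A' A(2))
        then show "(\<lambda>N. norm x * norm (Q (\<Union>i. A i) x - (\<Sum>i<N. Q (A i) x))) \<longlonglongrightarrow> 0" by simp
        have "x \<bullet> Q (\<Union>i. A i) x - (\<Sum>i<N. x \<bullet> Q (A i) x) = x \<bullet> (Q (\<Union>i. A i) x - (\<Sum>i<N. Q (A i) x))" for N
          by (simp add: inner_diff_right inner_sum_right)
        then show "\<forall>\<^sub>F N in sequentially. norm (x \<bullet> Q (\<Union>i. A i) x - (\<Sum>i<N. x \<bullet> Q (A i) x))
            \<le> norm x * norm (Q (\<Union>i. A i) x - (\<Sum>i<N. Q (A i) x))"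
          by (simp add: Cauchy_Schwarz_ineq2)
      qed
      from tendsto_diff[OF tendsto_const[of "x \<bullet> Q (\<Union>i. A i) x"] this]
      have "(\<lambda>N. \<Sum>i<N. x \<bullet> Q (A i) x) \<longlonglongrightarrow> x \<bullet> Q (\<Union>i. A i) x" by simp
      then have "(\<lambda>i. x \<bullet> Q (A i) x) sums (x \<bullet> Q (\<Union>i. A i) x)" by (simp add: sums_def)
      moreover have "0 \<le> x \<bullet> Q (A i) x" for i using A' inner_Q_self[of "A i" x] by auto
      ultimately show "(\<Sum>i. ennreal (x \<bullet> Q (A i) x)) = ennreal (x \<bullet> Q (\<Union>i. A i) x)"
        by (intro suminf_ennreal_eq)
    qed
  qed (use assms in auto)
  then show ?thesis using inner_Q_self[OF assms] by simp
qed

lemma measure_diag: "B \<in> sets borel \<Longrightarrow> measure (diag x) B = (norm (Q B x))\<^sup>2"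
  by (simp add: measure_def emeasure_diag)

lemma Q_UNIV: "Q UNIV x = x"
  using Q_Int[of UNIV "{-R<..<R}" x] Q_support by simp

lemma finite_measure_diag: "finite_measure (diag x)"
  by (rule finite_measureI) (simp add: emeasure_diag)

lemma Q_orthogonal:
  assumes "A \<in> sets borel" "B \<in> sets borel" "A \<inter> B = {}"
  shows "Q A x \<bullet> Q B y = 0"
  using sym[OF assms(1), of x "Q B y"] Q_Int[OF assms(1,2), of y] assms(3) by (simp add: Q_empty)

text \<open>The squared norm of the difference of both sides vanishes, because the spectral measure of \<open>x\<close>
  is additive.\<close>

lemma Q_Un:
  assumes "A \<in> sets borel" "B \<in> sets borel" "A \<inter> B = {}"
  shows "Q (A \<union> B) x = Q A x + Q B x"
proof -
  define z where "z = Q (A \<union> B) x"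
  have z: "Q A z = Q A x" "Q B z = Q B x"
  proof -
    have "A \<inter> (A \<union> B) = A" "B \<inter> (A \<union> B) = B" by blast+
    then show "Q A z = Q A x" "Q B z = Q B x"
      using assms Q_Int[of A "A \<union> B" x] Q_Int[of B "A \<union> B" x] by (simp_all add: z_def)
  qed
  interpret finite_measure "diag x" by (rule finite_measure_diag)
  have n: "(norm z)\<^sup>2 = (norm (Q A x))\<^sup>2 + (norm (Q B x))\<^sup>2"
    using finite_measure_Union[of A B] assms by (simp add: measure_diag z_def)
  have za: "z \<bullet> Q A x = (norm (Q A x))\<^sup>2" using z(1) inner_Q_self[OF assms(1), of z] by simp
  have zb: "z \<bullet> Q B x = (norm (Q B x))\<^sup>2" using z(2) inner_Q_self[OF assms(2), of z] by simp
  have "(norm (z - (Q A x + Q B x)))\<^sup>2 = 0"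
    unfolding power2_norm_eq_inner inner_diff_left inner_diff_right inner_add_left inner_add_right
    using n za zb Q_orthogonal[OF assms, of x x]
    by (simp add: power2_norm_eq_inner inner_commute)
  then show ?thesis by (simp add: z_def)
qed

lemma Q_UN_finite:
  assumes "finite F" "\<And>k. k \<in> F \<Longrightarrow> J k \<in> sets borel" "disjoint_family_on J F"
  shows "Q (\<Union>k\<in>F. J k) x = (\<Sum>k\<in>F. Q (J k) x)"
  using assms
proof (induction F rule: finite_induct)
  case (insert a F)
  have "J a \<inter> J k = {}" if "k \<in> F" for k
  proof -
    have "a \<noteq> k" using that insert.hyps(2) by metis
    then show ?thesis using that disjoint_family_onD[OF insert.prems(2), of a k] by simp
  qed
  then have "J a \<inter> (\<Union>k\<in>F. J k) = {}" by blast
  moreover have "(\<Union>k\<in>F. J k) \<in> sets borel" using insert by auto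
  ultimately have "Q (J a \<union> (\<Union>k\<in>F. J k)) x = Q (J a) x + Q (\<Union>k\<in>F. J k) x"
    using insert.prems by (intro Q_Un) auto
  moreover have "disjoint_family_on J F"
    by (rule disjoint_family_on_mono[OF subset_insertI insert.prems(2)])
  ultimately show ?case using insert by simp
qed (simp add: Q_empty)

lemma diag_Q:
  assumes I: "I \<in> sets borel"
  shows "diag (Q I x) = density (diag x) (indicator I)"
proof (rule measure_eqI)
  fix A assume "A \<in> sets (diag (Q I x))"
  then have A: "A \<in> sets borel" by simp
  have "emeasure (density (diag x) (indicator I)) A = emeasure (diag x) (I \<inter> A)"
    using A I by (intro emeasure_restricted) simp_all
  then show "emeasure (diag (Q I x)) A = emeasure (density (diag x) (indicator I)) A"
    using A I Q_Int[of A I x] by (simp add: emeasure_diag Int_commute)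
qed simp

lemma AE_diag:
  assumes I: "I \<in> sets borel" and x: "Q I x = x"
  shows "AE E in diag x. E \<in> I"
proof (rule AE_I)
  show "{E \<in> space (diag x). E \<notin> I} \<subseteq> - I" by auto
  have "Q (- I) x = Q (- I \<inter> I) x" using Q_Int[of "- I" I x] I x by simp
  then show "emeasure (diag x) (- I) = 0" using I by (simp add: emeasure_diag Q_empty)
qed (use I in simp)

lemma integrable_diag:
  assumes f: "f \<in> borel_measurable borel" and b: "\<And>E. \<bar>E\<bar> < R \<Longrightarrow> \<bar>f E :: real\<bar> \<le> b"
  shows "integrable (diag x) f"
proof -
  interpret finite_measure "diag x" by (rule finite_measure_diag)
  have "AE E in diag x. E \<in> {-R<..<R}" by (rule AE_diag) (auto simp: Q_support)
  then have "AE E in diag x. norm (f E) \<le> b" by eventually_elim (auto intro!: b)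
  then show ?thesis by (rule integrable_const_bound) (use f in simp)
qed

lemma form_lower:
  assumes I: "I \<in> sets borel" "I \<subseteq> {b..}" and x: "Q I x = x"
  shows "b * (x \<bullet> x) \<le> x \<bullet> H x"
proof -
  interpret finite_measure "diag x" by (rule finite_measure_diag)
  have "b * (x \<bullet> x) = (\<integral>E. b \<partial>diag x)"
    by (simp add: measure_diag[of UNIV] Q_UNIV power2_norm_eq_inner)
  also have "\<dots> \<le> (\<integral>E. E \<partial>diag x)"
  proof (rule integral_mono_AE)
    show "integrable (diag x) (\<lambda>E. E)" by (rule integrable_diag[of _ R]) auto
    show "AE E in diag x. b \<le> E" using AE_diag[OF I(1) x] by eventually_elim (use I(2) in auto)
  qed simp
  finally show ?thesis by (simp add: form diag_def)
qed

lemma form_upper: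
  assumes I: "I \<in> sets borel" "I \<subseteq> {..b}" and x: "Q I x = x"
  shows "x \<bullet> H x \<le> b * (x \<bullet> x)"
proof -
  interpret finite_measure "diag x" by (rule finite_measure_diag)
  have "(\<integral>E. E \<partial>diag x) \<le> (\<integral>E. b \<partial>diag x)"
  proof (rule integral_mono_AE)
    show "integrable (diag x) (\<lambda>E. E)" by (rule integrable_diag[of _ R]) auto
    show "AE E in diag x. E \<le> b" using AE_diag[OF I(1) x] by eventually_elim (use I(2) in auto)
  qed simp
  also have "\<dots> = b * (x \<bullet> x)"
    by (simp add: measure_diag[of UNIV] Q_UNIV power2_norm_eq_inner)
  finally show ?thesis by (simp add: form diag_def)
qed

text \<open>The form determines the operator: since the spectral measure of a vector splits over \<open>I\<close>
  and its complement, so does the quadratic form, and hence the cross terms vanish.\<close>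

lemma H_cross:
  assumes I: "I \<in> sets borel"
  shows "Q I x \<bullet> H (Q (- I) y) = 0"
proof -
  define z where "z = Q I x + Q (- I) y"
  have Il: "- I \<in> sets borel" using I by simp
  have QI: "Q I z = Q I x" and QIc: "Q (- I) z = Q (- I) y"
    using linear_add[OF linear_Q[OF I]] linear_add[OF linear_Q[OF Il]] idem[OF I] idem[OF Il]
      Q_Int[OF I Il, of y] Q_Int[OF Il I, of x] by (simp_all add: z_def Q_empty)
  have id: "integrable (diag w) (\<lambda>E. E)" for w by (rule integrable_diag[of _ R]) auto
  have part: "Q J z \<bullet> H (Q J z) = (\<integral>E. indicator J E * E \<partial>diag z)" if J: "J \<in> sets borel" for J
  proof -
    have "density (diag z) (indicator J) = density (diag z) (\<lambda>E. ennreal (indicator J E))"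
      by (simp add: ennreal_indicator)
    then have "(\<integral>E. E \<partial>diag (Q J z)) = (\<integral>E. indicator J E * E \<partial>diag z)"
      unfolding diag_Q[OF J] using J by (simp add: integral_density)
    then show ?thesis by (simp add: form diag_def)
  qed
  have int: "integrable (diag z) (\<lambda>E. indicator J E * E)" if J: "J \<in> sets borel" for J
    using integrable_mult_indicator[OF _ id, of J z] J by simp
  have "z \<bullet> H z = (\<integral>E. indicator I E * E + indicator (- I) E * E \<partial>diag z)"
    unfolding form[of z, folded diag_def]
    by (intro Bochner_Integration.integral_cong refl) (auto simp: indicator_def)
  also have "\<dots> = Q I z \<bullet> H (Q I z) + Q (- I) z \<bullet> H (Q (- I) z)"
    using int[OF I] int[OF Il] by (simp add: part[OF I] part[OF Il])
  finally have "z \<bullet> H z = Q I x \<bullet> H (Q I x) + Q (- I) y \<bullet> H (Q (- I) y)" by (simp only: QI QIc)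
  moreover have "Q (- I) y \<bullet> H (Q I x) = Q I x \<bullet> H (Q (- I) y)"
    using H_sym[of "Q (- I) y" "Q I x"] by (simp add: inner_commute)
  ultimately show ?thesis
    unfolding z_def linear_add[OF linear_H] inner_add_left inner_add_right by simp
qed

lemma inner_H_Q:
  assumes I: "I \<in> sets borel"
  shows "x \<bullet> H (Q I y) = Q I x \<bullet> H (Q I y)" and "Q I x \<bullet> H y = Q I x \<bullet> H (Q I y)"
proof -
  have split: "w = Q I w + Q (- I) w" for w
    using Q_Un[of I "- I" w] I by (simp add: Q_UNIV)
  have "Q (- I) x \<bullet> H (Q I y) = 0"
    using H_cross[OF I, of y x] H_sym[of "Q (- I) x" "Q I y"] by (simp add: inner_commute)
  then show "x \<bullet> H (Q I y) = Q I x \<bullet> H (Q I y)"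
    by (metis split inner_add_left add.right_neutral)
  have "H y = H (Q I y) + H (Q (- I) y)" by (metis split linear_add[OF linear_H])
  then show "Q I x \<bullet> H y = Q I x \<bullet> H (Q I y)" using H_cross[OF I, of x y] by (simp add: inner_add_right)
qed

text \<open>Polarization of the upper and lower form bounds, which apply to the sum and to the difference of
  the two vectors.\<close>

lemma approximate_eigenvector:
  assumes I: "I \<in> sets borel" "I \<subseteq> {E - h..E + h}" and x: "Q I x = x" and y: "Q I y = y"
  shows "\<bar>x \<bullet> H y - E * (x \<bullet> y)\<bar> \<le> h / 2 * (x \<bullet> x + y \<bullet> y)"
proof -
  define k where "k = (\<lambda>w. w \<bullet> H w - E * (w \<bullet> w))"
  have I': "I \<subseteq> {E - h..}" "I \<subseteq> {..E + h}" using I(2) by auto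
  have k: "\<bar>k w\<bar> \<le> h * (w \<bullet> w)" if "Q I w = w" for w
    using form_lower[OF I(1) I'(1) that] form_upper[OF I(1) I'(2) that]
    unfolding k_def abs_le_iff by (auto simp: algebra_simps)
  have q: "Q I (x + y) = x + y" "Q I (x - y) = x - y"
    using x y linear_add[OF linear_Q[OF I(1)]] linear_diff[OF linear_Q[OF I(1)]] by simp_all
  have c: "y \<bullet> H x = x \<bullet> H y" using H_sym[of y x] by (simp add: inner_commute)
  have "4 * (x \<bullet> H y - E * (x \<bullet> y)) = k (x + y) - k (x - y)"
    unfolding k_def linear_add[OF linear_H] linear_diff[OF linear_H]
    by (simp add: inner_add_left inner_add_right inner_diff_left inner_diff_right c inner_commute[of y x] algebra_simps)
  then have "4 * \<bar>x \<bullet> H y - E * (x \<bullet> y)\<bar> \<le> \<bar>k (x + y)\<bar> + \<bar>k (x - y)\<bar>" by linarith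
  also have "\<dots> \<le> h * ((x + y) \<bullet> (x + y)) + h * ((x - y) \<bullet> (x - y))" using k q by (intro add_mono) auto
  also have "\<dots> = 2 * h * (x \<bullet> x + y \<bullet> y)"
    by (simp add: inner_add_left inner_add_right inner_diff_left inner_diff_right inner_commute[of y x] algebra_simps)
  finally show ?thesis by simp
qed

text \<open>With \<open>z = E + i\<epsilon>\<close>, the integral is the squared norm of the resolvent applied to \<open>x\<close> and the
  last factor is the squared norm of \<open>(H - z) f\<close>, so this is the Cauchy-Schwarz inequality for
  \<open>\<langle>x, f\<rangle> = \<langle>(H - z*)\<^sup>-\<^sup>1 x, (H - z) f\<rangle>\<close>, up to the factor 3. Cutting the line into cells of length
  \<open>\<epsilon>\<close>, on each of which \<open>|H - z|\<close> is constant up to a factor, reduces it to the Cauchy-Schwarz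
  inequality for the sum over the cells.\<close>

lemma resolvent_estimate:
  assumes \<epsilon>: "\<epsilon> > 0"
  shows "(x \<bullet> f)\<^sup>2 \<le> 3 * (\<integral>t. 1 / ((t - E)\<^sup>2 + \<epsilon>\<^sup>2) \<partial>diag x) * ((norm (H f - E *\<^sub>R f))\<^sup>2 + \<epsilon>\<^sup>2 * (norm f)\<^sup>2)"
proof -
  define J where "J = (\<lambda>k::int. {E + k * \<epsilon>..<E + (k + 1) * \<epsilon>})"
  define d where "d = (\<lambda>k::int. max 0 (max (k * \<epsilon>) (- ((k + 1) * \<epsilon>))))"
  define m where "m = (\<lambda>k. (d k)\<^sup>2 + \<epsilon>\<^sup>2)"
  define g where "g = H f - E *\<^sub>R f"
  have m: "m k > 0" for k using \<epsilon> by (simp add: m_def add_nonneg_pos)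
  have cell: "t \<in> J k \<longleftrightarrow> k = \<lfloor>(t - E) / \<epsilon>\<rfloor>" for t k
  proof -
    have "t \<in> J k \<longleftrightarrow> k \<le> (t - E) / \<epsilon> \<and> (t - E) / \<epsilon> < k + 1"
      using \<epsilon> by (auto simp: J_def field_simps)
    then show ?thesis by (auto simp: floor_eq_iff[symmetric] dest: sym)
  qed
  have Jb: "J k \<in> sets borel" for k by (simp add: J_def)
  define F where "F = {\<lfloor>(- R - E) / \<epsilon>\<rfloor>..\<lfloor>(R - E) / \<epsilon>\<rfloor>}"
  have cover: "{-R<..<R} \<subseteq> (\<Union>k\<in>F. J k)"
  proof
    fix t assume t: "t \<in> {-R<..<R}"
    then have "(- R - E) / \<epsilon> \<le> (t - E) / \<epsilon>" "(t - E) / \<epsilon> \<le> (R - E) / \<epsilon>"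
      using \<epsilon> by (auto intro!: divide_right_mono)
    then have "\<lfloor>(t - E) / \<epsilon>\<rfloor> \<in> F" by (simp add: F_def floor_mono)
    then show "t \<in> (\<Union>k\<in>F. J k)" using cell[of t "\<lfloor>(t - E) / \<epsilon>\<rfloor>"] by blast
  qed
  have dis: "disjoint_family_on J F"
    unfolding disjoint_family_on_def disjoint_iff cell by simp
  have finF: "finite F" by (simp add: F_def)
  have full: "w = (\<Sum>k\<in>F. Q (J k) w)" for w
  proof -
    have U: "(\<Union>k\<in>F. J k) \<in> sets borel" using finF Jb by auto
    have "Q (\<Union>k\<in>F. J k) w = Q ((\<Union>k\<in>F. J k) \<inter> {-R<..<R}) w"
      using Q_Int[OF U, of "{-R<..<R}" w] by (simp add: Q_support)
    also have "(\<Union>k\<in>F. J k) \<inter> {-R<..<R} = {-R<..<R}" using cover by blast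
    finally show ?thesis using Q_UN_finite[OF finF Jb dis, of w] by (simp add: Q_support)
  qed
  have inner_sum: "w \<bullet> y = (\<Sum>k\<in>F. Q (J k) w \<bullet> Q (J k) y)" for w y
  proof -
    have "w \<bullet> y = (\<Sum>k\<in>F. Q (J k) w \<bullet> y)" by (metis full inner_sum_left)
    also have "\<dots> = (\<Sum>k\<in>F. Q (J k) w \<bullet> Q (J k) y)"
      by (intro sum.cong refl) (metis idem sym Jb)
    finally show ?thesis .
  qed
  have nsq: "(\<Sum>k\<in>F. (norm (Q (J k) w))\<^sup>2) = (norm w)\<^sup>2" for w
    using inner_sum[of w w] by (simp add: power2_norm_eq_inner)
  have dk: "d k * norm (Q (J k) f) \<le> norm (Q (J k) g)" for k
  proof -
    define y where "y = Q (J k) f"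
    have y: "Q (J k) y = y" by (simp add: y_def idem Jb)
    have yg: "y \<bullet> H y - E * (y \<bullet> y) = y \<bullet> Q (J k) g"
    proof -
      have "y \<bullet> H f = y \<bullet> H y" using inner_H_Q(2)[OF Jb[of k], of f f] by (simp add: y_def)
      moreover have "y \<bullet> f = y \<bullet> y" unfolding y_def by (metis idem sym Jb)
      moreover have "y \<bullet> Q (J k) g = y \<bullet> g" by (metis y sym Jb)
      ultimately show ?thesis by (simp add: g_def inner_diff_right)
    qed
    have lo: "(E + k * \<epsilon>) * (y \<bullet> y) \<le> y \<bullet> H y" by (rule form_lower[OF Jb _ y]) (auto simp: J_def)
    have up: "y \<bullet> H y \<le> (E + (k + 1) * \<epsilon>) * (y \<bullet> y)" by (rule form_upper[OF Jb _ y]) (auto simp: J_def)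
    have "d k * (y \<bullet> y) \<le> \<bar>y \<bullet> Q (J k) g\<bar>"
      using lo up unfolding yg[symmetric] d_def max_def by (auto simp: algebra_simps)
    also have "\<dots> \<le> norm y * norm (Q (J k) g)" by (rule Cauchy_Schwarz_ineq2)
    finally have "norm y * (d k * norm y) \<le> norm y * norm (Q (J k) g)"
      by (simp add: power2_norm_eq_inner[symmetric] power2_eq_square mult_ac)
    then have "d k * norm y \<le> norm (Q (J k) g)"
      by (cases "norm y = 0") (simp_all only: mult_le_cancel_left_pos zero_less_norm_iff norm_eq_zero norm_zero mult_zero_right norm_ge_zero simp_thms)
    then show ?thesis by (simp add: y_def)
  qed
  have "\<bar>x \<bullet> f\<bar> \<le> (\<Sum>k\<in>F. norm (Q (J k) x) * norm (Q (J k) f))"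
    unfolding inner_sum[of x f] by (intro order_trans[OF sum_abs] sum_mono Cauchy_Schwarz_ineq2)
  also have "\<dots> = (\<Sum>k\<in>F. (norm (Q (J k) x) / sqrt (m k)) * (sqrt (m k) * norm (Q (J k) f)))"
    using m by (intro sum.cong refl) (simp add: less_imp_neq[THEN not_sym])
  finally have "(x \<bullet> f)\<^sup>2 \<le> (\<Sum>k\<in>F. (norm (Q (J k) x) / sqrt (m k)) * (sqrt (m k) * norm (Q (J k) f)))\<^sup>2"
    by (simp add: abs_le_square_iff[symmetric])
  also have "\<dots> \<le> (\<Sum>k\<in>F. (norm (Q (J k) x) / sqrt (m k))\<^sup>2) * (\<Sum>k\<in>F. (sqrt (m k) * norm (Q (J k) f))\<^sup>2)"
    by (rule Cauchy_Schwarz_ineq_sum)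
  also have "\<dots> = (\<Sum>k\<in>F. (norm (Q (J k) x))\<^sup>2 / m k) * (\<Sum>k\<in>F. m k * (norm (Q (J k) f))\<^sup>2)"
    using m by (simp add: power_divide power_mult_distrib less_imp_le)
  also have "\<dots> \<le> (3 * (\<integral>t. 1 / ((t - E)\<^sup>2 + \<epsilon>\<^sup>2) \<partial>diag x)) * ((norm g)\<^sup>2 + \<epsilon>\<^sup>2 * (norm f)\<^sup>2)"
  proof (rule mult_mono)
    interpret finite_measure "diag x" by (rule finite_measure_diag)
    have "(\<Sum>k\<in>F. (norm (Q (J k) x))\<^sup>2 / m k) = (\<integral>t. (\<Sum>k\<in>F. indicator (J k) t / m k) \<partial>diag x)"
      using Jb by (simp add: measure_diag less_top[symmetric] emeasure_diag)
    also have "\<dots> \<le> (\<integral>t. 3 * (1 / ((t - E)\<^sup>2 + \<epsilon>\<^sup>2)) \<partial>diag x)"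
    proof (rule integral_mono)
      show "integrable (diag x) (\<lambda>t. \<Sum>k\<in>F. indicator (J k) t / m k)"
        using Jb by (auto simp: less_top[symmetric] emeasure_diag)
      have "1 / ((t - E)\<^sup>2 + \<epsilon>\<^sup>2) \<le> 1 / \<epsilon>\<^sup>2" for t using \<epsilon> by (intro frac_le) auto
      then show "integrable (diag x) (\<lambda>t. 3 * (1 / ((t - E)\<^sup>2 + \<epsilon>\<^sup>2)))"
        by (intro integrable_mult_right integrable_diag[of _ "1 / \<epsilon>\<^sup>2"]) auto
      fix t
      define k where "k = \<lfloor>(t - E) / \<epsilon>\<rfloor>"
      have "t \<in> J k" by (simp add: cell k_def)
      then have "\<bar>t - E\<bar> \<le> d k + \<epsilon>" using \<epsilon> by (auto simp: J_def d_def max_def algebra_simps)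
      then have "(t - E)\<^sup>2 \<le> (d k + \<epsilon>)\<^sup>2" using \<epsilon> by (simp add: abs_le_square_iff[symmetric] d_def)
      also have "\<dots> \<le> 2 * (d k)\<^sup>2 + 2 * \<epsilon>\<^sup>2"
        using sum_squares_bound[of "d k" \<epsilon>] by (simp add: power2_sum)
      finally have le: "(t - E)\<^sup>2 + \<epsilon>\<^sup>2 \<le> 3 * m k"
        using zero_le_power2[of "d k"] zero_le_power2[of \<epsilon>] unfolding m_def distrib_left by linarith
      have "(\<Sum>k'\<in>F. indicator (J k') t / m k') \<le> 1 / m k"
      proof -
        have "(\<Sum>k'\<in>F. indicator (J k') t / m k') = (\<Sum>k'\<in>F. if k' = k then 1 / m k' else 0)"
          by (intro sum.cong refl) (auto simp: indicator_def cell k_def)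
        then show ?thesis using finF m[of k] by (simp add: less_imp_le)
      qed
      also have "1 / m k \<le> 3 * (1 / ((t - E)\<^sup>2 + \<epsilon>\<^sup>2))"
      proof -
        have "(t - E)\<^sup>2 + \<epsilon>\<^sup>2 > 0" using \<epsilon> by (intro add_nonneg_pos) auto
        then show ?thesis using le m[of k] by (simp add: divide_simps mult.commute)
      qed
      finally show "(\<Sum>k'\<in>F. indicator (J k') t / m k') \<le> 3 * (1 / ((t - E)\<^sup>2 + \<epsilon>\<^sup>2))" .
    qed
    finally show "(\<Sum>k\<in>F. (norm (Q (J k) x))\<^sup>2 / m k) \<le> 3 * (\<integral>t. 1 / ((t - E)\<^sup>2 + \<epsilon>\<^sup>2) \<partial>diag x)"
      by (simp only: Bochner_Integration.integral_mult_right_zero)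
    have "m k * (norm (Q (J k) f))\<^sup>2 \<le> (norm (Q (J k) g))\<^sup>2 + \<epsilon>\<^sup>2 * (norm (Q (J k) f))\<^sup>2" for k
    proof -
      have "(d k * norm (Q (J k) f))\<^sup>2 \<le> (norm (Q (J k) g))\<^sup>2"
        using dk[of k] by (intro power_mono) (auto simp: d_def)
      then show ?thesis by (simp add: m_def distrib_right power_mult_distrib)
    qed
    then have "(\<Sum>k\<in>F. m k * (norm (Q (J k) f))\<^sup>2) \<le> (\<Sum>k\<in>F. (norm (Q (J k) g))\<^sup>2 + \<epsilon>\<^sup>2 * (norm (Q (J k) f))\<^sup>2)"
      by (intro sum_mono)
    also have "\<dots> = (norm g)\<^sup>2 + \<epsilon>\<^sup>2 * (norm f)\<^sup>2"
      by (simp add: sum.distrib nsq flip: sum_distrib_left)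
    finally show "(\<Sum>k\<in>F. m k * (norm (Q (J k) f))\<^sup>2) \<le> (norm g)\<^sup>2 + \<epsilon>\<^sup>2 * (norm f)\<^sup>2" .
    show "0 \<le> 3 * (\<integral>t. 1 / ((t - E)\<^sup>2 + \<epsilon>\<^sup>2) \<partial>diag x)" by simp
    show "0 \<le> (\<Sum>k\<in>F. m k * (norm (Q (J k) f))\<^sup>2)" by (intro sum_nonneg mult_nonneg_nonneg less_imp_le[OF m]) simp
  qed
  finally show ?thesis by (simp add: g_def)
qed

end

section \<open>Generalized eigenfunctions\<close>

lemma sum_measure:
  fixes M N :: "real measure"
  assumes [simp]: "sets M = sets borel" "sets N = sets borel"
  defines "S \<equiv> measure_of UNIV (sets borel) (\<lambda>B. emeasure M B + emeasure N B)"
  shows "sets S = sets borel" "space S = UNIV"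
    and "B \<in> sets borel \<Longrightarrow> emeasure S B = emeasure M B + emeasure N B"
proof -
  show s: "sets S = sets borel" and sp: "space S = UNIV"
    unfolding S_def using sets.sigma_sets_eq[of "borel :: real measure"]
    by (simp_all add: sets_measure_of space_measure_of)
  show "emeasure S B = emeasure M B + emeasure N B" if "B \<in> sets borel"
  proof (rule emeasure_measure_of[OF meta_eq_to_obj_eq[OF S_def]])
    show "countably_additive (sets S) (\<lambda>B. emeasure M B + emeasure N B)"
    proof (rule countably_additiveI)
      fix A :: "nat \<Rightarrow> real set"
      assume A: "range A \<subseteq> sets S" "disjoint_family A"
      then show "(\<Sum>i. emeasure M (A i) + emeasure N (A i)) = emeasure M (\<Union>i. A i) + emeasure N (\<Union>i. A i)"
        by (subst suminf_add[symmetric]) (auto simp: suminf_emeasure s)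
    qed
  qed (use that s in \<open>auto simp: positive_def\<close>)
qed

definition dyadic_cell :: "nat \<Rightarrow> int \<Rightarrow> real set" where
  "dyadic_cell k j = {of_int j / 2 ^ k..<(of_int j + 1) / 2 ^ k}"

lemma dyadic_cell_borel [measurable, simp]: "dyadic_cell k j \<in> sets borel"
  by (simp add: dyadic_cell_def)

lemma in_dyadic_cell: "E \<in> dyadic_cell k j \<longleftrightarrow> j = \<lfloor>E * 2 ^ k\<rfloor>"
proof -
  have "E \<in> dyadic_cell k j \<longleftrightarrow> of_int j \<le> E * 2 ^ k \<and> E * 2 ^ k < of_int j + 1"
    by (auto simp: dyadic_cell_def field_simps)
  then show ?thesis using floor_eq_iff[of "E * 2 ^ k" j] by auto
qed

locale jacobi_family = spectral_family Q H R
  for Q :: "real set \<Rightarrow> 'h::real_inner \<Rightarrow> 'h" and H :: "'h \<Rightarrow> 'h" and R :: real +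
  fixes \<delta> :: "int \<Rightarrow> 'h" and v :: "int \<Rightarrow> real" and K :: real
  assumes inner_\<delta>: "\<And>i j. \<delta> i \<bullet> \<delta> j = (if i = j then 1 else 0)"
    and H_\<delta>: "\<And>n. H (\<delta> n) = \<delta> (n + 1) + \<delta> (n - 1) + v n *\<^sub>R \<delta> n"
    and H_bound: "\<And>x. \<bar>x \<bullet> H x\<bar> \<le> K * (x \<bullet> x)"
begin

lemma norm_\<delta>: "norm (\<delta> n) = 1"
  by (simp add: norm_eq_sqrt_inner inner_\<delta>)

definition m :: "int \<Rightarrow> real set \<Rightarrow> real" where
  "m n B = (norm (Q B (\<delta> n)))\<^sup>2"

definition \<mu> :: "real measure" where
  "\<mu> = measure_of UNIV (sets borel) (\<lambda>B. emeasure (diag (\<delta> 0)) B + emeasure (diag (\<delta> 1)) B)"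

lemma sets_\<mu> [simp, measurable_cong]: "sets \<mu> = sets borel"
  and space_\<mu> [simp]: "space \<mu> = UNIV"
  unfolding \<mu>_def using sum_measure(1,2)[of "diag (\<delta> 0)" "diag (\<delta> 1)"] by simp_all

lemma m_nonneg: "0 \<le> m n B" by (simp add: m_def)

lemma emeasure_\<mu>: "B \<in> sets borel \<Longrightarrow> emeasure \<mu> B = ennreal (m 0 B + m 1 B)"
  unfolding \<mu>_def using sum_measure(3)[of "diag (\<delta> 0)" "diag (\<delta> 1)" B]
  by (simp add: emeasure_diag m_def)

lemma measure_\<mu>: "B \<in> sets borel \<Longrightarrow> measure \<mu> B = m 0 B + m 1 B"
  by (simp add: measure_def emeasure_\<mu> m_nonneg del: ennreal_plus)

lemma finite_measure_\<mu>: "finite_measure \<mu>"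
  by (rule finite_measureI) (simp add: emeasure_\<mu>)

lemma m_diag: "B \<in> sets borel \<Longrightarrow> m n B = measure (diag (\<delta> n)) B"
  by (simp add: measure_diag m_def)

lemma m_le_1:
  assumes "B \<in> sets borel"
  shows "m n B \<le> 1"
proof -
  interpret finite_measure "diag (\<delta> n)" by (rule finite_measure_diag)
  have "m n B \<le> measure (diag (\<delta> n)) UNIV"
    unfolding m_diag[OF assms] using assms by (intro finite_measure_mono) auto
  then show ?thesis by (simp add: measure_diag Q_UNIV norm_\<delta>)
qed

lemma sum_m_le_1:
  assumes "finite F" "\<And>k. k \<in> F \<Longrightarrow> J k \<in> sets borel" "disjoint_family_on J F"
  shows "(\<Sum>k\<in>F. m n (J k)) \<le> 1"
proof -
  interpret finite_measure "diag (\<delta> n)" by (rule finite_measure_diag)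
  have U: "(\<Union>k\<in>F. J k) \<in> sets borel" using assms by auto
  have "(\<Sum>k\<in>F. m n (J k)) = (\<Sum>k\<in>F. measure (diag (\<delta> n)) (J k))"
    using assms by (intro sum.cong) (auto simp: m_diag)
  also have "\<dots> = measure (diag (\<delta> n)) (\<Union>k\<in>F. J k)"
    using assms by (intro finite_measure_finite_Union[symmetric]) auto
  also have "\<dots> \<le> 1" using m_le_1[OF U, of n] m_diag[OF U, of n] by simp
  finally show ?thesis .
qed

lemma AE_\<mu>_bounded: "AE E in \<mu>. E \<in> {-R<..<R}"
proof (rule AE_I)
  show "{E \<in> space \<mu>. E \<notin> {-R<..<R}} \<subseteq> - {-R<..<R}" by auto
  have "Q (- {-R<..<R}) x = Q (- {-R<..<R} \<inter> {-R<..<R}) x" for x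
    using Q_Int[of "- {-R<..<R}" "{-R<..<R}" x] Q_support by simp
  then have "Q (- {-R<..<R}) x = 0" for x by (metis Q_empty Compl_disjoint2)
  then show "emeasure \<mu> (- {-R<..<R}) = 0" by (simp add: emeasure_\<mu> m_def)
qed simp

lemma AE_\<mu>_cell_pos: "AE E in \<mu>. \<forall>k. measure \<mu> (dyadic_cell k \<lfloor>E * 2 ^ k\<rfloor>) > 0"
proof -
  have "AE E in \<mu>. E \<in> dyadic_cell k j \<longrightarrow> measure \<mu> (dyadic_cell k j) > 0" for k j
  proof (cases "measure \<mu> (dyadic_cell k j) > 0")
    case False
    then have "measure \<mu> (dyadic_cell k j) = 0" using measure_nonneg[of \<mu> "dyadic_cell k j"] by linarith
    then have "emeasure \<mu> (dyadic_cell k j) = 0" by (simp add: emeasure_\<mu> measure_\<mu>)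
    then have "dyadic_cell k j \<in> null_sets \<mu>" by auto
    from AE_not_in[OF this] show ?thesis by eventually_elim simp
  qed simp
  then have "AE E in \<mu>. \<forall>k j. E \<in> dyadic_cell k j \<longrightarrow> measure \<mu> (dyadic_cell k j) > 0"
    by (simp add: AE_all_countable)
  then show ?thesis by eventually_elim (use in_dyadic_cell in blast)
qed

text \<open>Over the dyadic intervals of one generation, the ratios integrate to at most the total mass of
  the weighted sum of the diagonal measures. By Fatou's lemma the lower limit of the ratios over the
  generations is finite almost everywhere.\<close>

lemma weighted_ratio_bounded:
  fixes w :: "nat \<Rightarrow> real"
  assumes w: "\<And>k. w k \<ge> 0" "summable w"
  defines "W \<equiv> \<lambda>B. (\<Sum>i. w i * (m (int i) B + m (- int i) B))"
  shows "B \<in> sets borel \<Longrightarrow> summable (\<lambda>i. w i * (m (int i) B + m (- int i) B))"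
    and "AE E in \<mu>. \<exists>C. \<exists>\<^sub>F k in sequentially.
      W (dyadic_cell k \<lfloor>E * 2 ^ k\<rfloor>) \<le> C * measure \<mu> (dyadic_cell k \<lfloor>E * 2 ^ k\<rfloor>)"
proof -
  show sm: "summable (\<lambda>i. w i * (m (int i) B + m (- int i) B))" if "B \<in> sets borel" for B
  proof (rule summable_comparison_test')
    show "summable (\<lambda>i. w i * 2)" using w(2) by (rule summable_mult2)
    have "m (int i) B + m (- int i) B \<le> 2" for i
      using m_le_1[OF that, of "int i"] m_le_1[OF that, of "- int i"] by linarith
    then show "norm (w i * (m (int i) B + m (- int i) B)) \<le> w i * 2" for i
      using w(1)[of i] m_nonneg by (simp add: abs_mult mult_left_mono)
  qed
  have W0: "W B \<ge> 0" if "B \<in> sets borel" for B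
    unfolding W_def using w m_nonneg by (intro suminf_nonneg sm that) auto
  interpret finite_measure \<mu> by (rule finite_measure_\<mu>)
  define F where "F = (\<lambda>k::nat. {\<lfloor>- R * 2 ^ k\<rfloor>..\<lfloor>R * 2 ^ k\<rfloor>})"
  define T where "T = (\<Sum>i. w i * 2)"
  define g where "g = (\<lambda>k E. \<Sum>j\<in>F k. W (dyadic_cell k j) / measure \<mu> (dyadic_cell k j) * indicator (dyadic_cell k j) E)"
  have dis: "disjoint_family_on (dyadic_cell k) A" for k A
    unfolding disjoint_family_on_def disjoint_iff in_dyadic_cell by simp
  have sumW: "(\<Sum>j\<in>F k. W (dyadic_cell k j)) \<le> T" for k
  proof -
    have "(\<Sum>j\<in>F k. W (dyadic_cell k j))
        = (\<Sum>i. \<Sum>j\<in>F k. w i * (m (int i) (dyadic_cell k j) + m (- int i) (dyadic_cell k j)))"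
      unfolding W_def by (intro suminf_sum[symmetric] sm) simp
    also have "\<dots> \<le> T" unfolding T_def
    proof (rule suminf_le)
      fix i
      have "(\<Sum>j\<in>F k. m (int i) (dyadic_cell k j)) \<le> 1" "(\<Sum>j\<in>F k. m (- int i) (dyadic_cell k j)) \<le> 1"
        using dis by (auto intro!: sum_m_le_1 simp: F_def)
      then have "w i * ((\<Sum>j\<in>F k. m (int i) (dyadic_cell k j)) + (\<Sum>j\<in>F k. m (- int i) (dyadic_cell k j))) \<le> w i * 2"
        using w(1) by (intro mult_left_mono) auto
      then show "(\<Sum>j\<in>F k. w i * (m (int i) (dyadic_cell k j) + m (- int i) (dyadic_cell k j))) \<le> w i * 2"
        by (simp add: sum_distrib_left sum.distrib distrib_left)
    qed (use w(2) sm in \<open>auto intro!: summable_sum summable_mult2\<close>)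
    finally show ?thesis .
  qed
  have g0: "g k E \<ge> 0" for k E unfolding g_def using W0 by (intro sum_nonneg) auto
  have gm [measurable]: "g k \<in> borel_measurable \<mu>" for k unfolding g_def by measurable
  have "(\<integral>\<^sup>+E. ennreal (g k E) \<partial>\<mu>) \<le> ennreal T" for k
  proof -
    have int: "integrable \<mu> (indicator (dyadic_cell k j) :: real \<Rightarrow> real)" for j
      by (intro integrable_real_indicator) (auto simp: less_top[symmetric])
    have "(\<integral>\<^sup>+E. ennreal (g k E) \<partial>\<mu>) = ennreal (\<integral>E. g k E \<partial>\<mu>)"
    proof (rule nn_integral_eq_integral)
      show "integrable \<mu> (g k)"
        unfolding g_def using int by (intro Bochner_Integration.integrable_sum integrable_mult_right)
    qed (simp add: g0)
    also have "(\<integral>E. g k E \<partial>\<mu>) = (\<Sum>j\<in>F k. W (dyadic_cell k j) / measure \<mu> (dyadic_cell k j) * measure \<mu> (dyadic_cell k j))"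
      unfolding g_def using int by (simp add: Bochner_Integration.integral_sum)
    also have "\<dots> \<le> (\<Sum>j\<in>F k. W (dyadic_cell k j))"
      using W0 by (intro sum_mono) auto
    also have "\<dots> \<le> T" by (rule sumW)
    finally show ?thesis by (simp add: ennreal_leI)
  qed
  then have "liminf (\<lambda>k. \<integral>\<^sup>+E. ennreal (g k E) \<partial>\<mu>) \<le> ennreal T"
    by (intro Liminf_le) auto
  then have "(\<integral>\<^sup>+E. liminf (\<lambda>k. ennreal (g k E)) \<partial>\<mu>) \<le> ennreal T"
    by (intro order_trans[OF nn_integral_liminf]) auto
  then have fin: "(\<integral>\<^sup>+E. liminf (\<lambda>k. ennreal (g k E)) \<partial>\<mu>) \<noteq> \<infinity>"
    by (auto simp: top_unique)
  have "AE E in \<mu>. liminf (\<lambda>k. ennreal (g k E)) \<noteq> \<infinity>"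
    by (rule nn_integral_PInf_AE[OF _ fin]) measurable
  then show "AE E in \<mu>. \<exists>C. \<exists>\<^sub>F k in sequentially.
      W (dyadic_cell k \<lfloor>E * 2 ^ k\<rfloor>) \<le> C * measure \<mu> (dyadic_cell k \<lfloor>E * 2 ^ k\<rfloor>)"
    using AE_\<mu>_cell_pos AE_\<mu>_bounded
  proof eventually_elim
    case (elim E)
    define C where "C = enn2real (liminf (\<lambda>k. ennreal (g k E))) + 1"
    have C: "\<not> ennreal C \<le> liminf (\<lambda>k. ennreal (g k E))"
    proof -
      define l where "l = liminf (\<lambda>k. ennreal (g k E))"
      have "l = ennreal (enn2real l)" using elim(1) by (simp add: l_def less_top)
      also have "\<dots> < ennreal (enn2real l + 1)" by (intro ennreal_lessI add_nonneg_pos) auto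
      finally show ?thesis by (simp add: C_def l_def)
    qed
    have "\<exists>\<^sub>F k in sequentially. \<not> ennreal C \<le> ennreal (g k E)"
      unfolding frequently_def using C Liminf_bounded[of "ennreal C" "\<lambda>k. ennreal (g k E)" sequentially] by auto
    moreover have "W (dyadic_cell k \<lfloor>E * 2 ^ k\<rfloor>) \<le> C * measure \<mu> (dyadic_cell k \<lfloor>E * 2 ^ k\<rfloor>)"
      if "\<not> ennreal C \<le> ennreal (g k E)" for k
    proof -
      define j where "j = \<lfloor>E * 2 ^ k\<rfloor>"
      have jF: "j \<in> F k"
      proof -
        have "- R * 2 ^ k \<le> E * 2 ^ k" "E * 2 ^ k \<le> R * 2 ^ k"
          using elim(3) by (intro mult_right_mono; simp)+
        then show ?thesis unfolding j_def F_def by (simp add: floor_mono)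
      qed
      have "g k E = (\<Sum>i\<in>F k. if i = j then W (dyadic_cell k i) / measure \<mu> (dyadic_cell k i) else 0)"
        unfolding g_def by (intro sum.cong refl) (auto simp: indicator_def in_dyadic_cell j_def)
      also have "\<dots> = W (dyadic_cell k j) / measure \<mu> (dyadic_cell k j)"
        using jF by (simp add: F_def)
      finally have "g k E = W (dyadic_cell k j) / measure \<mu> (dyadic_cell k j)" .
      moreover have "g k E < C" using that by (meson ennreal_leI not_le)
      ultimately show ?thesis using elim(2) by (simp add: j_def field_simps)
    qed
    ultimately have "\<exists>\<^sub>F k in sequentially.
        W (dyadic_cell k \<lfloor>E * 2 ^ k\<rfloor>) \<le> C * measure \<mu> (dyadic_cell k \<lfloor>E * 2 ^ k\<rfloor>)"
      by (rule frequently_elim1)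
    then show ?case by blast
  qed
qed

text \<open>The solution is a limit of \<open>\<langle>\<delta>\<^sub>n, Q(I) \<delta>\<^sub>j\<rangle> / \<mu>(I)\<close> along dyadic intervals \<open>I\<close> shrinking to \<open>E\<close>,
  where \<open>j\<close> is the one of 0 and 1 whose diagonal measure of \<open>I\<close> is larger. Since \<open>Q(I) \<delta>\<^sub>j\<close> is an
  approximate eigenvector, the equation holds in the limit, and a subsequence converges
  at all sites as soon as it converges at 0 and 1. By the Cauchy-Schwarz inequality, the weighted
  square sums inherit the bound of the weighted ratios.\<close>

lemma generalized_eigenfunction:
  fixes w :: "nat \<Rightarrow> real"
  assumes w: "\<And>k. w k > 0" "summable w"
  shows "AE E in \<mu>. \<bar>E\<bar> \<le> K \<and> (\<exists>u C. solution v E u \<and> 1 / 2 \<le> max \<bar>u 0\<bar> \<bar>u 1\<bar> \<and>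
      (\<forall>l. (\<Sum>i<l. w i * ((u (int i))\<^sup>2 + (u (- int i))\<^sup>2)) \<le> C))"
proof -
  define W where "W = (\<lambda>B. (\<Sum>i. w i * (m (int i) B + m (- int i) B)))"
  have w0: "w k \<ge> 0" for k using w(1)[of k] by simp
  note sm = weighted_ratio_bounded(1)[OF w0 w(2)]
  show ?thesis
    using weighted_ratio_bounded(2)[OF w0 w(2)] AE_\<mu>_cell_pos
  proof eventually_elim
    case (elim E)
    define I where "I = (\<lambda>k. dyadic_cell k \<lfloor>E * 2 ^ k\<rfloor>)"
    have I: "I k \<in> sets borel" for k by (simp add: I_def)
    define M where "M = (\<lambda>k. measure \<mu> (I k))"
    have M: "M k > 0" for k using elim(2) by (simp add: M_def I_def)
    have Mm: "M k = m 0 (I k) + m 1 (I k)" for k by (simp add: M_def measure_\<mu> I)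
    have near: "I k \<subseteq> {E - 1 / 2 ^ k..E + 1 / 2 ^ k}" for k
    proof
      fix t assume t: "t \<in> I k"
      have "E \<in> I k" by (simp add: I_def in_dyadic_cell)
      with t show "t \<in> {E - 1 / 2 ^ k..E + 1 / 2 ^ k}"
        by (auto simp: I_def dyadic_cell_def add_divide_distrib)
    qed
    obtain C where "\<exists>\<^sub>F k in sequentially. W (I k) \<le> C * M k"
      using elim(1) unfolding I_def M_def W_def by blast
    then have "infinite {k. W (I k) \<le> C * M k}"
      by (simp add: frequently_sequentially infinite_nat_iff_unbounded_le)
    then obtain r0 :: "nat \<Rightarrow> nat" where r0: "strict_mono r0" "\<And>i. W (I (r0 i)) \<le> C * M (r0 i)"
      using infinite_enumerate by blast
    define jj where "jj = (\<lambda>k. if m 0 (I k) \<ge> m 1 (I k) then 0 else 1 :: int)"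
    define x where "x = (\<lambda>k. Q (I k) (\<delta> (jj k)))"
    have Qx: "Q (I k) (x k) = x k" for k by (simp add: x_def idem I)
    have xx: "x k \<bullet> x k = m (jj k) (I k)" for k by (simp add: x_def m_def power2_norm_eq_inner)
    have mj: "m (jj k) (I k) \<ge> M k / 2" "m (jj k) (I k) \<le> M k" for k
      using m_nonneg[of 0 "I k"] m_nonneg[of 1 "I k"] by (auto simp: jj_def Mm)
    define \<psi> where "\<psi> = (\<lambda>k n. \<delta> n \<bullet> x k / M k)"
    have inner_Q: "\<delta> n \<bullet> x k = Q (I k) (\<delta> n) \<bullet> x k" for n k by (metis Qx sym I)
    have E: "\<bar>E\<bar> \<le> K"
    proof (rule ccontr)
      assume "\<not> \<bar>E\<bar> \<le> K"
      then obtain k where k: "(1 / 2) ^ k < \<bar>E\<bar> - K"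
        using real_arch_pow_inv[of "\<bar>E\<bar> - K" "1 / 2"] by auto
      have p: "x k \<bullet> x k > 0" using mj(1)[of k] M[of k] xx[of k] by linarith
      have "\<bar>x k \<bullet> H (x k) - E * (x k \<bullet> x k)\<bar> \<le> (1 / 2 ^ k) / 2 * (x k \<bullet> x k + x k \<bullet> x k)"
        by (rule approximate_eigenvector[OF I near Qx Qx])
      then have "\<bar>x k \<bullet> H (x k) - E * (x k \<bullet> x k)\<bar> \<le> (1 / 2) ^ k * (x k \<bullet> x k)"
        by (simp add: power_one_over)
      moreover have "\<bar>E * (x k \<bullet> x k)\<bar> = \<bar>E\<bar> * (x k \<bullet> x k)" using p by (simp add: abs_mult)
      ultimately have "\<bar>E\<bar> * (x k \<bullet> x k) \<le> K * (x k \<bullet> x k) + (1 / 2) ^ k * (x k \<bullet> x k)"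
        using H_bound[of "x k"] by linarith
      then have "\<bar>E\<bar> \<le> K + (1 / 2) ^ k" using p by (simp flip: distrib_right)
      then show False using k by linarith
    qed
    have jval: "1 / 2 \<le> max \<bar>\<psi> k 0\<bar> \<bar>\<psi> k 1\<bar>" for k
    proof -
      have "\<psi> k (jj k) = m (jj k) (I k) / M k" by (simp add: \<psi>_def x_def inner_Q_self I m_def)
      moreover have "1 / 2 \<le> m (jj k) (I k) / M k" using mj(1)[of k] M[of k] by (simp add: pos_le_divide_eq)
      ultimately have "1 / 2 \<le> \<psi> k (jj k)" by simp
      then show ?thesis by (auto simp: jj_def split: if_splits)
    qed
    have \<psi>2: "(\<psi> k n)\<^sup>2 \<le> m n (I k) / M k" for k n
    proof -
      have "(\<delta> n \<bullet> x k)\<^sup>2 \<le> m n (I k) * m (jj k) (I k)"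
        using Cauchy_Schwarz_ineq[of "Q (I k) (\<delta> n)" "x k"]
        by (simp add: inner_Q xx m_def power2_norm_eq_inner)
      also have "\<dots> \<le> m n (I k) * M k" using mj m_nonneg by (intro mult_left_mono) auto
      finally show ?thesis using M[of k] by (simp add: \<psi>_def power_divide power2_eq_square field_simps)
    qed
    have eq: "\<bar>\<psi> k (n + 1) + \<psi> k (n - 1) + v n * \<psi> k n - E * \<psi> k n\<bar> \<le> (1 / 2) ^ k * (m n (I k) / M k + 1)" for k n
    proof -
      define y where "y = Q (I k) (\<delta> n)"
      have y: "Q (I k) y = y" by (simp add: y_def idem I)
      have "\<bar>y \<bullet> H (x k) - E * (y \<bullet> x k)\<bar> \<le> (1 / 2 ^ k) / 2 * (y \<bullet> y + x k \<bullet> x k)"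
        by (rule approximate_eigenvector[OF I near y Qx])
      also have "\<dots> \<le> (1 / 2) ^ k * (m n (I k) + M k)"
      proof -
        have "y \<bullet> y + x k \<bullet> x k \<le> m n (I k) + M k"
          using mj(2)[of k] by (simp add: xx y_def m_def power2_norm_eq_inner)
        moreover have "0 \<le> m n (I k) + M k" using M[of k] m_nonneg[of n "I k"] by simp
        ultimately have "(1 / 2) ^ k / 2 * (y \<bullet> y + x k \<bullet> x k) \<le> (1 / 2) ^ k / 2 * (m n (I k) + M k)"
          and "(1 / 2) ^ k / 2 * (m n (I k) + M k) \<le> (1 / 2) ^ k * (m n (I k) + M k)"
          by (intro mult_left_mono mult_right_mono; simp)+
        moreover have "1 / 2 ^ k = (1 / 2 :: real) ^ k" by (simp add: power_one_over)
        ultimately show ?thesis by (simp only:)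
      qed
      finally have 1: "\<bar>y \<bullet> H (x k) - E * (y \<bullet> x k)\<bar> \<le> (1 / 2) ^ k * (m n (I k) + M k)" .
      have "y \<bullet> H (x k) = \<delta> n \<bullet> H (x k)"
        using inner_H_Q(1)[OF I[of k], of "\<delta> n" "x k"] Qx[of k] by (simp add: y_def)
      also have "\<dots> = H (\<delta> n) \<bullet> x k" by (simp add: H_sym)
      also have "\<dots> = \<delta> (n + 1) \<bullet> x k + \<delta> (n - 1) \<bullet> x k + v n * (\<delta> n \<bullet> x k)"
        by (simp add: H_\<delta> inner_add_left)
      finally have 2: "y \<bullet> H (x k) - E * (y \<bullet> x k)
          = M k * (\<psi> k (n + 1) + \<psi> k (n - 1) + v n * \<psi> k n - E * \<psi> k n)"
        using M[of k] by (simp add: \<psi>_def y_def inner_Q[symmetric] algebra_simps add_divide_distrib)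
      have "M k * \<bar>\<psi> k (n + 1) + \<psi> k (n - 1) + v n * \<psi> k n - E * \<psi> k n\<bar> \<le> (1 / 2) ^ k * (m n (I k) + M k)"
        using 1 M[of k] unfolding 2 by (simp add: abs_mult)
      also have "\<dots> = M k * ((1 / 2) ^ k * (m n (I k) / M k + 1))" using M[of k] by (simp add: field_simps)
      finally show ?thesis using M[of k] by (simp only: mult_le_cancel_left_pos)
    qed
    have "bounded (range (\<lambda>i. (\<psi> (r0 i) 0, \<psi> (r0 i) 1)))"
    proof -
      have "\<bar>\<psi> k n\<bar> \<le> 1" if "n = 0 \<or> n = 1" for k n
      proof -
        have "m n (I k) \<le> M k" using that m_nonneg[of 0 "I k"] m_nonneg[of 1 "I k"] by (auto simp: Mm)
        then have "m n (I k) / M k \<le> 1" using M[of k] by (simp add: field_simps)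
        then have "(\<psi> k n)\<^sup>2 \<le> 1" using \<psi>2[of k n] by linarith
        then show ?thesis by (simp add: abs_square_le_1)
      qed
      then have "(\<psi> (r0 i) 0, \<psi> (r0 i) 1) \<in> cball 0 1 \<times> cball 0 1" for i by (simp add: mem_cball)
      then have "range (\<lambda>i. (\<psi> (r0 i) 0, \<psi> (r0 i) 1)) \<subseteq> cball 0 1 \<times> cball 0 1" by blast
      then show ?thesis by (rule bounded_subset[OF bounded_Times[OF bounded_cball bounded_cball]])
    qed
    then obtain l r1 where r1: "strict_mono r1" "((\<lambda>i. (\<psi> (r0 i) 0, \<psi> (r0 i) 1)) \<circ> r1) \<longlonglongrightarrow> l"
      using bounded_imp_convergent_subsequence by blast
    define r where "r = r0 \<circ> r1"
    have r: "strict_mono r" unfolding r_def by (rule strict_mono_o[OF r0(1) r1(1)])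
    define f where "f = (\<lambda>n i. \<psi> (r i) n)"
    have f01: "convergent (f 0)" "convergent (f 1)"
      using tendsto_fst[OF r1(2)] tendsto_snd[OF r1(2)]
      by (auto simp: f_def r_def o_def convergent_def)
    have WC: "W (I (r i)) \<le> C * M (r i)" for i using r0(2) by (simp add: r_def)
    have single: "w i * (m (int i) (I k) + m (- int i) (I k)) \<le> W (I k)" for i k
    proof -
      have "(\<Sum>j\<in>{i}. w j * (m (int j) (I k) + m (- int j) (I k))) \<le> W (I k)"
        unfolding W_def using w0 m_nonneg by (intro sum_le_suminf sm I) auto
      then show ?thesis by simp
    qed
    have mC: "m n (I (r i)) / M (r i) \<le> C / w (nat \<bar>n\<bar>)" for n i
    proof -
      have "m n (I (r i)) \<le> m (int (nat \<bar>n\<bar>)) (I (r i)) + m (- int (nat \<bar>n\<bar>)) (I (r i))"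
        using m_nonneg[of n "I (r i)"] m_nonneg[of "- n" "I (r i)"] by (cases "n \<ge> 0") auto
      then have "w (nat \<bar>n\<bar>) * m n (I (r i)) \<le> C * M (r i)"
        using single[of "nat \<bar>n\<bar>" "r i"] WC[of i] mult_left_mono[OF _ w0] by (meson order_trans)
      then show ?thesis using M[of "r i"] w(1)[of "nat \<bar>n\<bar>"] by (simp add: field_simps)
    qed
    define e where "e = (\<lambda>n i. f (n + 1) i + f (n - 1) i + v n * f n i - E * f n i)"
    have e0: "e n \<longlonglongrightarrow> 0" for n
    proof (rule Lim_null_comparison)
      show "\<forall>\<^sub>F i in sequentially. norm (e n i) \<le> (1 / 2) ^ r i * (C / w (nat \<bar>n\<bar>) + 1)"
      proof (intro always_eventually allI)
        fix i
        have "\<bar>e n i\<bar> \<le> (1 / 2) ^ r i * (m n (I (r i)) / M (r i) + 1)" unfolding e_def f_def by (rule eq)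
        also have "\<dots> \<le> (1 / 2) ^ r i * (C / w (nat \<bar>n\<bar>) + 1)" using mC by (intro mult_left_mono) auto
        finally show "norm (e n i) \<le> (1 / 2) ^ r i * (C / w (nat \<bar>n\<bar>) + 1)" by simp
      qed
      have "(\<lambda>k. (1 / 2 :: real) ^ k) \<longlonglongrightarrow> 0" by (rule LIMSEQ_power_zero) simp
      from LIMSEQ_subseq_LIMSEQ[OF this r] have "(\<lambda>i. (1 / 2 :: real) ^ r i) \<longlonglongrightarrow> 0" by (simp add: o_def)
      from tendsto_mult_right[OF this, of "C / w (nat \<bar>n\<bar>) + 1"]
      show "(\<lambda>i. (1 / 2) ^ r i * (C / w (nat \<bar>n\<bar>) + 1)) \<longlonglongrightarrow> 0" by simp
    qed
    have ce: "convergent (e n)" for n using e0 convergent_def by blast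
    have up: "convergent (f (int n)) \<and> convergent (f (int n + 1))" for n
    proof (induction n)
      case (Suc n)
      have "f (int n + 2) = (\<lambda>i. e (int n + 1) i - f (int n) i - v (int n + 1) * f (int n + 1) i + E * f (int n + 1) i)"
        by (rule ext) (simp add: e_def ac_simps)
      moreover have "convergent (\<lambda>i. e (int n + 1) i - f (int n) i - v (int n + 1) * f (int n + 1) i + E * f (int n + 1) i)"
        using Suc ce by (intro convergent_add convergent_diff) (auto intro: convergent_mult convergent_const)
      ultimately show ?case using Suc by (simp add: ac_simps)
    qed (use f01 in simp)
    have down: "convergent (f (- int n)) \<and> convergent (f (1 - int n))" for n
    proof (induction n)
      case (Suc n)
      have "f (- int n - 1) = (\<lambda>i. e (- int n) i - f (1 - int n) i - v (- int n) * f (- int n) i + E * f (- int n) i)"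
        by (auto simp: e_def)
      moreover have "convergent (\<lambda>i. e (- int n) i - f (1 - int n) i - v (- int n) * f (- int n) i + E * f (- int n) i)"
        using Suc ce by (intro convergent_add convergent_diff) (auto intro: convergent_mult convergent_const)
      moreover have "- int (Suc n) = - int n - 1" "1 - int (Suc n) = - int n" by auto
      ultimately show ?case using Suc by metis
    qed (use f01 in simp)
    define u where "u = (\<lambda>n. lim (f n))"
    have fu: "f n \<longlonglongrightarrow> u n" for n
    proof -
      have "convergent (f n)"
        using up[of "nat n"] down[of "nat (- n)"] by (cases "n \<ge> 0") auto
      then show ?thesis by (simp add: u_def convergent_LIMSEQ_iff)
    qed
    have "solution v E u" unfolding solution_def
    proof
      fix n
      have "e n \<longlonglongrightarrow> u (n + 1) + u (n - 1) + v n * u n - E * u n"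
        unfolding e_def by (intro tendsto_intros fu)
      with e0 have "u (n + 1) + u (n - 1) + v n * u n - E * u n = 0" by (metis LIMSEQ_unique)
      then show "u (n + 1) + u (n - 1) + v n * u n = E * u n" by simp
    qed
    moreover have "1 / 2 \<le> max \<bar>u 0\<bar> \<bar>u 1\<bar>"
    proof (rule LIMSEQ_le_const)
      show "(\<lambda>i. max \<bar>f 0 i\<bar> \<bar>f 1 i\<bar>) \<longlonglongrightarrow> max \<bar>u 0\<bar> \<bar>u 1\<bar>" by (intro tendsto_intros fu)
      show "\<exists>N. \<forall>i\<ge>N. 1 / 2 \<le> max \<bar>f 0 i\<bar> \<bar>f 1 i\<bar>" using jval by (auto simp: f_def)
    qed
    moreover have "(\<Sum>i<l. w i * ((u (int i))\<^sup>2 + (u (- int i))\<^sup>2)) \<le> C" for l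
    proof (rule LIMSEQ_le_const2)
      show "(\<lambda>k. \<Sum>i<l. w i * ((f (int i) k)\<^sup>2 + (f (- int i) k)\<^sup>2)) \<longlonglongrightarrow> (\<Sum>i<l. w i * ((u (int i))\<^sup>2 + (u (- int i))\<^sup>2))"
        by (intro tendsto_intros fu)
      have "(\<Sum>i<l. w i * ((f (int i) k)\<^sup>2 + (f (- int i) k)\<^sup>2)) \<le> C" for k
      proof -
        have "(\<Sum>i<l. w i * ((f (int i) k)\<^sup>2 + (f (- int i) k)\<^sup>2))
            \<le> (\<Sum>i<l. w i * (m (int i) (I (r k)) / M (r k) + m (- int i) (I (r k)) / M (r k)))"
          unfolding f_def using w0 by (intro sum_mono mult_left_mono add_mono \<psi>2) auto
        also have "\<dots> = (\<Sum>i<l. w i * (m (int i) (I (r k)) + m (- int i) (I (r k)))) / M (r k)"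
          by (simp add: sum_divide_distrib add_divide_distrib[symmetric])
        also have "\<dots> \<le> W (I (r k)) / M (r k)"
          unfolding W_def using w0 m_nonneg M[of "r k"]
          by (intro divide_right_mono sum_le_suminf sm I) auto
        also have "\<dots> \<le> C" using WC[of k] M[of "r k"] by (simp add: field_simps)
        finally show ?thesis .
      qed
      then show "\<exists>N. \<forall>k\<ge>N. (\<Sum>i<l. w i * ((f (int i) k)\<^sup>2 + (f (- int i) k)\<^sup>2)) \<le> C" by blast
    qed
    ultimately show ?case using E by blast
  qed
qed

end

section \<open>Comparison of Poisson kernels\<close>

text \<open>The imaginary part of the Borel transform at \<open>E + i\<epsilon>\<close>, divided by \<open>\<epsilon>\<close>. Without the factor \<open>\<epsilon>\<close> the
  kernel is decreasing in \<open>\<epsilon>\<close>.\<close>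

definition poisson :: "real measure \<Rightarrow> real \<Rightarrow> real \<Rightarrow> real" where
  "poisson M \<epsilon> E = (\<integral>t. 1 / ((t - E)\<^sup>2 + \<epsilon>\<^sup>2) \<partial>M)"

lemma poisson_integrable:
  fixes M :: "real measure"
  assumes [simp]: "sets M = sets borel" and "finite_measure M" and \<epsilon>: "\<epsilon> > 0"
  shows "integrable M (\<lambda>t. 1 / ((t - E)\<^sup>2 + \<epsilon>\<^sup>2))"
proof -
  interpret finite_measure M by fact
  have "norm (1 / ((t - E)\<^sup>2 + \<epsilon>\<^sup>2)) \<le> 1 / \<epsilon>\<^sup>2" for t
    using \<epsilon> by (simp add: frac_le add_nonneg_pos)
  then show ?thesis
    by (intro integrable_const_bound[where B = "1 / \<epsilon>\<^sup>2"]) (auto simp: measurable_cong_sets[OF assms(1) refl])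
qed

lemma sum_inverse_squares_bounded:
  obtains C :: real where "\<And>F. finite F \<Longrightarrow> (\<Sum>j\<in>F. 1 / (1 + (of_int j)\<^sup>2)) \<le> C"
proof -
  define a where "a = (\<lambda>n::nat. 1 / (1 + (real n)\<^sup>2))"
  have sm: "summable a"
  proof (rule summable_comparison_test')
    show "summable (\<lambda>n. 2 * (1 / (real (Suc n))\<^sup>2))"
      using inverse_squares_sums by (intro summable_mult) (simp add: sums_iff)
    show "norm (a n) \<le> 2 * (1 / (real (Suc n))\<^sup>2)" for n
    proof -
      have "(real (Suc n))\<^sup>2 \<le> 2 * (1 + (real n)\<^sup>2)"
        using sum_squares_bound[of 1 "real n"] by (simp add: power2_sum)
      moreover have "1 + (real n)\<^sup>2 > 0" "(real (Suc n))\<^sup>2 > 0" by (simp_all add: add_pos_nonneg)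
      ultimately show ?thesis unfolding a_def by (simp add: divide_simps)
    qed
  qed
  have a0: "a n \<ge> 0" for n by (simp add: a_def)
  have half: "(\<Sum>j\<in>F. 1 / (1 + (of_int j)\<^sup>2)) \<le> suminf a"
    if "finite F" and "inj_on (\<lambda>j. nat \<bar>j\<bar>) F" for F
  proof -
    have "(\<Sum>j\<in>F. 1 / (1 + (of_int j)\<^sup>2)) = (\<Sum>j\<in>F. a (nat \<bar>j\<bar>))"
      by (intro sum.cong refl) (simp add: a_def)
    also have "\<dots> = (\<Sum>n\<in>(\<lambda>j. nat \<bar>j\<bar>) ` F. a n)" by (simp add: sum.reindex[OF that(2)])
    also have "\<dots> \<le> suminf a" using that(1) a0 by (intro sum_le_suminf sm) auto
    finally show ?thesis .
  qed
  show ?thesis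
  proof (rule that[of "suminf a + suminf a"])
    fix F :: "int set" assume F: "finite F"
    have "(\<Sum>j\<in>F. 1 / (1 + (of_int j)\<^sup>2))
        = (\<Sum>j\<in>{j\<in>F. j \<ge> 0}. 1 / (1 + (of_int j)\<^sup>2)) + (\<Sum>j\<in>{j\<in>F. \<not> j \<ge> 0}. 1 / (1 + (real_of_int j)\<^sup>2))"
      using F by (subst sum.union_disjoint[symmetric]) (auto intro!: sum.cong)
    also have "\<dots> \<le> suminf a + suminf a"
      using F by (intro add_mono half) (auto simp: inj_on_def)
    finally show "(\<Sum>j\<in>F. 1 / (1 + (of_int j)\<^sup>2)) \<le> suminf a + suminf a" .
  qed
qed

text \<open>Call a cell of length \<open>\<epsilon>\<close> bad if it contains a point at which the kernel of \<open>N\<close> is smaller than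
  \<open>\<epsilon>\<^sup>\<sigma>\<close> times that of \<open>M\<close>. The kernel of \<open>N\<close> at such a point bounds the \<open>N\<close>-measure of its cell,
  and the kernels centred at one point in each cell add up to at most a constant times \<open>\<epsilon>\<^sup>-\<^sup>2\<close>. So the
  bad cells have \<open>N\<close>-measure \<open>O(\<epsilon>\<^sup>\<sigma>)\<close>, which is summable over dyadic \<open>\<epsilon>\<close>.\<close>

lemma poisson_comparison:
  fixes M N :: "real measure"
  assumes M: "sets M = sets borel" "finite_measure M" and N: "sets N = sets borel" "finite_measure N"
    and bdd: "AE E in N. \<bar>E\<bar> < R" and \<sigma>: "\<sigma> > 0"
  shows "AE E in N. \<forall>\<^sub>F k in sequentially.
    ((1 / 2) ^ k) powr \<sigma> * poisson M ((1 / 2) ^ k) E \<le> poisson N ((1 / 2) ^ k) E"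
proof -
  interpret M: finite_measure M by fact
  interpret N: finite_measure N by fact
  have [simp]: "space N = UNIV" "space M = UNIV" using sets_eq_imp_space_eq[OF N(1)] sets_eq_imp_space_eq[OF M(1)] by auto
  note [simp] = M(1) N(1)
  obtain C :: real where C: "\<And>F. finite F \<Longrightarrow> (\<Sum>j\<in>F. 1 / (1 + (of_int j)\<^sup>2)) \<le> C"
    using sum_inverse_squares_bounded by blast
  define \<epsilon> where "\<epsilon> = (\<lambda>k::nat. (1 / 2 :: real) ^ k)"
  have \<epsilon>: "\<epsilon> k > 0" for k by (simp add: \<epsilon>_def)
  define bad where "bad = (\<lambda>k E. poisson N (\<epsilon> k) E < \<epsilon> k powr \<sigma> * poisson M (\<epsilon> k) E)"
  define F where "F = (\<lambda>k::nat. {\<lfloor>- R * 2 ^ k\<rfloor>..\<lfloor>R * 2 ^ k\<rfloor>})"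
  define B where "B = (\<lambda>k. {j\<in>F k. \<exists>E\<in>dyadic_cell k j. bad k E})"
  define A where "A = (\<lambda>k. \<Union>j\<in>B k. dyadic_cell k j)"
  have finB: "finite (B k)" for k by (rule finite_subset[of _ "F k"]) (auto simp: B_def F_def)
  have A: "A k \<in> sets N" for k unfolding A_def using finB by auto
  have small: "measure N (A k) \<le> 8 * C * measure M UNIV * (\<epsilon> k powr \<sigma>)" for k
  proof -
    have "\<exists>E. \<forall>j\<in>B k. E j \<in> dyadic_cell k j \<and> bad k (E j)"
      by (rule bchoice) (auto simp: B_def)
    then obtain E where E: "\<And>j. j \<in> B k \<Longrightarrow> E j \<in> dyadic_cell k j" "\<And>j. j \<in> B k \<Longrightarrow> bad k (E j)"
      by blast
    have scale: "(2::real) ^ k = 1 / \<epsilon> k" by (simp add: \<epsilon>_def power_one_over)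
    have cell: "t \<in> dyadic_cell k j \<longleftrightarrow> of_int j * \<epsilon> k \<le> t \<and> t < (of_int j + 1) * \<epsilon> k" for t j
      by (simp add: dyadic_cell_def scale)
    have one: "measure N (dyadic_cell k j) \<le> 2 * (\<epsilon> k)\<^sup>2 * (\<epsilon> k powr \<sigma> * poisson M (\<epsilon> k) (E j))" if j: "j \<in> B k" for j
    proof -
      have "measure N (dyadic_cell k j) * (1 / (2 * (\<epsilon> k)\<^sup>2)) = (\<integral>t. indicator (dyadic_cell k j) t * (1 / (2 * (\<epsilon> k)\<^sup>2)) \<partial>N)"
        by simp
      also have "\<dots> \<le> poisson N (\<epsilon> k) (E j)"
        unfolding poisson_def
      proof (rule integral_mono)
        show "integrable N (\<lambda>t. indicator (dyadic_cell k j) t * (1 / (2 * (\<epsilon> k)\<^sup>2)))"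
          by (intro integrable_mult_left integrable_real_indicator) (auto simp: less_top[symmetric])
        show "integrable N (\<lambda>t. 1 / ((t - E j)\<^sup>2 + (\<epsilon> k)\<^sup>2))" by (rule poisson_integrable[OF N \<epsilon>])
        fix t
        show "indicator (dyadic_cell k j) t * (1 / (2 * (\<epsilon> k)\<^sup>2)) \<le> 1 / ((t - E j)\<^sup>2 + (\<epsilon> k)\<^sup>2)"
        proof (cases "t \<in> dyadic_cell k j")
          case True
          then have "\<bar>t - E j\<bar> \<le> \<epsilon> k" using E(1)[OF j] unfolding cell by (simp add: algebra_simps abs_le_iff)
          then have "(t - E j)\<^sup>2 \<le> (\<epsilon> k)\<^sup>2" using \<epsilon>[of k] by (simp add: abs_le_square_iff[symmetric])
          then have "1 / (2 * (\<epsilon> k)\<^sup>2) \<le> 1 / ((t - E j)\<^sup>2 + (\<epsilon> k)\<^sup>2)"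
            using \<epsilon>[of k] by (intro frac_le) (auto intro: add_nonneg_pos)
          then show ?thesis using True by simp
        qed simp
      qed
      also have "\<dots> \<le> \<epsilon> k powr \<sigma> * poisson M (\<epsilon> k) (E j)" using E(2)[OF j] by (simp add: bad_def)
      finally show ?thesis using \<epsilon>[of k] by (simp add: field_simps)
    qed
    have kern: "(\<Sum>j\<in>B k. 1 / ((t - E j)\<^sup>2 + (\<epsilon> k)\<^sup>2)) \<le> 4 * C / (\<epsilon> k)\<^sup>2" for t
    proof -
      define i where "i = \<lfloor>t * 2 ^ k\<rfloor>"
      have ti: "t \<in> dyadic_cell k i" by (simp add: in_dyadic_cell i_def)
      have "1 / ((t - E j)\<^sup>2 + (\<epsilon> k)\<^sup>2) \<le> 4 / (\<epsilon> k)\<^sup>2 * (1 / (1 + (of_int (i - j))\<^sup>2))" if j: "j \<in> B k" for j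
      proof -
        define d where "d = real_of_int (i - j)"
        have up: "t - E j \<le> (d + 1) * \<epsilon> k" and lo: "(d - 1) * \<epsilon> k \<le> t - E j"
          using ti E(1)[OF j] unfolding cell d_def by (simp_all add: algebra_simps)
        have key: "(\<epsilon> k)\<^sup>2 * (1 + d\<^sup>2) \<le> 4 * ((t - E j)\<^sup>2 + (\<epsilon> k)\<^sup>2)"
        proof -
          have "\<bar>i - j\<bar> \<le> 1 \<or> \<bar>i - j\<bar> \<ge> 2" by linarith
          then have di: "\<bar>d\<bar> \<le> 1 \<or> \<bar>d\<bar> \<ge> 2"
            unfolding d_def of_int_abs[symmetric] by (metis of_int_1 of_int_le_iff of_int_numeral)
          have "(\<epsilon> k)\<^sup>2 * d\<^sup>2 \<le> 4 * (t - E j)\<^sup>2 + 3 * (\<epsilon> k)\<^sup>2"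
          proof (cases "\<bar>d\<bar> \<le> 1")
            case True
            then have "d\<^sup>2 \<le> 1" by (simp add: abs_square_le_1)
            then have "(\<epsilon> k)\<^sup>2 * d\<^sup>2 \<le> (\<epsilon> k)\<^sup>2 * 1" by (intro mult_left_mono) auto
            moreover have "0 \<le> (t - E j)\<^sup>2" "0 \<le> (\<epsilon> k)\<^sup>2" by auto
            ultimately show ?thesis by linarith
          next
            case False
            have "\<epsilon> k * \<bar>d\<bar> \<le> 2 * \<bar>t - E j\<bar>"
            proof (cases "d \<ge> 2")
              case True
              then have "d * \<epsilon> k \<le> 2 * ((d - 1) * \<epsilon> k)" using \<epsilon>[of k] by (simp add: algebra_simps)
              also have "\<dots> \<le> 2 * \<bar>t - E j\<bar>"
                by (rule mult_left_mono[OF order_trans[OF lo abs_ge_self]]) simp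
              finally have "d * \<epsilon> k \<le> 2 * \<bar>t - E j\<bar>" .
              then show ?thesis using True by (simp add: mult.commute)
            next
              case F2: False
              then have "d \<le> -2" using di False by linarith
              then have "(d + 2) * \<epsilon> k \<le> 0" using \<epsilon>[of k] by (intro mult_nonpos_nonneg) auto
              then have "- d * \<epsilon> k \<le> 2 * (- (d + 1) * \<epsilon> k)" by (simp add: algebra_simps)
              also have "\<dots> \<le> 2 * \<bar>t - E j\<bar>"
              proof (rule mult_left_mono)
                have "- ((d + 1) * \<epsilon> k) \<le> - (t - E j)" using up by simp
                also have "\<dots> \<le> \<bar>t - E j\<bar>" by (rule abs_ge_minus_self)
                finally show "- (d + 1) * \<epsilon> k \<le> \<bar>t - E j\<bar>" by (simp only: mult_minus_left)
              qed simp
              finally have "- d * \<epsilon> k \<le> 2 * \<bar>t - E j\<bar>" .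
              then show ?thesis using \<open>d \<le> -2\<close> by (simp add: mult.commute)
            qed
            then have "(\<epsilon> k * \<bar>d\<bar>)\<^sup>2 \<le> (2 * \<bar>t - E j\<bar>)\<^sup>2" using \<epsilon>[of k] by (intro power_mono) auto
            then show ?thesis by (simp add: power_mult_distrib add_increasing2)
          qed
          then show ?thesis by (simp add: algebra_simps)
        qed
        have "1 + d\<^sup>2 > 0" "(t - E j)\<^sup>2 + (\<epsilon> k)\<^sup>2 > 0" using \<epsilon>[of k] by (auto intro: add_pos_nonneg add_nonneg_pos)
        then show ?thesis using key \<epsilon>[of k] unfolding d_def[symmetric] by (simp add: divide_simps mult.commute)
      qed
      then have "(\<Sum>j\<in>B k. 1 / ((t - E j)\<^sup>2 + (\<epsilon> k)\<^sup>2)) \<le> (\<Sum>j\<in>B k. 4 / (\<epsilon> k)\<^sup>2 * (1 / (1 + (of_int (i - j))\<^sup>2)))"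
        by (intro sum_mono)
      also have "\<dots> = 4 / (\<epsilon> k)\<^sup>2 * (\<Sum>j\<in>(\<lambda>j. i - j) ` B k. 1 / (1 + (of_int j)\<^sup>2))"
        by (subst sum.reindex) (auto simp: inj_on_def sum_distrib_left)
      also have "\<dots> \<le> 4 / (\<epsilon> k)\<^sup>2 * C" using finB by (intro mult_left_mono C) auto
      finally show ?thesis by simp
    qed
    have "measure N (A k) \<le> (\<Sum>j\<in>B k. measure N (dyadic_cell k j))"
      unfolding A_def using finB by (intro measure_UNION_le) auto
    also have "\<dots> \<le> (\<Sum>j\<in>B k. 2 * (\<epsilon> k)\<^sup>2 * (\<epsilon> k powr \<sigma> * poisson M (\<epsilon> k) (E j)))"
      by (intro sum_mono one)
    also have "\<dots> = 2 * (\<epsilon> k)\<^sup>2 * (\<epsilon> k powr \<sigma>) * (\<integral>t. (\<Sum>j\<in>B k. 1 / ((t - E j)\<^sup>2 + (\<epsilon> k)\<^sup>2)) \<partial>M)"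
      using poisson_integrable[OF M \<epsilon>]
      by (simp add: poisson_def sum_distrib_left mult.assoc)
    also have "\<dots> \<le> 2 * (\<epsilon> k)\<^sup>2 * (\<epsilon> k powr \<sigma>) * (\<integral>t. 4 * C / (\<epsilon> k)\<^sup>2 \<partial>M)"
      using poisson_integrable[OF M \<epsilon>] \<epsilon>[of k]
      by (intro mult_left_mono integral_mono kern Bochner_Integration.integrable_sum) auto
    also have "\<dots> = 8 * C * measure M UNIV * (\<epsilon> k powr \<sigma>)" using \<epsilon>[of k] by (simp add: field_simps power2_eq_square)
    finally show ?thesis .
  qed
  have geo: "\<epsilon> k powr \<sigma> = ((1 / 2) powr \<sigma>) ^ k" for k
    by (simp add: \<epsilon>_def powr_powr powr_realpow[symmetric] mult.commute)
  have "(1 / 2 :: real) powr \<sigma> < 1" using \<sigma> powr_less_mono2[of \<sigma> "1/2" 1] by simp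
  then have "summable (\<lambda>k. 8 * C * measure M UNIV * (\<epsilon> k powr \<sigma>))"
    unfolding geo by (intro summable_mult summable_geometric) auto
  then have "summable (\<lambda>k. measure N (A k))"
    by (rule summable_comparison_test') (use small in auto)
  then have "AE x in N. \<forall>\<^sub>F k in sequentially. x \<in> space N - A k"
    using A by (intro borel_cantelli_AE1) (auto simp: less_top[symmetric])
  then show ?thesis using bdd
  proof eventually_elim
    case (elim E)
    from elim(1) show ?case
    proof eventually_elim
      case (elim k)
      have "\<lfloor>E * 2 ^ k\<rfloor> \<in> F k"
      proof -
        have "- R * 2 ^ k \<le> E * 2 ^ k" "E * 2 ^ k \<le> R * 2 ^ k"
          using \<open>\<bar>E\<bar> < R\<close> by (intro mult_right_mono; simp)+
        then show ?thesis by (simp add: F_def floor_mono)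
      qed
      moreover have "E \<in> dyadic_cell k \<lfloor>E * 2 ^ k\<rfloor>" by (simp add: in_dyadic_cell)
      ultimately have "\<not> bad k E" using elim unfolding A_def B_def by blast
      then show ?case by (simp add: bad_def \<epsilon>_def)
    qed
  qed
qed

section \<open>Lower bound for the Poisson kernel of the spectral measure\<close>

context jacobi_family
begin

lemma inner_sum_\<delta>:
  assumes "finite A" "finite B"
  shows "(\<Sum>n\<in>A. f n *\<^sub>R \<delta> n) \<bullet> (\<Sum>n\<in>B. g n *\<^sub>R \<delta> n) = (\<Sum>n\<in>A \<inter> B. f n * g n)"
proof -
  have "(\<Sum>n\<in>A. f n *\<^sub>R \<delta> n) \<bullet> (\<Sum>n\<in>B. g n *\<^sub>R \<delta> n) = (\<Sum>i\<in>A. \<Sum>j\<in>B. f i * (g j * (if i = j then 1 else 0)))"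
    unfolding inner_sum_left inner_sum_right by (subst sum.swap) (simp add: inner_\<delta> mult_ac)
  also have "\<dots> = (\<Sum>i\<in>A. if i \<in> B then f i * g i else 0)"
    using assms by (intro sum.cong refl) (simp add: if_distrib[of "\<lambda>x. _ * x"] cong: if_cong)
  finally show ?thesis using assms by (simp add: sum.inter_restrict)
qed

lemma H_finite_combination:
  assumes f: "\<And>n. \<bar>n\<bar> > L \<Longrightarrow> f n = 0" and L: "L \<ge> 0"
  shows "H (\<Sum>n\<in>{- L..L}. f n *\<^sub>R \<delta> n) = (\<Sum>n\<in>{- L - 1..L + 1}. (f (n + 1) + f (n - 1) + v n * f n) *\<^sub>R \<delta> n)"
proof -
  have "H (\<Sum>n\<in>{- L..L}. f n *\<^sub>R \<delta> n) = (\<Sum>n\<in>{- L..L}. f n *\<^sub>R H (\<delta> n))"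
    by (simp add: linear_sum[OF linear_H] linear_scale[OF linear_H])
  also have "\<dots> = (\<Sum>n\<in>{- L..L}. f n *\<^sub>R \<delta> (n + 1)) + (\<Sum>n\<in>{- L..L}. f n *\<^sub>R \<delta> (n - 1))
      + (\<Sum>n\<in>{- L..L}. (v n * f n) *\<^sub>R \<delta> n)"
    by (simp add: H_\<delta> scaleR_add_right sum.distrib mult.commute)
  also have "(\<Sum>n\<in>{- L..L}. f n *\<^sub>R \<delta> (n + 1)) = (\<Sum>n\<in>{- L - 1..L + 1}. f (n - 1) *\<^sub>R \<delta> n)"
  proof -
    have "(\<Sum>n\<in>{- L..L}. f n *\<^sub>R \<delta> (n + 1)) = (\<Sum>n\<in>(\<lambda>n. n + 1) ` {- L..L}. f (n - 1) *\<^sub>R \<delta> n)"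
      by (subst sum.reindex) (auto simp: inj_on_def)
    also have "\<dots> = (\<Sum>n\<in>{- L - 1..L + 1}. f (n - 1) *\<^sub>R \<delta> n)"
    proof (rule sum.mono_neutral_left)
      show "\<forall>n\<in>{- L - 1..L + 1} - (\<lambda>n. n + 1) ` {- L..L}. f (n - 1) *\<^sub>R \<delta> n = 0"
      proof
        fix n assume n: "n \<in> {- L - 1..L + 1} - (\<lambda>n. n + 1) ` {- L..L}"
        have "n - 1 \<notin> {- L..L}"
        proof
          assume "n - 1 \<in> {- L..L}"
          then have "(n - 1) + 1 \<in> (\<lambda>n. n + 1) ` {- L..L}" by (rule imageI)
          then show False using n by simp
        qed
        then have "L < \<bar>n - 1\<bar>" by auto
        then show "f (n - 1) *\<^sub>R \<delta> n = 0" by (simp add: f)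
      qed
    qed auto
    finally show ?thesis .
  qed
  also have "(\<Sum>n\<in>{- L..L}. f n *\<^sub>R \<delta> (n - 1)) = (\<Sum>n\<in>{- L - 1..L + 1}. f (n + 1) *\<^sub>R \<delta> n)"
  proof -
    have "(\<Sum>n\<in>{- L..L}. f n *\<^sub>R \<delta> (n - 1)) = (\<Sum>n\<in>(\<lambda>n. n - 1) ` {- L..L}. f (n + 1) *\<^sub>R \<delta> n)"
      by (subst sum.reindex) (auto simp: inj_on_def)
    also have "\<dots> = (\<Sum>n\<in>{- L - 1..L + 1}. f (n + 1) *\<^sub>R \<delta> n)"
    proof (rule sum.mono_neutral_left)
      show "\<forall>n\<in>{- L - 1..L + 1} - (\<lambda>n. n - 1) ` {- L..L}. f (n + 1) *\<^sub>R \<delta> n = 0"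
      proof
        fix n assume n: "n \<in> {- L - 1..L + 1} - (\<lambda>n. n - 1) ` {- L..L}"
        have "n + 1 \<notin> {- L..L}"
        proof
          assume "n + 1 \<in> {- L..L}"
          then have "(n + 1) - 1 \<in> (\<lambda>n. n - 1) ` {- L..L}" by (rule imageI)
          then show False using n by simp
        qed
        then have "L < \<bar>n + 1\<bar>" by auto
        then show "f (n + 1) *\<^sub>R \<delta> n = 0" by (simp add: f)
      qed
    qed auto
    finally show ?thesis .
  qed
  also have "(\<Sum>n\<in>{- L..L}. (v n * f n) *\<^sub>R \<delta> n) = (\<Sum>n\<in>{- L - 1..L + 1}. (v n * f n) *\<^sub>R \<delta> n)"
    by (rule sum.mono_neutral_left) (auto simp: f)
  finally show ?thesis by (simp add: sum.distrib scaleR_add_left algebra_simps)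
qed

lemma poisson_diag_le:
  assumes "j = 0 \<or> j = 1" and \<epsilon>: "\<epsilon> > 0"
  shows "poisson (diag (\<delta> j)) \<epsilon> E \<le> poisson \<mu> \<epsilon> E"
proof -
  let ?g = "\<lambda>t. 1 / ((t - E)\<^sup>2 + \<epsilon>\<^sup>2)"
  have int: "integrable \<mu> ?g" "integrable (diag (\<delta> j)) ?g"
    using finite_measure_\<mu> finite_measure_diag \<epsilon> by (auto intro!: poisson_integrable)
  have "emeasure (diag (\<delta> j)) B \<le> emeasure \<mu> B" if "B \<in> sets borel" for B
    using assms(1) that m_nonneg[of 0 B] m_nonneg[of 1 B]
    by (auto simp: emeasure_\<mu> emeasure_diag m_def[symmetric] simp del: ennreal_plus intro!: ennreal_leI)
  then have "diag (\<delta> j) \<le> \<mu>" by (simp add: le_measure)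
  then have "(\<integral>\<^sup>+t. ennreal (?g t) \<partial>diag (\<delta> j)) \<le> (\<integral>\<^sup>+t. ennreal (?g t) \<partial>\<mu>)"
    by (intro nn_integral_mono_measure) simp_all
  then have "ennreal (\<integral>t. ?g t \<partial>diag (\<delta> j)) \<le> ennreal (\<integral>t. ?g t \<partial>\<mu>)"
    using int by (simp add: nn_integral_eq_integral)
  then show ?thesis unfolding poisson_def by (subst (asm) ennreal_le_iff) auto
qed

lemma poisson_lower_bound:
  assumes f: "\<And>n. \<bar>n\<bar> > L \<Longrightarrow> f n = 0" and L: "L \<ge> 1" and \<epsilon>: "\<epsilon> > 0" and j: "j = 0 \<or> j = 1"
  shows "(f j)\<^sup>2 \<le> 3 * poisson \<mu> \<epsilon> E *
    ((\<Sum>n\<in>{- L - 1..L + 1}. (f (n + 1) + f (n - 1) + v n * f n - E * f n)\<^sup>2) + \<epsilon>\<^sup>2 * (\<Sum>n\<in>{- L..L}. (f n)\<^sup>2))"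
proof -
  define x where "x = (\<Sum>n\<in>{- L..L}. f n *\<^sub>R \<delta> n)"
  have x': "x = (\<Sum>n\<in>{- L - 1..L + 1}. f n *\<^sub>R \<delta> n)"
    unfolding x_def by (rule sum.mono_neutral_left) (auto simp: f)
  have "H x - E *\<^sub>R x = (\<Sum>n\<in>{- L - 1..L + 1}. (f (n + 1) + f (n - 1) + v n * f n) *\<^sub>R \<delta> n)
      - (\<Sum>n\<in>{- L - 1..L + 1}. (E * f n) *\<^sub>R \<delta> n)"
  proof -
    have "H x = (\<Sum>n\<in>{- L - 1..L + 1}. (f (n + 1) + f (n - 1) + v n * f n) *\<^sub>R \<delta> n)"
      unfolding x_def by (rule H_finite_combination[OF f]) (use L in auto)
    moreover have "E *\<^sub>R x = (\<Sum>n\<in>{- L - 1..L + 1}. (E * f n) *\<^sub>R \<delta> n)"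
      unfolding x' by (simp add: scaleR_sum_right)
    ultimately show ?thesis by simp
  qed
  also have "\<dots> = (\<Sum>n\<in>{- L - 1..L + 1}. (f (n + 1) + f (n - 1) + v n * f n - E * f n) *\<^sub>R \<delta> n)"
    by (simp add: sum_subtractf[symmetric] scaleR_diff_left)
  finally have Hx: "(norm (H x - E *\<^sub>R x))\<^sup>2 = (\<Sum>n\<in>{- L - 1..L + 1}. (f (n + 1) + f (n - 1) + v n * f n - E * f n)\<^sup>2)"
    by (simp add: power2_norm_eq_inner inner_sum_\<delta>) (simp add: power2_eq_square)
  have nx: "(norm x)\<^sup>2 = (\<Sum>n\<in>{- L..L}. (f n)\<^sup>2)"
    unfolding x_def power2_norm_eq_inner by (simp add: inner_sum_\<delta> power2_eq_square)
  have "\<delta> j \<bullet> x = f j"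
  proof -
    have "\<delta> j \<bullet> x = (\<Sum>n\<in>{j}. 1 *\<^sub>R \<delta> n) \<bullet> x" by simp
    also have "\<dots> = (\<Sum>n\<in>{j} \<inter> {- L..L}. 1 * f n)" unfolding x_def by (intro inner_sum_\<delta>) auto
    also have "{j} \<inter> {- L..L} = {j}" using j L by auto
    finally show ?thesis by simp
  qed
  then have "(f j)\<^sup>2 \<le> 3 * poisson (diag (\<delta> j)) \<epsilon> E * ((norm (H x - E *\<^sub>R x))\<^sup>2 + \<epsilon>\<^sup>2 * (norm x)\<^sup>2)"
    unfolding poisson_def using resolvent_estimate[OF \<epsilon>, of "\<delta> j" x E] by simp
  also have "\<dots> \<le> 3 * poisson \<mu> \<epsilon> E * ((norm (H x - E *\<^sub>R x))\<^sup>2 + \<epsilon>\<^sup>2 * (norm x)\<^sup>2)"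
    using poisson_diag_le[OF j \<epsilon>] by (intro mult_right_mono mult_left_mono) auto
  finally show ?thesis by (simp only: Hx nx)
qed

text \<open>Averaging the truncations at the small sites of the \<open>N\<close> blocks on either side of the origin leaves
  an error of relative size \<open>\<eta> / N \<le> \<epsilon>\<close>, the same as that of the term \<open>i\<epsilon> f\<close>, so
  the kernel is at least of order \<open>\<epsilon>\<^sup>-\<^sup>2\<close> over the square sum of the solution over the blocks.\<close>

lemma poisson_lower_bound_blocks:
  assumes sol: "solution v E u" and j: "j = 0 \<or> j = 1" and uj: "1 / 2 \<le> \<bar>u j\<bar>"
    and \<epsilon>: "\<epsilon> > 0" and N: "N \<ge> 1" "\<eta> \<le> N * \<epsilon>" and \<eta>: "\<eta> \<ge> 0" and b: "b > 0"
    and small: "\<And>s. \<exists>n. s \<le> n \<and> n < s + int b \<and>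
      pair_sq u n \<le> \<eta>\<^sup>2 * (\<Sum>i\<in>{s..<s + int b}. pair_sq u i)"
  shows "1 \<le> 108 * \<epsilon>\<^sup>2 * poisson \<mu> \<epsilon> E * (\<Sum>i<N * b + 2. (u (int i))\<^sup>2 + (u (- int i))\<^sup>2)"
proof -
  have "\<exists>site. \<forall>s. s \<le> site s \<and> site s < s + int b \<and>
      pair_sq u (site s) \<le> \<eta>\<^sup>2 * (\<Sum>i\<in>{s..<s + int b}. pair_sq u i)"
    by (intro choice allI small)
  then obtain site where site: "\<And>s. s \<le> site s \<and> site s < s + int b"
    "\<And>s. pair_sq u (site s) \<le> \<eta>\<^sup>2 * (\<Sum>i\<in>{s..<s + int b}. pair_sq u i)"
    by blast
  define L where "L = int (N * b)"
  define r where "r = (\<lambda>i::nat. site (1 + int i * int b))"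
  define l where "l = (\<lambda>i::nat. site (- (int i + 1) * int b))"
  define S where "S = (\<Sum>i<N * b + 2. (u (int i))\<^sup>2 + (u (- int i))\<^sup>2)"
  have "0 < N * b" using N b by simp
  then have L1: "L \<ge> 1" unfolding L_def by linarith
  have blk: "(int i + 1) * int b \<le> L" if "i < N" for i
  proof -
    have "(int i + 1) * int b \<le> int N * int b" using that by (intro mult_right_mono) auto
    then show ?thesis by (simp add: L_def)
  qed
  have rb: "1 + int i * int b \<le> r i" "r i < 1 + (int i + 1) * int b" for i
    using site(1)[of "1 + int i * int b"] by (simp_all add: r_def algebra_simps)
  have lb: "- (int i + 1) * int b \<le> l i" "l i < - (int i * int b)" for i
    using site(1)[of "- (int i + 1) * int b"] by (simp_all add: l_def algebra_simps)
  have inj: "i = k" if "i * int b \<le> x" "x < (i + 1) * int b" "k * int b \<le> x" "x < (k + 1) * int b" for i k x :: int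
  proof -
    have "i * int b < (k + 1) * int b" "k * int b < (i + 1) * int b" using that by linarith+
    then have "i < k + 1" "k < i + 1" using b by (simp_all only: mult_less_cancel_right_pos of_nat_0_less_iff)
    then show ?thesis by simp
  qed
  have r: "0 < r i \<and> r i \<le> L" if "i < N" for i
  proof -
    have "0 \<le> int i * int b" by simp
    then show ?thesis using rb[of i] blk[OF that] by linarith
  qed
  have l: "- L \<le> l i \<and> l i < 0" if "i < N" for i
  proof -
    have "0 \<le> int i * int b" "- (int i + 1) * int b = - ((int i + 1) * int b)"
      by (simp_all add: algebra_simps)
    then show ?thesis using lb[of i] blk[OF that] by linarith
  qed
  have r_inj: "inj_on r {..<N}"
  proof (rule inj_onI)
    fix i k assume "r i = r k"
    then show "i = k" using inj[of "int i" "r i - 1" "int k"] rb[of i] rb[of k] by simp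
  qed
  have l_inj: "inj_on l {..<N}"
  proof (rule inj_onI)
    fix i k assume "l i = l k"
    then have "- int i - 1 = - int k - 1"
      using lb[of i] lb[of k] by (intro inj[of "- int i - 1" "l i"]) (simp_all add: algebra_simps)
    then show "i = k" by simp
  qed
  obtain f where f: "f 0 = u 0" "f 1 = u 1" "\<And>n. \<bar>f n\<bar> \<le> \<bar>u n\<bar>" "\<And>n. \<bar>n\<bar> > L \<Longrightarrow> f n = 0"
    "(\<Sum>n\<in>{- L - 1..L + 1}. (f (n + 1) + f (n - 1) + v n * f n - E * f n)\<^sup>2)
       \<le> 2 / (real N)\<^sup>2 * ((\<Sum>i<N. pair_sq u (l i)) + (\<Sum>i<N. pair_sq u (r i)))"
    using truncated_solution[OF sol N(1) l l_inj r r_inj] by blast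
  have uS: "(\<Sum>n\<in>A. (u n)\<^sup>2) \<le> S" if "A \<subseteq> {- L - 1..L + 1}" for A
  proof -
    have "(\<Sum>n\<in>A. (u n)\<^sup>2) \<le> (\<Sum>n\<in>int ` {..<N * b + 2} \<union> (\<lambda>i. - int i) ` {..<N * b + 2}. (u n)\<^sup>2)"
    proof (rule sum_mono2)
      show "A \<subseteq> int ` {..<N * b + 2} \<union> (\<lambda>i. - int i) ` {..<N * b + 2}"
      proof
        fix n assume "n \<in> A"
        then have n: "- L - 1 \<le> n" "n \<le> L + 1" using that by auto
        show "n \<in> int ` {..<N * b + 2} \<union> (\<lambda>i. - int i) ` {..<N * b + 2}"
        proof (cases "n \<ge> 0")
          case True
          have "n < int (N * b + 2)" using n by (simp add: L_def)
          then have "n = int (nat n)" "nat n < N * b + 2" using True by (simp_all only: nat_less_iff int_nat_eq if_True)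
          then show ?thesis by blast
        next
          case False
          then have "0 \<le> - n" by simp
          moreover have "- n < int (N * b + 2)" using n by (simp add: L_def)
          ultimately have "n = - int (nat (- n))" "nat (- n) < N * b + 2"
            by (simp_all only: nat_less_iff int_nat_eq if_True minus_minus)
          then show ?thesis by blast
        qed
      qed
    qed auto
    also have "\<dots> \<le> (\<Sum>n\<in>int ` {..<N * b + 2}. (u n)\<^sup>2) + (\<Sum>n\<in>(\<lambda>i. - int i) ` {..<N * b + 2}. (u n)\<^sup>2)"
      by (subst sum_Un) (auto intro!: sum_nonneg)
    also have "\<dots> = S"
      by (simp add: S_def sum.reindex inj_on_def sum.distrib)
    finally show ?thesis .
  qed
  have pS: "(\<Sum>n\<in>A. pair_sq u n) \<le> 2 * S" if "A \<subseteq> {- L..L}" for A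
  proof -
    have "(\<Sum>n\<in>A. (u (n + 1))\<^sup>2) = (\<Sum>n\<in>(\<lambda>n. n + 1) ` A. (u n)\<^sup>2)" by (subst sum.reindex) auto
    also have "\<dots> \<le> S" using that by (intro uS) auto
    moreover have "(\<Sum>n\<in>A. (u n)\<^sup>2) \<le> S" using that by (intro uS) auto
    ultimately show ?thesis by (simp add: sum.distrib)
  qed
  have blocks: "(\<Sum>i<N. pair_sq u (site (c i))) \<le> \<eta>\<^sup>2 * (2 * S)"
    if c: "\<And>i. i < N \<Longrightarrow> {c i..<c i + int b} \<subseteq> {- L..L}"
      and dis: "\<And>i k x. i < N \<Longrightarrow> k < N \<Longrightarrow> x \<in> {c i..<c i + int b} \<Longrightarrow> x \<in> {c k..<c k + int b} \<Longrightarrow> i = k"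
    for c :: "nat \<Rightarrow> int"
  proof -
    have "(\<Sum>i<N. pair_sq u (site (c i))) \<le> (\<Sum>i<N. \<eta>\<^sup>2 * (\<Sum>n\<in>{c i..<c i + int b}. pair_sq u n))"
      by (intro sum_mono site(2))
    also have "\<dots> = \<eta>\<^sup>2 * (\<Sum>i<N. \<Sum>n\<in>{c i..<c i + int b}. pair_sq u n)" by (simp add: sum_distrib_left)
    also have "(\<Sum>i<N. \<Sum>n\<in>{c i..<c i + int b}. pair_sq u n) = (\<Sum>n\<in>(\<Union>i<N. {c i..<c i + int b}). pair_sq u n)"
    proof (rule sum.UNION_disjoint[symmetric])
      show "\<forall>i\<in>{..<N}. \<forall>k\<in>{..<N}. i \<noteq> k \<longrightarrow> {c i..<c i + int b} \<inter> {c k..<c k + int b} = {}"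
      proof (intro ballI impI equals0I)
        fix i k x
        assume "i \<in> {..<N}" "k \<in> {..<N}" "i \<noteq> k" "x \<in> {c i..<c i + int b} \<inter> {c k..<c k + int b}"
        then show False using dis[of i k x] by auto
      qed
    qed auto
    also have "\<eta>\<^sup>2 * \<dots> \<le> \<eta>\<^sup>2 * (2 * S)" using c by (intro mult_left_mono pS) auto
    finally show ?thesis .
  qed
  have "(\<Sum>i<N. pair_sq u (r i)) \<le> \<eta>\<^sup>2 * (2 * S)"
    unfolding r_def
  proof (rule blocks)
    show "{1 + int i * int b..<1 + int i * int b + int b} \<subseteq> {- L..L}" if "i < N" for i
    proof
      fix x assume "x \<in> {1 + int i * int b..<1 + int i * int b + int b}"
      then have "1 + int i * int b \<le> x" "x < 1 + int i * int b + int b" by simp_all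
      moreover have "0 \<le> int i * int b" by simp
      moreover have "(int i + 1) * int b = int i * int b + int b" by (simp add: algebra_simps)
      ultimately show "x \<in> {- L..L}" using blk[OF that] L1 unfolding atLeastAtMost_iff by linarith
    qed
    show "i = k" if "x \<in> {1 + int i * int b..<1 + int i * int b + int b}"
        "x \<in> {1 + int k * int b..<1 + int k * int b + int b}" for i k x
      using inj[of "int i" "x - 1" "int k"] that by (simp add: algebra_simps)
  qed
  moreover have "(\<Sum>i<N. pair_sq u (l i)) \<le> \<eta>\<^sup>2 * (2 * S)"
    unfolding l_def
  proof (rule blocks)
    show "{- (int i + 1) * int b..<- (int i + 1) * int b + int b} \<subseteq> {- L..L}" if "i < N" for i
    proof
      fix x assume "x \<in> {- (int i + 1) * int b..<- (int i + 1) * int b + int b}"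
      then have "- (int i + 1) * int b \<le> x" "x < - (int i + 1) * int b + int b" by simp_all
      moreover have "0 \<le> int i * int b" by simp
      moreover have "- (int i + 1) * int b = - ((int i + 1) * int b)"
        "(int i + 1) * int b = int i * int b + int b" by (simp_all add: algebra_simps)
      ultimately show "x \<in> {- L..L}" using blk[OF that] L1 unfolding atLeastAtMost_iff by linarith
    qed
    show "i = k" if "x \<in> {- (int i + 1) * int b..<- (int i + 1) * int b + int b}"
        "x \<in> {- (int k + 1) * int b..<- (int k + 1) * int b + int b}" for i k x
      using inj[of "- int i - 1" x "- int k - 1"] that by (simp add: algebra_simps)
  qed
  ultimately have "(\<Sum>i<N. pair_sq u (l i)) + (\<Sum>i<N. pair_sq u (r i)) \<le> 4 * \<eta>\<^sup>2 * S" by simp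
  from mult_left_mono[OF this, of "2 / (real N)\<^sup>2"]
  have "(\<Sum>n\<in>{- L - 1..L + 1}. (f (n + 1) + f (n - 1) + v n * f n - E * f n)\<^sup>2) \<le> 8 * (\<eta> / N)\<^sup>2 * S"
    using f(5) by (simp add: power_divide)
  also have "\<dots> \<le> 8 * \<epsilon>\<^sup>2 * S"
  proof -
    have "\<eta> / N \<le> \<epsilon>" using N by (simp add: divide_le_eq mult.commute)
    then have "(\<eta> / N)\<^sup>2 \<le> \<epsilon>\<^sup>2" using \<eta> by (intro power_mono) auto
    moreover have "S \<ge> 0" unfolding S_def by (intro sum_nonneg) auto
    ultimately show ?thesis by (intro mult_right_mono) auto
  qed
  finally have g: "(\<Sum>n\<in>{- L - 1..L + 1}. (f (n + 1) + f (n - 1) + v n * f n - E * f n)\<^sup>2) \<le> 8 * \<epsilon>\<^sup>2 * S" .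
  have fS: "(\<Sum>n\<in>{- L..L}. (f n)\<^sup>2) \<le> S"
  proof -
    have "(\<Sum>n\<in>{- L..L}. (f n)\<^sup>2) \<le> (\<Sum>n\<in>{- L..L}. (u n)\<^sup>2)"
      using f(3) by (intro sum_mono) (simp add: abs_le_square_iff[symmetric])
    also have "\<dots> \<le> S" by (rule uS) auto
    finally show ?thesis .
  qed
  have p0: "0 \<le> poisson \<mu> \<epsilon> E" unfolding poisson_def by (intro integral_nonneg_AE) simp
  have "(1 / 2)\<^sup>2 \<le> (f j)\<^sup>2"
    using uj j f(1,2) power_mono[of "1 / 2" "\<bar>u j\<bar>" 2] by auto
  also have "\<dots> \<le> 3 * poisson \<mu> \<epsilon> E *
    ((\<Sum>n\<in>{- L - 1..L + 1}. (f (n + 1) + f (n - 1) + v n * f n - E * f n)\<^sup>2) + \<epsilon>\<^sup>2 * (\<Sum>n\<in>{- L..L}. (f n)\<^sup>2))"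
    by (rule poisson_lower_bound[OF f(4) L1 \<epsilon> j])
  also have "\<dots> \<le> 3 * poisson \<mu> \<epsilon> E * (8 * \<epsilon>\<^sup>2 * S + \<epsilon>\<^sup>2 * S)"
    using p0 by (intro mult_left_mono add_mono g fS) auto
  finally have "1 \<le> 108 * \<epsilon>\<^sup>2 * poisson \<mu> \<epsilon> E * S" by (simp add: power2_eq_square algebra_simps)
  then show ?thesis by (simp add: S_def)
qed

end

section \<open>The Hilbert space of square-summable sequences\<close>

lemma l2_add:
  assumes "u \<in> l2" "v \<in> l2"
  shows "(\<lambda>n. u n + v n) \<in> l2"
proof -
  have "(\<lambda>n. 2 * (cmod (u n))\<^sup>2 + 2 * (cmod (v n))\<^sup>2) summable_on UNIV"
    using assms by (intro summable_on_add summable_on_cmult_right) (auto simp: l2_def)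
  moreover have "(cmod (u n + v n))\<^sup>2 \<le> 2 * (cmod (u n))\<^sup>2 + 2 * (cmod (v n))\<^sup>2" for n
  proof -
    have "(cmod (u n + v n))\<^sup>2 \<le> (cmod (u n) + cmod (v n))\<^sup>2"
      by (intro power_mono norm_triangle_ineq) simp
    also have "\<dots> \<le> 2 * (cmod (u n))\<^sup>2 + 2 * (cmod (v n))\<^sup>2"
      using sum_squares_bound[of "cmod (u n)" "cmod (v n)"] by (simp add: power2_sum)
    finally show ?thesis .
  qed
  ultimately show ?thesis unfolding l2_def mem_Collect_eq
    by (intro summable_on_comparison_test[where g = "\<lambda>n. (cmod (u n + v n))\<^sup>2"]) auto
qed

lemma l2_mult_bounded:
  assumes "u \<in> l2" "\<And>n. cmod (c n) \<le> b"
  shows "(\<lambda>n. c n * u n) \<in> l2"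
proof -
  have "(\<lambda>n. b\<^sup>2 * (cmod (u n))\<^sup>2) summable_on UNIV"
    using assms by (intro summable_on_cmult_right) (auto simp: l2_def)
  moreover have "(cmod (c n * u n))\<^sup>2 \<le> b\<^sup>2 * (cmod (u n))\<^sup>2" for n
    unfolding norm_mult power_mult_distrib using assms(2) by (intro mult_right_mono power_mono) auto
  ultimately show ?thesis unfolding l2_def mem_Collect_eq
    by (intro summable_on_comparison_test[where g = "\<lambda>n. (cmod (c n * u n))\<^sup>2"]) auto
qed

lemma l2_scale: "u \<in> l2 \<Longrightarrow> (\<lambda>n. c * u n) \<in> l2"
  by (rule l2_mult_bounded[where b = "cmod c"]) auto

lemma l2_zero: "(\<lambda>n. 0) \<in> l2"
  by (simp add: l2_def)

lemma bij_shift: "bij_betw (\<lambda>n::int. n + k) UNIV UNIV"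
  by (rule bij_betw_byWitness[where f' = "\<lambda>n. n - k"]) auto

lemma l2_shift: "u \<in> l2 \<Longrightarrow> (\<lambda>n. u (n + k)) \<in> l2"
  using summable_on_reindex_bij_betw[OF bij_shift[of k], of "\<lambda>n. (cmod (u n))\<^sup>2"] by (simp add: l2_def)

lemma delta_l2: "delta j \<in> l2"
proof -
  have "(\<lambda>n. (cmod (delta j n))\<^sup>2) summable_on UNIV \<longleftrightarrow> (\<lambda>n. (cmod (delta j n))\<^sup>2) summable_on {j}"
    by (rule summable_on_cong_neutral) (auto simp: delta_def)
  then show ?thesis by (simp add: l2_def)
qed

lemma l2_inner_summable:
  assumes "u \<in> l2" "v \<in> l2"
  shows "(\<lambda>n. cnj (u n) * v n) summable_on UNIV"
proof (rule abs_summable_summable)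
  have "(\<lambda>n. (cmod (u n))\<^sup>2 + (cmod (v n))\<^sup>2) summable_on UNIV"
    using assms by (intro summable_on_add) (auto simp: l2_def)
  moreover have "norm (cnj (u n) * v n) \<le> (cmod (u n))\<^sup>2 + (cmod (v n))\<^sup>2" for n
  proof -
    have "2 * (cmod (u n) * cmod (v n)) \<le> (cmod (u n))\<^sup>2 + (cmod (v n))\<^sup>2"
      using sum_squares_bound[of "cmod (u n)" "cmod (v n)"] by simp
    moreover have "0 \<le> cmod (u n) * cmod (v n)" by simp
    ultimately show ?thesis unfolding norm_mult complex_mod_cnj by linarith
  qed
  ultimately show "(\<lambda>n. norm (cnj (u n) * v n)) summable_on UNIV"
    by (intro summable_on_comparison_test[where g = "\<lambda>n. norm (cnj (u n) * v n)"]) auto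
qed

definition l2_re_inner :: "(int \<Rightarrow> complex) \<Rightarrow> (int \<Rightarrow> complex) \<Rightarrow> real" where
  "l2_re_inner u v = (\<Sum>\<^sub>\<infinity>n. Re (cnj (u n) * v n))"

lemma l2_re_inner_summable:
  "u \<in> l2 \<Longrightarrow> v \<in> l2 \<Longrightarrow> (\<lambda>n. Re (cnj (u n) * v n)) summable_on UNIV"
  by (intro summable_on_Re l2_inner_summable)

lemma Re_l2_inner: "u \<in> l2 \<Longrightarrow> v \<in> l2 \<Longrightarrow> Re (l2_inner u v) = l2_re_inner u v"
  unfolding l2_re_inner_def l2_inner_def by (simp only: infsum_Re[OF l2_inner_summable])

lemma l2_re_inner_commute: "l2_re_inner u v = l2_re_inner v u"
  unfolding l2_re_inner_def by (simp add: mult.commute)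

lemma l2_re_inner_add:
  assumes "u \<in> l2" "v \<in> l2" "w \<in> l2"
  shows "l2_re_inner (\<lambda>n. u n + v n) w = l2_re_inner u w + l2_re_inner v w"
proof -
  have "Re (cnj (u n + v n) * w n) = Re (cnj (u n) * w n) + Re (cnj (v n) * w n)" for n
    by (simp add: algebra_simps)
  then show ?thesis
    unfolding l2_re_inner_def
    using infsum_add[OF l2_re_inner_summable[OF assms(1,3)] l2_re_inner_summable[OF assms(2,3)]] by simp
qed

lemma l2_re_inner_scale: "l2_re_inner (\<lambda>n. of_real r * u n) w = r * l2_re_inner u w"
proof -
  have "Re (cnj (of_real r * u n) * w n) = r * Re (cnj (u n) * w n)" for n
    by (simp add: algebra_simps)
  then show ?thesis unfolding l2_re_inner_def by (simp only: infsum_cmult_right')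
qed

lemma Re_cnj_mult_self: "Re (cnj z * z) = (cmod z)\<^sup>2"
  by (metis Re_complex_of_real complex_norm_square mult.commute)

lemma l2_re_inner_self: "l2_re_inner u u = (\<Sum>\<^sub>\<infinity>n. (cmod (u n))\<^sup>2)"
  unfolding l2_re_inner_def Re_cnj_mult_self ..

lemma l2_re_inner_shift: "l2_re_inner (\<lambda>n. u (n + k)) v = l2_re_inner u (\<lambda>n. v (n - k))"
  unfolding l2_re_inner_def
  using infsum_reindex_bij_betw[OF bij_shift[of k], of "\<lambda>n. Re (cnj (u n) * v (n - k))"] by simp

text \<open>The inner product of the instance is the real part of \<^const>\<open>l2_inner\<close>, so that the estimates of
  \<^locale>\<open>spectral_family\<close> apply.\<close>

typedef ell2 = l2
  using l2_zero by blast

instantiation ell2 :: real_inner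
begin

definition "0 = Abs_ell2 (\<lambda>n. 0)"
definition "x + y = Abs_ell2 (\<lambda>n. Rep_ell2 x n + Rep_ell2 y n)"
definition "- x = Abs_ell2 (\<lambda>n. - Rep_ell2 x n)" for x :: ell2
definition "x - y = Abs_ell2 (\<lambda>n. Rep_ell2 x n - Rep_ell2 y n)" for x y :: ell2
definition "r *\<^sub>R x = Abs_ell2 (\<lambda>n. of_real r * Rep_ell2 x n)"
definition "inner x y = l2_re_inner (Rep_ell2 x) (Rep_ell2 y)"
definition "norm x = sqrt (inner x x)" for x :: ell2
definition "sgn x = inverse (norm x) *\<^sub>R x" for x :: ell2
definition "dist x y = norm (x - y)" for x y :: ell2
definition "(uniformity :: (ell2 \<times> ell2) filter) = (INF e\<in>{0<..}. principal {(x, y). dist x y < e})"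
definition "open U = (\<forall>x\<in>U. \<forall>\<^sub>F (x', y) in uniformity. x' = x \<longrightarrow> y \<in> U)" for U :: "ell2 set"

lemma Rep_ell2_l2: "Rep_ell2 x \<in> l2"
  using Rep_ell2 .

lemma Rep_ell2_zero: "Rep_ell2 0 = (\<lambda>n. 0)"
  by (simp add: zero_ell2_def Abs_ell2_inverse l2_zero)

lemma Rep_ell2_add: "Rep_ell2 (x + y) = (\<lambda>n. Rep_ell2 x n + Rep_ell2 y n)"
  by (simp add: plus_ell2_def Abs_ell2_inverse l2_add Rep_ell2_l2)

lemma Rep_ell2_scaleR: "Rep_ell2 (r *\<^sub>R x) = (\<lambda>n. of_real r * Rep_ell2 x n)"
  by (simp add: scaleR_ell2_def Abs_ell2_inverse l2_scale Rep_ell2_l2)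

lemma Rep_ell2_uminus: "Rep_ell2 (- x) = (\<lambda>n. - Rep_ell2 x n)"
  using l2_scale[OF Rep_ell2_l2[of x], of "-1"] by (simp add: uminus_ell2_def Abs_ell2_inverse)

lemma Rep_ell2_diff: "Rep_ell2 (x - y) = (\<lambda>n. Rep_ell2 x n - Rep_ell2 y n)"
  using l2_add[OF Rep_ell2_l2[of x] l2_scale[OF Rep_ell2_l2[of y], of "-1"]]
  by (simp add: minus_ell2_def Abs_ell2_inverse)

lemmas Rep_ell2_simps = Rep_ell2_zero Rep_ell2_add Rep_ell2_scaleR Rep_ell2_uminus Rep_ell2_diff

lemma ell2_eqI: "(\<And>n. Rep_ell2 x n = Rep_ell2 y n) \<Longrightarrow> x = y"
  by (simp add: Rep_ell2_inject[symmetric] fun_eq_iff)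

instance
proof
  fix x y z :: ell2 and r s :: real
  show "x + y + z = x + (y + z)" by (rule ell2_eqI) (simp add: Rep_ell2_simps)
  show "x + y = y + x" by (rule ell2_eqI) (simp add: Rep_ell2_simps)
  show "0 + x = x" by (rule ell2_eqI) (simp add: Rep_ell2_simps)
  show "- x + x = 0" by (rule ell2_eqI) (simp add: Rep_ell2_simps)
  show "x - y = x + - y" by (rule ell2_eqI) (simp add: Rep_ell2_simps)
  show "r *\<^sub>R (x + y) = r *\<^sub>R x + r *\<^sub>R y" by (rule ell2_eqI) (simp add: Rep_ell2_simps algebra_simps)
  show "(r + s) *\<^sub>R x = r *\<^sub>R x + s *\<^sub>R x" by (rule ell2_eqI) (simp add: Rep_ell2_simps algebra_simps)
  show "r *\<^sub>R s *\<^sub>R x = (r * s) *\<^sub>R x" by (rule ell2_eqI) (simp add: Rep_ell2_simps)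
  show "1 *\<^sub>R x = x" by (rule ell2_eqI) (simp add: Rep_ell2_simps)
  show "inner x y = inner y x" by (simp add: inner_ell2_def l2_re_inner_commute)
  show "inner (x + y) z = inner x z + inner y z"
    unfolding inner_ell2_def Rep_ell2_add by (intro l2_re_inner_add Rep_ell2_l2)
  show "inner (r *\<^sub>R x) y = r * inner x y"
    unfolding inner_ell2_def Rep_ell2_scaleR by (rule l2_re_inner_scale)
  show "0 \<le> inner x x" unfolding inner_ell2_def l2_re_inner_self by (rule infsum_nonneg) simp
  show "(inner x x = 0) = (x = 0)"
  proof
    assume "inner x x = 0"
    then have s: "(\<Sum>\<^sub>\<infinity>n. (cmod (Rep_ell2 x n))\<^sup>2) \<le> 0" by (simp add: inner_ell2_def l2_re_inner_self)
    have "(cmod (Rep_ell2 x n))\<^sup>2 = 0" for n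
      by (rule nonneg_infsum_le_0D[OF s]) (use Rep_ell2_l2[of x] in \<open>auto simp: l2_def\<close>)
    then show "x = 0" by (intro ell2_eqI) (simp add: Rep_ell2_zero)
  qed (simp add: inner_ell2_def l2_re_inner_def Rep_ell2_zero)
qed (simp_all add: norm_ell2_def sgn_ell2_def dist_ell2_def uniformity_ell2_def open_ell2_def)

end

lemma norm_ell2_eq: "norm x = l2_norm (Rep_ell2 x)"
  by (simp add: norm_ell2_def inner_ell2_def l2_re_inner_self l2_norm_def)

lemma Rep_ell2_sum: "Rep_ell2 (\<Sum>i\<in>A. f i) = (\<lambda>n. \<Sum>i\<in>A. Rep_ell2 (f i) n)"
  by (induction A rule: infinite_finite_induct) (simp_all add: Rep_ell2_simps)

section \<open>The spectral resolution of the Schroedinger operator\<close>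

text \<open>The form identity in the spectral resolution has to be read in the real inner product, and
  the quadratic form of \<open>H\<close> is bounded by \<open>2 + B\<close> because the two shifts are isometries. This confines
  the energies to an interval depending on \<open>V\<close> alone, as the uniformity of \<open>c\<close> requires.\<close>

lemma jacobi_family_schroedinger:
  assumes B: "\<And>x. \<bar>V x\<bar> \<le> B"
    and res: "spectral_resolution (schroedinger V \<alpha> \<theta>) P"
  shows "\<exists>(Q :: real set \<Rightarrow> ell2 \<Rightarrow> ell2) H R \<delta>. jacobi_family Q H R \<delta> (\<lambda>n. V (\<theta> + of_int n * \<alpha>)) (2 + B) \<and>
    jacobi_family.\<mu> Q \<delta> = spectral_measure P"
proof -
  define v where "v = (\<lambda>n::int. V (\<theta> + of_int n * \<alpha>))"
  define Q where "Q = (\<lambda>A x. Abs_ell2 (P A (Rep_ell2 x)))"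
  define shift where "shift = (\<lambda>k x. Abs_ell2 (\<lambda>n. Rep_ell2 x (n + k)))"
  define mult where "mult = (\<lambda>x. Abs_ell2 (\<lambda>n. of_real (v n) * Rep_ell2 x n))"
  define H where "H = (\<lambda>x. shift 1 x + shift (-1) x + mult x)"
  define \<delta> where "\<delta> = (\<lambda>n. Abs_ell2 (delta n))"
  have pvm: "projection_valued_measure P"
    and form: "\<And>u. u \<in> l2 \<Longrightarrow> l2_inner u (schroedinger V \<alpha> \<theta> u) = of_real (\<integral>E. E \<partial>diag_measure P u)"
    using res unfolding spectral_resolution_def by blast+
  note pvm' = pvm[unfolded projection_valued_measure_def]
  note proj = pvm'[THEN conjunct1, rule_format]
  note P_empty = pvm'[THEN conjunct2, THEN conjunct1, rule_format]
  note P_Int = pvm'[THEN conjunct2, THEN conjunct2, THEN conjunct2, THEN conjunct1, rule_format]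
  note P_sigma = pvm'[THEN conjunct2, THEN conjunct2, THEN conjunct2, THEN conjunct2, rule_format]
  obtain R where R: "\<And>u. u \<in> l2 \<Longrightarrow> P {-R<..<R} u = u"
    using pvm'[THEN conjunct2, THEN conjunct2, THEN conjunct1] by auto
  have P_l2: "P A u \<in> l2" if "A \<in> sets borel" "u \<in> l2" for A u
    using proj[OF that(1)] that(2) unfolding orthogonal_projection_def by blast
  have Rep_Q: "Rep_ell2 (Q A x) = P A (Rep_ell2 x)" if "A \<in> sets borel" for A x
    unfolding Q_def by (rule Abs_ell2_inverse[OF P_l2[OF that Rep_ell2_l2]])
  have Rep_shift: "Rep_ell2 (shift k x) = (\<lambda>n. Rep_ell2 x (n + k))" for k x
    unfolding shift_def by (rule Abs_ell2_inverse[OF l2_shift[OF Rep_ell2_l2]])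
  have Rep_mult: "Rep_ell2 (mult x) = (\<lambda>n. of_real (v n) * Rep_ell2 x n)" for x
    unfolding mult_def
    by (rule Abs_ell2_inverse[OF l2_mult_bounded[OF Rep_ell2_l2, of _ B]]) (simp add: v_def B)
  have Rep_\<delta>: "Rep_ell2 (\<delta> n) = delta n" for n
    unfolding \<delta>_def by (rule Abs_ell2_inverse[OF delta_l2])
  have Rep_H: "Rep_ell2 (H x) = schroedinger V \<alpha> \<theta> (Rep_ell2 x)" for x
    by (simp add: H_def Rep_ell2_add Rep_shift Rep_mult schroedinger_def v_def)
  have shift_inner: "inner (shift k x) y = inner x (shift (- k) y)" for k x y
    using l2_re_inner_shift[of "Rep_ell2 x" k "Rep_ell2 y"] by (simp add: inner_ell2_def Rep_shift)
  have mult_inner: "inner (mult x) y = inner x (mult y)" for x y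
    by (simp add: inner_ell2_def l2_re_inner_def Rep_mult algebra_simps)
  have shift_norm: "norm (shift k x) = norm x" for k x
  proof -
    have "shift (- k) (shift k x) = x" by (rule ell2_eqI) (simp add: Rep_shift)
    then show ?thesis using shift_inner[of k x "shift k x"] by (simp add: norm_eq_sqrt_inner)
  qed
  have B0: "B \<ge> 0" using B[of 0] by linarith
  have mult_norm: "norm (mult x) \<le> B * norm x" for x
  proof -
    have s: "(\<lambda>n. (cmod (Rep_ell2 y n))\<^sup>2) summable_on UNIV" for y using Rep_ell2_l2[of y] by (simp add: l2_def)
    have "(\<Sum>\<^sub>\<infinity>n. (cmod (Rep_ell2 (mult x) n))\<^sup>2) \<le> (\<Sum>\<^sub>\<infinity>n. B\<^sup>2 * (cmod (Rep_ell2 x n))\<^sup>2)"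
    proof (rule infsum_mono[OF s summable_on_cmult_right[OF s]])
      fix n
      have "\<bar>v n\<bar>\<^sup>2 \<le> B\<^sup>2" using B by (intro power_mono) (auto simp: v_def)
      then show "(cmod (Rep_ell2 (mult x) n))\<^sup>2 \<le> B\<^sup>2 * (cmod (Rep_ell2 x n))\<^sup>2"
        by (simp add: Rep_mult norm_mult power_mult_distrib mult_right_mono)
    qed
    also have "\<dots> = B\<^sup>2 * (\<Sum>\<^sub>\<infinity>n. (cmod (Rep_ell2 x n))\<^sup>2)" by (rule infsum_cmult_right')
    finally show ?thesis
      unfolding norm_ell2_eq l2_norm_def using B0
      by (metis abs_of_nonneg real_sqrt_abs real_sqrt_le_iff real_sqrt_mult)
  qed
  have diag: "diag_measure P (Rep_ell2 x) = measure_of UNIV (sets borel) (\<lambda>A. ennreal (inner x (Q A x)))" for x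
    unfolding diag_measure_def
  proof (rule measure_of_eq)
    fix A assume "A \<in> sigma_sets UNIV (sets (borel :: real measure))"
    then have A: "A \<in> sets borel" using sets.sigma_sets_eq[of "borel :: real measure"] by simp
    show "ennreal (Re (l2_inner (Rep_ell2 x) (P A (Rep_ell2 x)))) = ennreal (inner x (Q A x))"
      using Re_l2_inner[OF Rep_ell2_l2 P_l2[OF A Rep_ell2_l2], of x x]
      by (simp add: inner_ell2_def Rep_Q[OF A])
  qed simp
  interpret J: jacobi_family Q H R \<delta> v "2 + B"
  proof (intro jacobi_family.intro spectral_family.intro jacobi_family_axioms.intro)
    fix A assume A: "A \<in> sets (borel :: real measure)"
    have lin: "P A (\<lambda>n. a * u n + b * w n) = (\<lambda>n. a * P A u n + b * P A w n)" if "u \<in> l2" "w \<in> l2" for u w a b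
      using proj[OF A] that unfolding orthogonal_projection_def by blast
    show "linear (Q A)"
    proof (rule linearI)
      fix x y :: ell2 and r :: real
      show "Q A (x + y) = Q A x + Q A y"
        using lin[OF Rep_ell2_l2[of x] Rep_ell2_l2[of y], of 1 1]
        by (intro ell2_eqI) (simp add: Rep_Q[OF A] Rep_ell2_simps)
      show "Q A (r *\<^sub>R x) = r *\<^sub>R Q A x"
        using lin[OF Rep_ell2_l2[of x] Rep_ell2_l2[of x], of "of_real r" 0]
        by (intro ell2_eqI) (simp add: Rep_Q[OF A] Rep_ell2_simps)
    qed
    show "Q A (Q A x) = Q A x" for x
      using proj[OF A] Rep_ell2_l2[of x] unfolding orthogonal_projection_def
      by (intro ell2_eqI) (simp add: Rep_Q[OF A])
    show "inner (Q A x) y = inner x (Q A y)" for x y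
    proof -
      have "l2_inner (Rep_ell2 x) (P A (Rep_ell2 y)) = l2_inner (P A (Rep_ell2 x)) (Rep_ell2 y)"
        using proj[OF A] Rep_ell2_l2[of x] Rep_ell2_l2[of y] unfolding orthogonal_projection_def by blast
      then show ?thesis
        using Re_l2_inner[OF Rep_ell2_l2[of x] P_l2[OF A Rep_ell2_l2[of y]]]
          Re_l2_inner[OF P_l2[OF A Rep_ell2_l2[of x]] Rep_ell2_l2[of y]]
        by (simp add: inner_ell2_def Rep_Q[OF A])
    qed
    show "Q (A \<inter> C) x = Q A (Q C x)" if C: "C \<in> sets borel" for C x
      by (rule ell2_eqI) (simp add: Rep_Q A C P_Int[OF A C Rep_ell2_l2] sets.Int)
  next
    show "Q {} x = 0" for x
      by (rule ell2_eqI) (simp add: Rep_Q P_empty Rep_ell2_l2 Rep_ell2_zero)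
    show "Q {-R<..<R} x = x" for x
      by (rule ell2_eqI) (simp add: Rep_Q R Rep_ell2_l2)
    fix A :: "nat \<Rightarrow> real set" and x
    assume A: "range A \<subseteq> sets borel" "disjoint_family A"
    have U: "(\<Union>i. A i) \<in> sets borel" "\<And>i. A i \<in> sets borel" using A by auto
    have "norm (Q (\<Union>i. A i) x - (\<Sum>i<N. Q (A i) x))
        = l2_norm (\<lambda>k. P (\<Union>i. A i) (Rep_ell2 x) k - (\<Sum>i<N. P (A i) (Rep_ell2 x) k))" for N
      by (simp only: norm_ell2_eq Rep_ell2_diff Rep_ell2_sum Rep_Q[OF U(1)] Rep_Q[OF U(2)])
    then show "(\<lambda>N. norm (Q (\<Union>i. A i) x - (\<Sum>i<N. Q (A i) x))) \<longlonglongrightarrow> 0"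
      using P_sigma[OF A Rep_ell2_l2] by simp
  next
    show "linear H"
      by (rule linearI; rule ell2_eqI) (simp_all add: Rep_H Rep_ell2_simps schroedinger_def algebra_simps)
    show "inner (H x) y = inner x (H y)" for x y
      unfolding H_def inner_add_left inner_add_right
      using shift_inner[of 1 x y] shift_inner[of "-1" x y] mult_inner[of x y] by simp
    show "inner x (H x) = (\<integral>E. E \<partial>measure_of UNIV (sets borel) (\<lambda>A. ennreal (inner x (Q A x))))" for x
    proof -
      have "inner x (H x) = Re (l2_inner (Rep_ell2 x) (schroedinger V \<alpha> \<theta> (Rep_ell2 x)))"
        using Re_l2_inner[OF Rep_ell2_l2[of x] Rep_ell2_l2[of "H x"]] by (simp add: inner_ell2_def Rep_H)
      then show ?thesis by (simp add: form[OF Rep_ell2_l2] diag)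
    qed
    show "inner (\<delta> i) (\<delta> j) = (if i = j then 1 else 0)" for i j
    proof -
      have "inner (\<delta> i) (\<delta> j) = (\<Sum>\<^sub>\<infinity>n. Re (cnj (delta i n) * delta j n))"
        by (simp add: inner_ell2_def l2_re_inner_def Rep_\<delta>)
      also have "\<dots> = (\<Sum>\<^sub>\<infinity>n\<in>{i}. Re (cnj (delta i n) * delta j n))"
        by (rule infsum_cong_neutral) (auto simp: delta_def)
      finally show ?thesis by (auto simp: delta_def)
    qed
    show "H (\<delta> n) = \<delta> (n + 1) + \<delta> (n - 1) + v n *\<^sub>R \<delta> n" for n
      by (rule ell2_eqI) (auto simp: Rep_H Rep_ell2_simps Rep_\<delta> schroedinger_def delta_def v_def)
    show "\<bar>inner x (H x)\<bar> \<le> (2 + B) * inner x x" for x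
    proof -
      have "norm (H x) \<le> norm (shift 1 x) + norm (shift (-1) x) + norm (mult x)"
        unfolding H_def by (meson add_mono norm_triangle_ineq order_refl order_trans)
      then have "norm (H x) \<le> (2 + B) * norm x" using mult_norm[of x] by (simp add: shift_norm algebra_simps)
      then have "norm x * norm (H x) \<le> norm x * ((2 + B) * norm x)" by (intro mult_left_mono) auto
      then show ?thesis
        using Cauchy_Schwarz_ineq2[of x "H x"] by (simp add: power2_norm_eq_inner[symmetric] power2_eq_square mult_ac)
    qed
  qed
  have "J.diag (\<delta> n) = diag_measure P (delta n)" for n
    unfolding J.diag_def using diag[of "\<delta> n"] by (simp add: Rep_\<delta>)
  then have "J.\<mu> = spectral_measure P" by (simp add: J.\<mu>_def spectral_measure_def)
  with J.jacobi_family_axioms show ?thesis unfolding v_def by blast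
qed

section \<open>Choice of scales\<close>

text \<open>The blocks have \<open>2 q\<close> sites to contain both the position \<open>j < q\<close> of a large transfer matrix
  and its length \<open>k \<le> q\<close>. The constant \<open>c\<close> depends only on \<open>V\<close> and \<open>a\<close>, in particular not on \<open>\<alpha>\<close>.\<close>

lemma solutions_small_in_blocks:
  assumes an: "real_analytic V" and per: "periodic1 V" and a: "a > 0" and B: "\<And>x. \<bar>V x\<bar> \<le> B"
  obtains c :: real and q1 :: int where "c > 0"
    "\<And>\<alpha> E \<theta> p q u s. \<bar>E\<bar> \<le> 2 + B \<Longrightarrow> lyapunov V \<alpha> E > a \<Longrightarrow> q \<ge> q1 \<Longrightarrow> coprime p q \<Longrightarrow>
      \<bar>of_int q * \<alpha> - of_int p\<bar> < 1 / of_int q \<Longrightarrow> solution (\<lambda>n. V (\<theta> + of_int n * \<alpha>)) E u \<Longrightarrow>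
      \<exists>n. s \<le> n \<and> n < s + int (nat (2 * q)) \<and>
        pair_sq u n \<le> (exp (- c * of_int q))\<^sup>2 * (\<Sum>i\<in>{s..<s + int (nat (2 * q))}. pair_sq u i)"
proof -
  have B0: "B \<ge> 0" using B[of 0] by linarith
  then have R: "2 + B \<ge> 0" by simp
  obtain c1 :: real and q0 :: int where c1: "0 < c1" "c1 \<le> 1" and large:
    "\<And>\<alpha> E \<theta> p q. \<bar>E\<bar> \<le> 2 + B \<Longrightarrow> lyapunov V \<alpha> E > a \<Longrightarrow> q \<ge> q0 \<Longrightarrow> coprime p q \<Longrightarrow>
       \<bar>of_int q * \<alpha> - of_int p\<bar> < 1 / of_int q \<Longrightarrow>
       \<exists>j. int j < q \<and> exp (real (nat \<lfloor>c1 * of_int q\<rfloor>) * a / 2)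
          < frobenius_sq (transfer_product V \<alpha> (nat \<lfloor>c1 * of_int q\<rfloor>) (\<theta> + real j * \<alpha>) E)"
    by (rule transfer_product_large_on_orbit[OF an per a R], rule that, assumption+)
  define C where "C = 2 + 2 * B"
  have "\<forall>\<^sub>F x in at_top. (2 + x * (C + 2)) * exp (a / 4) \<le> exp (a / 8 * x)"
  proof -
    have "C > 0" using B0 by (simp add: C_def)
    with a show ?thesis by real_asymp
  qed
  then obtain x0 where x0: "\<And>x. x \<ge> x0 \<Longrightarrow> (2 + x * (C + 2)) * exp (a / 4) \<le> exp (a / 8 * x)"
    unfolding eventually_at_top_linorder by blast
  \<comment> \<open>The square root of \<open>exp (k a / 2)\<close>, with \<open>k\<close> about \<open>c1 q\<close>, is the square of
    \<open>exp (2 c q)\<close>. Half of the exponent absorbs the factor linear in \<open>k\<close>.\<close>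
  define c where "c = c1 * a / 16"
  define q1 where "q1 = max (max q0 1) \<lceil>x0 / c1\<rceil>"
  show ?thesis
  proof (rule that[of c q1])
    show "c > 0" using c1 a by (simp add: c_def)
    fix \<alpha> E \<theta> :: real and p q s :: int and u
    assume E: "\<bar>E\<bar> \<le> 2 + B" and lyap: "lyapunov V \<alpha> E > a" and q: "q \<ge> q1" and co: "coprime p q"
      and ap: "\<bar>of_int q * \<alpha> - of_int p\<bar> < 1 / of_int q"
      and sol: "solution (\<lambda>n. V (\<theta> + of_int n * \<alpha>)) E u"
    define k where "k = nat \<lfloor>c1 * of_int q\<rfloor>"
    have q': "q \<ge> q0" "q \<ge> 1" using q by (simp_all add: q1_def)
    have x: "c1 * q \<ge> x0"
    proof -
      have "x0 / c1 \<le> q" using q unfolding q1_def by linarith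
      then show ?thesis using c1 by (simp add: field_simps)
    qed
    have "0 \<le> c1 * q" using c1 q' by simp
    then have "real k = of_int \<lfloor>c1 * of_int q\<rfloor>" unfolding k_def by simp
    then have k: "real k \<le> c1 * q" "real k \<ge> c1 * q - 1" by linarith+
    have "c1 * q \<le> 1 * real_of_int q" using c1 q' by (intro mult_right_mono) auto
    then have kq: "int k \<le> q" using k(1) by linarith
    obtain j where j: "int j < q"
      "exp (real k * a / 2) < frobenius_sq (transfer_product V \<alpha> k ((\<theta> + of_int s * \<alpha>) + real j * \<alpha>) E)"
      using large[OF E lyap q'(1) co ap, of "\<theta> + of_int s * \<alpha>"] by (auto simp: k_def)
    have pt: "(\<theta> + of_int s * \<alpha>) + real j * \<alpha> = \<theta> + of_int (s + int j) * \<alpha>" by (simp add: algebra_simps)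
    define D where "D = (\<Sum>i\<in>{s..<s + int (nat (2 * q))}. pair_sq u i)"
    have blk: "s \<le> s + int j + int i \<and> s + int j + int i < s + int (nat (2 * q))" if "i \<le> k" for i
      using that kq j(1) by simp
    have "\<exists>i\<le>k. pair_sq u (s + int j + int i) * sqrt (exp (real k * a / 2)) \<le> D * (2 + real k * (C + 2))"
    proof (rule solution_small_somewhere[OF sol])
      show "\<bar>E - V x\<bar> \<le> C" for x using E B[of x] unfolding C_def by linarith
      show "exp (real k * a / 2) \<le> frobenius_sq (transfer_product V \<alpha> k (\<theta> + of_int (s + int j) * \<alpha>) E)"
        using j(2) unfolding pt by simp
      show "pair_sq u (s + int j + int i) \<le> D" if "i \<le> k" for i
        unfolding D_def using blk[OF that] by (intro member_le_sum) auto
    qed simp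
    then obtain i where i: "i \<le> k" "pair_sq u (s + int j + int i) * sqrt (exp (real k * a / 2)) \<le> D * (2 + real k * (C + 2))"
      by blast
    have D0: "D \<ge> 0" unfolding D_def by (intro sum_nonneg) auto
    have C0: "C \<ge> 0" using B0 by (simp add: C_def)
    have sq: "sqrt (exp (real k * a / 2)) = exp (real k * a / 4)"
      by (rule real_sqrt_unique) (simp_all add: power2_eq_square flip: exp_add)
    have "2 + real k * (C + 2) \<le> 2 + (c1 * q) * (C + 2)" using k C0 by (intro add_mono mult_right_mono) auto
    also have "\<dots> \<le> exp (a / 8 * (c1 * q)) * exp (- (a / 4))"
      using x0[OF x] by (simp add: exp_minus field_simps)
    also have "\<dots> = exp (- (c1 * a / 8) * q) * exp ((c1 * q - 1) * (a / 4))"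
      by (simp add: algebra_simps flip: exp_add)
    also have "\<dots> \<le> exp (- (c1 * a / 8) * q) * exp (real k * a / 4)"
      using mult_right_mono[OF k(2), of "a / 4"] a by simp
    also have "exp (- (c1 * a / 8) * q) = (exp (- c * q))\<^sup>2"
      by (simp add: c_def power2_eq_square flip: exp_add)
    finally have "D * (2 + real k * (C + 2)) \<le> D * ((exp (- c * q))\<^sup>2 * exp (real k * a / 4))"
      using D0 by (rule mult_left_mono)
    from order_trans[OF i(2) this]
    have "pair_sq u (s + int j + int i) * exp (real k * a / 4) \<le> ((exp (- c * q))\<^sup>2 * D) * exp (real k * a / 4)"
      unfolding sq by (simp only: mult_ac)
    then have "pair_sq u (s + int j + int i) \<le> (exp (- c * q))\<^sup>2 * D" by (rule mult_right_le_imp_le) simp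
    then show "\<exists>n. s \<le> n \<and> n < s + int (nat (2 * q)) \<and>
        pair_sq u n \<le> (exp (- c * of_int q))\<^sup>2 * (\<Sum>i\<in>{s..<s + int (nat (2 * q))}. pair_sq u i)"
      using blk[OF i(1)] unfolding D_def by blast
  qed
qed

text \<open>Let \<open>\<gamma>\<^sub>0 = 1 / (1 + c / b)\<close>, and let \<open>n\<close> be the last index with \<open>exp (- c q\<^sub>n) \<ge> \<epsilon>\<close>. If
  \<open>exp (- c q\<^sub>n) \<le> \<epsilon> powr (1 - \<gamma>\<^sub>0)\<close>, then \<open>n\<close> will do, and otherwise \<open>n + 1\<close>, since
  \<open>q\<^sub>n\<^sub>+\<^sub>1 \<le> exp (b q\<^sub>n)\<close>.\<close>

lemma scale_selection:
  fixes q :: "nat \<Rightarrow> real"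
  assumes c: "c > 0" and b: "b > 0" and q: "\<And>n. q n \<ge> real n" and grow: "\<And>n. n \<ge> n0 \<Longrightarrow> q (Suc n) \<le> exp (b * q n)"
  shows "\<forall>\<^sub>F \<epsilon> in at_right 0. \<exists>n\<ge>n0. q n * max 1 (exp (- c * q n) / \<epsilon>)
    \<le> (1 + ln (1 / \<epsilon>) / c) * \<epsilon> powr (- (1 / (1 + c / b)))"
proof -
  define \<gamma>0 where "\<gamma>0 = 1 / (1 + c / b)"
  have \<gamma>0: "\<gamma>0 = b / (c + b)" using b c by (simp add: \<gamma>0_def field_simps)
  have pos: "exp (- c * q n0) > 0" by simp
  have "\<exists>n\<ge>n0. q n * max 1 (exp (- c * q n) / \<epsilon>) \<le> (1 + ln (1 / \<epsilon>) / c) * \<epsilon> powr (- \<gamma>0)"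
    if \<epsilon>: "0 < \<epsilon>" "\<epsilon> < exp (- c * q n0)" for \<epsilon>
  proof -
    define t where "t = - ln \<epsilon>"
    have e: "\<epsilon> = exp (- t)" using \<epsilon> by (simp add: t_def)
    have t: "c * q n0 < t" using \<epsilon>(2) unfolding e by simp
    have "0 \<le> q n0" using q[of n0] by (meson of_nat_0_le_iff order_trans)
    then have t0: "0 < t" using t c by (meson le_less_trans mult_nonneg_nonneg less_imp_le)
    have rhs: "(1 + ln (1 / \<epsilon>) / c) * \<epsilon> powr (- \<gamma>0) = (1 + t / c) * exp (\<gamma>0 * t)"
      by (simp add: e powr_def ln_div)
    define S where "S = {n. n \<ge> n0 \<and> c * q n \<le> t}"
    have "S \<subseteq> {..nat \<lceil>t / c\<rceil>}"
    proof
      fix n assume "n \<in> S"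
      then have "c * q n \<le> t" by (simp add: S_def)
      moreover have "c * real n \<le> c * q n" using q[of n] c by (intro mult_left_mono) auto
      ultimately have "c * real n \<le> t" by linarith
      then have "real n \<le> t / c" using c by (simp add: field_simps)
      then show "n \<in> {..nat \<lceil>t / c\<rceil>}" by (simp add: le_nat_iff) linarith
    qed
    then have fin: "finite S" by (rule finite_subset) simp
    have "n0 \<in> S" using t by (simp add: S_def)
    define n where "n = Max S"
    have n: "n \<in> S" unfolding n_def using fin \<open>n0 \<in> S\<close> by (intro Max_in) auto
    have "Suc n \<notin> S"
    proof
      assume "Suc n \<in> S"
      from Max_ge[OF fin this] show False by (simp add: n_def)
    qed
    then have Sn: "c * q (Suc n) > t" using n by (simp add: S_def)
    have n': "n \<ge> n0" "c * q n \<le> t" using n by (auto simp: S_def)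
    show ?thesis
    proof (cases "(1 - \<gamma>0) * t \<le> c * q n")
      case True
      have "1 \<le> exp (t - c * q n)" using n' by simp
      then have "max 1 (exp (- c * q n) / \<epsilon>) = exp (t - c * q n)"
        by (simp add: e exp_diff[symmetric] max_def add.commute)
      also have "\<dots> \<le> exp (\<gamma>0 * t)" using True by (simp add: algebra_simps)
      finally have 1: "max 1 (exp (- c * q n) / \<epsilon>) \<le> exp (\<gamma>0 * t)" .
      have "q n \<le> 1 + t / c" using n'(2) c by (simp add: field_simps)
      moreover have "0 \<le> q n" using q[of n] by (meson of_nat_0_le_iff order_trans)
      ultimately have "q n * max 1 (exp (- c * q n) / \<epsilon>) \<le> (1 + t / c) * exp (\<gamma>0 * t)"
        using 1 by (intro mult_mono) auto
      then show ?thesis using n'(1) unfolding rhs by blast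
    next
      case False
      have "1 - \<gamma>0 = c / (c + b)" unfolding \<gamma>0 using b c by (simp add: field_simps)
      then have "c * q n < c * (t / (c + b))" using False by simp
      then have "q n \<le> t / (c + b)" using c by (simp only: mult_less_cancel_left_pos less_imp_le)
      then have "b * q n \<le> b * (t / (c + b))" using b by (intro mult_left_mono) auto
      then have "b * q n \<le> \<gamma>0 * t" by (simp add: \<gamma>0)
      then have "q (Suc n) \<le> exp (\<gamma>0 * t)" using grow[OF n'(1)] by (meson exp_le_cancel_iff order_trans)
      moreover have "max 1 (exp (- c * q (Suc n)) / \<epsilon>) = 1"
        using Sn by (simp add: e exp_diff[symmetric] max_def)
      moreover have "exp (\<gamma>0 * t) \<le> (1 + t / c) * exp (\<gamma>0 * t)" using t0 c by simp
      ultimately have "q (Suc n) * max 1 (exp (- c * q (Suc n)) / \<epsilon>) \<le> (1 + t / c) * exp (\<gamma>0 * t)"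
        by (simp only: mult_1_right)
      then show ?thesis using n'(1) unfolding rhs by (intro exI[of _ "Suc n"]) simp
    qed
  qed
  then show ?thesis
    unfolding eventually_at_right_field \<gamma>0_def[symmetric] using pos by blast
qed

lemma weighted_sum_bound:
  fixes g :: "nat \<Rightarrow> real"
  assumes g: "\<And>i. g i \<ge> 0" and s: "s \<ge> 0" and C: "(\<Sum>i<l. (1 + real i) powr (- s) * g i) \<le> C"
  shows "(\<Sum>i<l. g i) \<le> C * real l powr s"
proof -
  have "g i \<le> ((1 + real i) powr (- s) * g i) * real l powr s" if "i < l" for i
  proof -
    have "(1 + real i) powr s \<le> real l powr s" using that s by (intro powr_mono2) auto
    then have "((1 + real i) powr (- s) * g i) * (1 + real i) powr s \<le> ((1 + real i) powr (- s) * g i) * real l powr s"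
      using g by (intro mult_left_mono) auto
    moreover have "((1 + real i) powr (- s) * g i) * (1 + real i) powr s = g i"
      by (simp add: powr_minus field_simps)
    ultimately show ?thesis by simp
  qed
  then have "(\<Sum>i<l. g i) \<le> (\<Sum>i<l. ((1 + real i) powr (- s) * g i) * real l powr s)" by (intro sum_mono) auto
  also have "\<dots> \<le> C * real l powr s" unfolding sum_distrib_right[symmetric] using C by (intro mult_right_mono) auto
  finally show ?thesis .
qed

text \<open>Between consecutive powers of \<open>1 / 2\<close> the first factor varies at most by the factor 4, and the
  second is monotone.\<close>

lemma dyadic_filterlim:
  fixes G :: "real \<Rightarrow> real"
  assumes mono: "\<And>x y. 0 < x \<Longrightarrow> x \<le> y \<Longrightarrow> G y \<le> G x" and nn: "\<And>x. 0 \<le> G x" and p: "0 \<le> p" "p \<le> 2"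
    and lim: "filterlim (\<lambda>k. ((1 / 2) ^ k) powr p * G ((1 / 2) ^ k)) at_top sequentially"
  shows "filterlim (\<lambda>\<epsilon>. \<epsilon> powr p * G \<epsilon>) at_top (at_right 0)"
  unfolding filterlim_at_top
proof
  fix Z :: real
  obtain k0 where k0: "\<And>k. k \<ge> k0 \<Longrightarrow> 4 * Z \<le> ((1 / 2) ^ k) powr p * G ((1 / 2) ^ k)"
    using lim unfolding filterlim_at_top eventually_sequentially by blast
  have "Z \<le> \<epsilon> powr p * G \<epsilon>" if \<epsilon>: "0 < \<epsilon>" "\<epsilon> < (1 / 2) ^ k0" for \<epsilon>
  proof -
    obtain m0 where "(1 / 2) ^ m0 < \<epsilon>" using real_arch_pow_inv[OF \<epsilon>(1), of "1/2"] by auto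
    define m where "m = (LEAST m. (1 / 2) ^ m < \<epsilon>)"
    have m: "(1 / 2) ^ m < \<epsilon>" unfolding m_def by (rule LeastI) fact
    have "(1 / 2 :: real) ^ m < (1 / 2) ^ k0" using m \<epsilon>(2) by linarith
    then have mk: "k0 < m" by (simp add: power_strict_decreasing_iff)
    then obtain k where k: "m = Suc k" by (cases m) auto
    have ek: "\<epsilon> \<le> (1 / 2) ^ k" using not_less_Least[of k "\<lambda>m. (1 / 2) ^ m < \<epsilon>"] k by (simp add: m_def not_less)
    have "(1 / 4) * ((1 / 2) ^ k) powr p \<le> \<epsilon> powr p"
    proof -
      have "(1 / 2 :: real) powr 2 \<le> (1 / 2) powr p" using p by (intro powr_mono') auto
      then have "(1 / 4 :: real) \<le> (1 / 2) powr p" by (simp add: power2_eq_square)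
      then have "(1 / 4) * ((1 / 2) ^ k) powr p \<le> (1 / 2) powr p * ((1 / 2) ^ k) powr p" by (intro mult_right_mono) auto
      also have "\<dots> = ((1 / 2) ^ m) powr p" by (simp add: k flip: powr_mult)
      also have "\<dots> \<le> \<epsilon> powr p" using m p by (intro powr_mono2) auto
      finally show ?thesis .
    qed
    then have "(1 / 4) * ((1 / 2) ^ k) powr p * G ((1 / 2) ^ k) \<le> \<epsilon> powr p * G \<epsilon>"
      using mono[OF \<epsilon>(1) ek] nn by (intro mult_mono) auto
    moreover have "4 * Z \<le> ((1 / 2) ^ k) powr p * G ((1 / 2) ^ k)" using k0[of k] mk k by simp
    ultimately show ?thesis by simp
  qed
  then show "\<forall>\<^sub>F \<epsilon> in at_right 0. Z \<le> \<epsilon> powr p * G \<epsilon>"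
    unfolding eventually_at_right_field by (intro exI[of _ "(1 / 2) ^ k0"]) auto
qed

lemma borel_transform_ge_poisson:
  fixes M :: "real measure"
  assumes M: "sets M = sets borel" "finite_measure M" and \<epsilon>: "\<epsilon> > 0"
  shows "\<epsilon> * poisson M \<epsilon> E \<le> cmod (borel_transform M (Complex E \<epsilon>))"
proof -
  interpret finite_measure M by fact
  let ?f = "\<lambda>t. 1 / (complex_of_real t - Complex E \<epsilon>)"
  have sq: "(cmod (complex_of_real t - Complex E \<epsilon>))\<^sup>2 = (t - E)\<^sup>2 + \<epsilon>\<^sup>2" for t
    by (simp add: cmod_power2)
  have ne: "complex_of_real t - Complex E \<epsilon> \<noteq> 0" for t
    using \<epsilon> by (auto simp: complex_eq_iff)
  have "cmod (?f t) \<le> 1 / \<epsilon>" for t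
  proof -
    have "\<epsilon> \<le> cmod (complex_of_real t - Complex E \<epsilon>)"
      using abs_Im_le_cmod[of "complex_of_real t - Complex E \<epsilon>"] by simp
    then show ?thesis using \<epsilon> by (simp add: norm_divide frac_le)
  qed
  moreover have "?f \<in> borel_measurable M"
    unfolding measurable_cong_sets[OF M(1) refl]
    by (intro borel_measurable_continuous_onI continuous_intros) (use ne in auto)
  ultimately have int: "integrable M ?f" by (intro integrable_const_bound[where B = "1 / \<epsilon>"]) auto
  have im: "Im (?f t) = \<epsilon> * (1 / ((t - E)\<^sup>2 + \<epsilon>\<^sup>2))" for t
    by (simp add: Im_divide power2_eq_square)
  have "\<epsilon> * poisson M \<epsilon> E = (\<integral>t. Im (?f t) \<partial>M)"
    unfolding im poisson_def by (simp only: Bochner_Integration.integral_mult_right_zero)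
  also have "\<dots> = Im (borel_transform M (Complex E \<epsilon>))"
    unfolding borel_transform_def by (rule integral_Im[OF int])
  also have "\<dots> \<le> cmod (borel_transform M (Complex E \<epsilon>))" using abs_Im_le_cmod abs_ge_self order_trans by blast
  finally show ?thesis .
qed

text \<open>The condition \<open>1 / (1 + c / b) < \<gamma>\<close> reads \<open>b < c \<gamma> / (1 - \<gamma>)\<close>, which is open in \<open>b\<close> and holds for
  \<open>b = \<beta>(\<alpha>)\<close>, so it leaves room for some \<open>b > \<beta>(\<alpha>)\<close>.\<close>

lemma beta_exponent_growth:
  assumes irr: "\<alpha> \<notin> \<rat>" and c: "c > 0" and \<gamma>: "\<gamma> < 1" "\<gamma> > singularity_threshold c (beta_exponent \<alpha>)" "\<gamma> > 0"
  obtains b :: real and n0 where "b > 0" "1 / (1 + c / b) < \<gamma>"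
    "\<And>n. n \<ge> n0 \<Longrightarrow> real_of_int (convergent_denom \<alpha> (Suc n)) \<le> exp (b * convergent_denom \<alpha> n)"
proof -
  define \<beta> where "\<beta> = beta_exponent \<alpha>"
  have q: "convergent_denom \<alpha> n \<ge> 1" for n by (rule convergent_denom_ge_1[OF irr])
  have "0 \<le> \<beta>"
    unfolding \<beta>_def beta_exponent_def using q
    by (intro le_Limsup always_eventually) (auto intro!: divide_nonneg_nonneg ln_ge_zero simp: order_trans[OF zero_le_one])
  moreover have "\<beta> \<noteq> \<infinity>" using \<gamma> by (auto simp: \<beta>_def singularity_threshold_def)
  ultimately obtain b0 where b0: "\<beta> = ereal b0" "b0 \<ge> 0" by (cases \<beta>) auto
  define G where "G = c * \<gamma> / (1 - \<gamma>)"
  have G: "G > 0" using c \<gamma> by (simp add: G_def)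
  have bG: "1 / (1 + c / b) < \<gamma> \<longleftrightarrow> b < G" if "b > 0" for b
  proof -
    have "1 / (1 + c / b) = b / (b + c)" using that c by (simp add: field_simps)
    moreover have "b / (b + c) < \<gamma> \<longleftrightarrow> b < G" using that c \<gamma> by (simp add: G_def field_simps)
    ultimately show ?thesis by simp
  qed
  have "b0 < G"
  proof (cases "b0 = 0")
    case False
    then have "1 / (1 + c / b0) < \<gamma>"
      using \<gamma>(2) b0 by (simp add: \<beta>_def[symmetric] singularity_threshold_def)
    then show ?thesis using bG[of b0] False b0(2) by simp
  qed (use G in simp)
  define b where "b = (b0 + G) / 2"
  have b: "b > 0" "b < G" "b0 < b" using G b0(2) \<open>b0 < G\<close> by (auto simp: b_def)
  have "limsup (\<lambda>n. ereal (ln (of_int (convergent_denom \<alpha> (Suc n))) / of_int (convergent_denom \<alpha> n))) < ereal b"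
    using b0(1) b(3) by (simp add: \<beta>_def beta_exponent_def)
  from Limsup_lessD[OF this] obtain n0 where n0: "\<And>n. n \<ge> n0 \<Longrightarrow>
      ln (of_int (convergent_denom \<alpha> (Suc n))) / of_int (convergent_denom \<alpha> n) < b"
    by (auto simp: eventually_sequentially)
  show ?thesis
  proof (rule that[OF b(1), of n0])
    show "1 / (1 + c / b) < \<gamma>" using bG[OF b(1)] b(2) by simp
    fix n assume "n \<ge> n0"
    then have "ln (of_int (convergent_denom \<alpha> (Suc n))) \<le> b * convergent_denom \<alpha> n"
      using n0[of n] q[of n] by (simp add: divide_less_eq)
    then have "exp (ln (of_int (convergent_denom \<alpha> (Suc n)))) \<le> exp (b * convergent_denom \<alpha> n)" by simp
    then show "real_of_int (convergent_denom \<alpha> (Suc n)) \<le> exp (b * convergent_denom \<alpha> n)"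
      using q[of "Suc n"] by simp
  qed
qed

lemma threshold_function_at_top:
  fixes c C d s g :: real
  assumes "c > 0" "C > 0" "s > 0" "d > 0"
  shows "filterlim (\<lambda>t. C * (t powr (- d) * (1 + ln (1 / t) / c) powr (- (1 + s)))) at_top (at_right 0)"
proof -
  have "filterlim (\<lambda>t. t powr (- d) * (1 + ln (1 / t) / c) powr (- (1 + s))) at_top (at_right 0)"
    using assms by real_asymp
  then show ?thesis using assms(2) by (intro filterlim_tendsto_pos_mult_at_top[OF tendsto_const])
qed

text \<open>With the scale \<open>n\<close> chosen for \<open>\<epsilon>\<close> and \<open>N\<close> about \<open>max 1 (exp (- c q\<^sub>n) / \<epsilon>)\<close>, the blocks cover a
  length bounded by a multiple of \<open>(1 + ln (1 / \<epsilon>) / c) * \<epsilon> powr (- 1 / (1 + c / b))\<close>, and the square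
  sum of \<open>u\<close> over them is at most the power \<open>1 + \<sigma>\<close> of it.\<close>

lemma (in jacobi_family) poisson_lower_bound_scales:
  fixes q :: "nat \<Rightarrow> int" and b c \<sigma> C :: real
  assumes sol: "solution v E u" and j: "1 / 2 \<le> max \<bar>u 0\<bar> \<bar>u 1\<bar>"
    and \<sigma>: "\<sigma> > 0" and C: "\<And>l. (\<Sum>i<l. (1 + real i) powr (- (1 + \<sigma>)) * ((u (int i))\<^sup>2 + (u (- int i))\<^sup>2)) \<le> C"
    and c: "c > 0" and b: "b > 0" and q: "\<And>n. q n \<ge> 1" "\<And>n. q n \<ge> int n"
    and grow: "\<And>n. n \<ge> n0 \<Longrightarrow> real_of_int (q (Suc n)) \<le> exp (b * q n)"
    and small: "\<And>n s. n \<ge> n0 \<Longrightarrow> \<exists>k. s \<le> k \<and> k < s + int (nat (2 * q n)) \<and>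
        pair_sq u k \<le> (exp (- c * q n))\<^sup>2 * (\<Sum>i\<in>{s..<s + int (nat (2 * q n))}. pair_sq u i)"
  shows "\<exists>C'>0. \<forall>\<^sub>F \<epsilon> in at_right 0.
    C' * \<epsilon> powr (- 2 + (1 + \<sigma>) / (1 + c / b)) * (1 + ln (1 / \<epsilon>) / c) powr (- (1 + \<sigma>)) \<le> poisson \<mu> \<epsilon> E"
proof -
  define g0 where "g0 = 1 / (1 + c / b)"
  define C1 where "C1 = max C 1"
  define K1 where "K1 = 108 * C1 * 6 powr (1 + \<sigma>)"
  have K1: "K1 > 0" by (simp add: K1_def C1_def)
  have "\<forall>\<^sub>F \<epsilon> in at_right 0. \<exists>n\<ge>n0. real_of_int (q n) * max 1 (exp (- c * q n) / \<epsilon>)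
      \<le> (1 + ln (1 / \<epsilon>) / c) * \<epsilon> powr (- (1 / (1 + c / b)))"
  proof (rule scale_selection[OF c b])
    show "real n \<le> real_of_int (q n)" for n using q(2)[of n] by linarith
  qed (rule grow)
  moreover have "\<forall>\<^sub>F \<epsilon> :: real in at_right 0. 0 < \<epsilon>" by (rule eventually_at_right_less)
  ultimately have "\<forall>\<^sub>F \<epsilon> in at_right 0.
    1 / K1 * \<epsilon> powr (- 2 + (1 + \<sigma>) / (1 + c / b)) * (1 + ln (1 / \<epsilon>) / c) powr (- (1 + \<sigma>)) \<le> poisson \<mu> \<epsilon> E"
  proof eventually_elim
    case (elim \<epsilon>)
    then obtain n where n: "n \<ge> n0" "real_of_int (q n) * max 1 (exp (- c * q n) / \<epsilon>)
      \<le> (1 + ln (1 / \<epsilon>) / c) * \<epsilon> powr (- g0)" unfolding g0_def by blast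
    have \<epsilon>: "\<epsilon> > 0" using elim by simp
    define X where "X = (1 + ln (1 / \<epsilon>) / c) * \<epsilon> powr (- g0)"
    define mx where "mx = max 1 (exp (- c * q n) / \<epsilon>)"
    have mx: "mx \<ge> 1" "exp (- c * q n) / \<epsilon> \<le> mx" by (simp_all add: mx_def)
    define N where "N = nat \<lceil>mx\<rceil>"
    have N: "N \<ge> 1" "real N \<ge> mx" "real N \<le> 2 * mx"
    proof -
      have "\<lceil>mx\<rceil> \<ge> 1" using mx(1) by linarith
      then have "real N = of_int \<lceil>mx\<rceil>" by (simp add: N_def)
      then show "real N \<ge> mx" "real N \<le> 2 * mx" using mx(1) by linarith+
      then show "N \<ge> 1" using mx(1) by (cases "N = 0") auto
    qed
    define len where "len = N * nat (2 * q n) + 2"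
    have qX: "q n * mx \<le> X" using n(2) by (simp add: X_def mx_def)
    have "1 * 1 \<le> q n * mx" using q(1)[of n] mx(1) by (intro mult_mono) auto
    then have qm1: "1 \<le> q n * mx" by simp
    then have X1: "X \<ge> 1" using qX by linarith
    have len: "real len \<le> 6 * X"
    proof -
      have "real len = real N * (2 * q n) + 2" using q(1)[of n] by (simp add: len_def)
      also have "\<dots> \<le> (2 * mx) * (2 * q n) + 2" using N(3) q(1)[of n] by (intro add_mono mult_right_mono) auto
      also have "\<dots> \<le> 6 * (q n * mx)" using qm1 by (simp add: mult_ac)
      finally show ?thesis using qX by simp
    qed
    obtain j' where j': "j' = 0 \<or> j' = 1" "1 / 2 \<le> \<bar>u j'\<bar>" using j by (auto simp: max_def split: if_splits)
    have "1 \<le> 108 * \<epsilon>\<^sup>2 * poisson \<mu> \<epsilon> E * (\<Sum>i<len. (u (int i))\<^sup>2 + (u (- int i))\<^sup>2)"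
      unfolding len_def
    proof (rule poisson_lower_bound_blocks[OF sol j' \<epsilon> N(1) _ _ _ small[OF n(1)]])
      have "exp (- c * q n) \<le> mx * \<epsilon>" using mx(2) \<epsilon> by (simp add: field_simps)
      also have "\<dots> \<le> real N * \<epsilon>" using N(2) \<epsilon> by (intro mult_right_mono) auto
      finally show "exp (- c * q n) \<le> real N * \<epsilon>" .
      show "nat (2 * q n) > 0" using q(1)[of n] by simp
    qed simp
    also have "\<dots> \<le> 108 * \<epsilon>\<^sup>2 * poisson \<mu> \<epsilon> E * (C1 * (6 * X) powr (1 + \<sigma>))"
    proof (rule mult_left_mono)
      have "(\<Sum>i<len. (u (int i))\<^sup>2 + (u (- int i))\<^sup>2) \<le> C1 * real len powr (1 + \<sigma>)"
        using C[of len] \<sigma> by (intro weighted_sum_bound) (auto simp: C1_def)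
      also have "\<dots> \<le> C1 * (6 * X) powr (1 + \<sigma>)"
        using len \<sigma> by (intro mult_left_mono powr_mono2) (auto simp: C1_def)
      finally show "(\<Sum>i<len. (u (int i))\<^sup>2 + (u (- int i))\<^sup>2) \<le> C1 * (6 * X) powr (1 + \<sigma>)" .
      show "0 \<le> 108 * \<epsilon>\<^sup>2 * poisson \<mu> \<epsilon> E"
        unfolding poisson_def by (intro mult_nonneg_nonneg integral_nonneg_AE) auto
    qed
    finally have 1: "1 \<le> K1 * (\<epsilon>\<^sup>2 * X powr (1 + \<sigma>)) * poisson \<mu> \<epsilon> E"
      using X1 by (simp add: K1_def powr_mult mult_ac)
    have Y: "\<epsilon>\<^sup>2 * X powr (1 + \<sigma>) > 0" using \<epsilon> X1 by simp
    have "1 / (K1 * (\<epsilon>\<^sup>2 * X powr (1 + \<sigma>))) \<le> poisson \<mu> \<epsilon> E"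
      using 1 K1 Y by (simp add: divide_le_eq mult.commute)
    moreover have "1 / (K1 * (\<epsilon>\<^sup>2 * X powr (1 + \<sigma>)))
        = 1 / K1 * \<epsilon> powr (- 2 + (1 + \<sigma>) * g0) * (1 + ln (1 / \<epsilon>) / c) powr (- (1 + \<sigma>))"
    proof -
      have l: "1 + ln (1 / \<epsilon>) / c > 0"
      proof (rule ccontr)
        assume "\<not> 1 + ln (1 / \<epsilon>) / c > 0"
        then have "X \<le> 0" unfolding X_def by (intro mult_nonpos_nonneg) auto
        then show False using X1 by simp
      qed
      have xp: "X powr (1 + \<sigma>) = (1 + ln (1 / \<epsilon>) / c) powr (1 + \<sigma>) * \<epsilon> powr (- ((1 + \<sigma>) * g0))"
      proof -
        have "X powr (1 + \<sigma>) = (1 + ln (1 / \<epsilon>) / c) powr (1 + \<sigma>) * (\<epsilon> powr (- g0)) powr (1 + \<sigma>)"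
          unfolding X_def by (rule powr_mult)
        moreover have "(\<epsilon> powr (- g0)) powr (1 + \<sigma>) = \<epsilon> powr (- g0 * (1 + \<sigma>))" by (rule powr_powr)
        moreover have "- g0 * (1 + \<sigma>) = - ((1 + \<sigma>) * g0)" by algebra
        ultimately show ?thesis by (simp only:)
      qed
      have e2: "\<epsilon>\<^sup>2 = \<epsilon> powr 2" using powr_realpow[OF \<epsilon>, of 2] by simp
      have ee: "\<epsilon> powr 2 * \<epsilon> powr (- ((1 + \<sigma>) * g0)) = \<epsilon> powr (2 - (1 + \<sigma>) * g0)"
        by (simp only: powr_add[symmetric] diff_conv_add_uminus)
      have eq: "\<epsilon>\<^sup>2 * X powr (1 + \<sigma>)
          = (1 + ln (1 / \<epsilon>) / c) powr (1 + \<sigma>) * \<epsilon> powr (2 - (1 + \<sigma>) * g0)"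
        unfolding xp e2 ee[symmetric] by (simp only: mult_ac)
      have ex: "- 2 + (1 + \<sigma>) * g0 = - (2 - (1 + \<sigma>) * g0)" by simp
      show ?thesis unfolding eq ex powr_minus by (simp add: divide_inverse)
    qed
    ultimately show ?case by (simp add: g0_def)
  qed
  then show ?thesis using K1 by (intro exI[of _ "1 / K1"]) simp
qed

theorem theorem5:
  fixes V :: "real \<Rightarrow> real" and a :: real
  assumes "periodic1 V" and "real_analytic V" and "a > 0"
  shows "\<exists>c::real. c > 0 \<and>
    (\<forall>(\<alpha>::real) (\<theta>::real) P (S::real set) (\<gamma>::real).
       \<alpha> \<notin> \<rat> \<longrightarrow>
       spectral_resolution (schroedinger V \<alpha> \<theta>) P \<longrightarrow>
       S \<in> sets borel \<longrightarrow>
       (\<forall>E\<in>S. lyapunov V \<alpha> E > a) \<longrightarrow>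
       0 < \<gamma> \<longrightarrow> \<gamma> < 1 \<longrightarrow>
       \<gamma> > singularity_threshold c (beta_exponent \<alpha>) \<longrightarrow>
       spectral_singular \<gamma> (measure_restrict (spectral_measure P) S))"
proof -
  obtain \<rho> B where \<rho>: "\<rho> > 0" and ser: "\<And>y. poly_series \<rho> B (\<lambda>t. V (y + t))"
    using real_analytic_poly_series[OF assms(2,1)] by blast
  have B: "\<bar>V x\<bar> \<le> B" for x using poly_series_bound(2)[OF ser, of 0 x] \<rho> by simp
  obtain c :: real and q1 :: int where c: "c > 0" and small:
    "\<And>\<alpha> E \<theta> p q u s. \<bar>E\<bar> \<le> 2 + B \<Longrightarrow> lyapunov V \<alpha> E > a \<Longrightarrow> q \<ge> q1 \<Longrightarrow> coprime p q \<Longrightarrow>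
      \<bar>of_int q * \<alpha> - of_int p\<bar> < 1 / of_int q \<Longrightarrow> solution (\<lambda>n. V (\<theta> + of_int n * \<alpha>)) E u \<Longrightarrow>
      \<exists>n. s \<le> n \<and> n < s + int (nat (2 * q)) \<and>
        pair_sq u n \<le> (exp (- c * of_int q))\<^sup>2 * (\<Sum>i\<in>{s..<s + int (nat (2 * q))}. pair_sq u i)"
    by (rule solutions_small_in_blocks[OF assms(2,1,3) B], rule that, assumption+)
  show ?thesis
  proof (intro exI[of _ c] conjI c allI impI)
    fix \<alpha> \<theta> :: real and P S and \<gamma> :: real
    assume irr: "\<alpha> \<notin> \<rat>" and res: "spectral_resolution (schroedinger V \<alpha> \<theta>) P" and S: "S \<in> sets borel"
      and lyap: "\<forall>E\<in>S. lyapunov V \<alpha> E > a" and \<gamma>: "0 < \<gamma>" "\<gamma> < 1"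
      and thr: "\<gamma> > singularity_threshold c (beta_exponent \<alpha>)"
    obtain b n1 where b: "b > 0" "1 / (1 + c / b) < \<gamma>"
      and grow: "\<And>n. n \<ge> n1 \<Longrightarrow> real_of_int (convergent_denom \<alpha> (Suc n)) \<le> exp (b * convergent_denom \<alpha> n)"
      using beta_exponent_growth[OF irr c \<gamma>(2) thr \<gamma>(1)] by metis
    define q where "q = convergent_denom \<alpha>"
    define n0 where "n0 = max n1 (nat q1)"
    define g0 where "g0 = 1 / (1 + c / b)"
    \<comment> \<open>\<open>\<sigma>\<close> is lost in the growth of the eigenfunction and again in the restriction to \<open>S\<close>;
      a third of the gap leaves the positive exponent \<open>d\<close>.\<close>
    define \<sigma> where "\<sigma> = (\<gamma> - g0) / 3"
    have g0: "0 < g0" "g0 < 1"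
    proof -
      have "c / b > 0" using b(1) c by simp
      then show "0 < g0" "g0 < 1" by (simp_all add: g0_def field_simps)
    qed
    have \<sigma>: "\<sigma> > 0" using b(2) by (simp add: \<sigma>_def g0_def)
    define d where "d = \<gamma> - \<sigma> - (1 + \<sigma>) * g0"
    have d: "d > 0"
    proof -
      have "\<sigma> * g0 \<le> \<sigma> * 1" using \<sigma> g0 by (intro mult_left_mono) auto
      moreover have "3 * \<sigma> = \<gamma> - g0" by (simp add: \<sigma>_def)
      ultimately show ?thesis using \<sigma> unfolding d_def distrib_right by linarith
    qed
    obtain Q :: "real set \<Rightarrow> ell2 \<Rightarrow> ell2" and H R \<delta>
      where jac: "jacobi_family Q H R \<delta> (\<lambda>n. V (\<theta> + of_int n * \<alpha>)) (2 + B)"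
        and mu: "jacobi_family.\<mu> Q \<delta> = spectral_measure P"
      using jacobi_family_schroedinger[OF B res] by blast
    interpret J: jacobi_family Q H R \<delta> "\<lambda>n. V (\<theta> + of_int n * \<alpha>)" "2 + B" by (rule jac)
    define N where "N = measure_restrict (spectral_measure P) S"
    have N_def': "N = density J.\<mu> (indicator S)" by (simp add: N_def measure_restrict_def mu)
    have N: "sets N = sets borel" "finite_measure N"
    proof -
      show "sets N = sets borel" by (simp add: N_def')
      have "emeasure N UNIV = emeasure J.\<mu> (S \<inter> UNIV)"
        unfolding N_def' using S by (intro emeasure_restricted) simp_all
      then show "finite_measure N"
        using finite_measure.emeasure_finite[OF J.finite_measure_\<mu>, of S] by (intro finite_measureI) (simp add: N_def')
    qed
    have AE_N: "AE E in N. E \<in> S \<and> X E" if "AE E in J.\<mu>. X E" for X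
    proof -
      have "AE E in J.\<mu>. 0 < (indicator S E :: ennreal) \<longrightarrow> E \<in> S \<and> X E"
        using that by eventually_elim (auto simp: indicator_def split: if_splits)
      moreover have "(AE E in density J.\<mu> (indicator S). E \<in> S \<and> X E)
          \<longleftrightarrow> (AE E in J.\<mu>. 0 < (indicator S E :: ennreal) \<longrightarrow> E \<in> S \<and> X E)"
        by (rule AE_density) (use S in simp)
      ultimately show ?thesis unfolding N_def' by blast
    qed
    have wsum: "summable (\<lambda>i. (1 + real i) powr (- (1 + \<sigma>)))"
    proof -
      have "summable (\<lambda>i. real i powr (- (1 + \<sigma>)))" using \<sigma> by (simp add: summable_real_powr_iff)
      then have "summable (\<lambda>i. real (Suc i) powr (- (1 + \<sigma>)))" by (subst summable_Suc_iff)
      then show ?thesis by (simp add: add.commute)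
    qed
    have "AE E in J.\<mu>. \<bar>E\<bar> \<le> 2 + B \<and> (\<exists>u C. solution (\<lambda>n. V (\<theta> + of_int n * \<alpha>)) E u \<and> 1 / 2 \<le> max \<bar>u 0\<bar> \<bar>u 1\<bar> \<and>
        (\<forall>l. (\<Sum>i<l. (1 + real i) powr (- (1 + \<sigma>)) * ((u (int i))\<^sup>2 + (u (- int i))\<^sup>2)) \<le> C))"
      by (rule J.generalized_eigenfunction[OF _ wsum]) simp
    from AE_N[OF this]
    have eig: "AE E in N. E \<in> S \<and> \<bar>E\<bar> \<le> 2 + B \<and> (\<exists>u C. solution (\<lambda>n. V (\<theta> + of_int n * \<alpha>)) E u \<and> 1 / 2 \<le> max \<bar>u 0\<bar> \<bar>u 1\<bar> \<and>
        (\<forall>l. (\<Sum>i<l. (1 + real i) powr (- (1 + \<sigma>)) * ((u (int i))\<^sup>2 + (u (- int i))\<^sup>2)) \<le> C))" .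
    have "AE E in N. \<bar>E\<bar> < R"
      using AE_N[OF J.AE_\<mu>_bounded] by eventually_elim auto
    from poisson_comparison[OF J.sets_\<mu> J.finite_measure_\<mu> N this \<sigma>]
    have restr: "AE E in N. \<forall>\<^sub>F k in sequentially.
      ((1 / 2) ^ k) powr \<sigma> * poisson J.\<mu> ((1 / 2) ^ k) E \<le> poisson N ((1 / 2) ^ k) E" .
    have "AE E in N. Liminf (at_right 0)
        (\<lambda>\<epsilon>. ereal (\<epsilon> powr (1 - \<gamma>) * cmod (borel_transform N (Complex E \<epsilon>)))) = \<infinity>"
      using eig restr
    proof eventually_elim
      case (elim E)
      then obtain u C where E: "E \<in> S" "\<bar>E\<bar> \<le> 2 + B" and u: "solution (\<lambda>n. V (\<theta> + of_int n * \<alpha>)) E u"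
        "1 / 2 \<le> max \<bar>u 0\<bar> \<bar>u 1\<bar>"
        "\<And>l. (\<Sum>i<l. (1 + real i) powr (- (1 + \<sigma>)) * ((u (int i))\<^sup>2 + (u (- int i))\<^sup>2)) \<le> C" by blast
      have qn: "q n \<ge> q1" if "n \<ge> n0" for n
        using convergent_denom_ge_index[OF irr, of n] that unfolding q_def n0_def by linarith
      have "\<exists>C'>0. \<forall>\<^sub>F \<epsilon> in at_right 0.
        C' * \<epsilon> powr (- 2 + (1 + \<sigma>) / (1 + c / b)) * (1 + ln (1 / \<epsilon>) / c) powr (- (1 + \<sigma>)) \<le> poisson J.\<mu> \<epsilon> E"
      proof (rule J.poisson_lower_bound_scales[OF u(1,2) \<sigma> u(3) c b(1), of q n0])
        show "q n \<ge> 1" "q n \<ge> int n" for n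
          unfolding q_def by (rule convergent_denom_ge_1[OF irr] convergent_denom_ge_index[OF irr])+
        show "real_of_int (q (Suc n)) \<le> exp (b * q n)" if "n \<ge> n0" for n
          unfolding q_def using that by (intro grow) (simp add: n0_def)
        show "\<exists>k. s \<le> k \<and> k < s + int (nat (2 * q n)) \<and>
            pair_sq u k \<le> (exp (- c * q n))\<^sup>2 * (\<Sum>i\<in>{s..<s + int (nat (2 * q n))}. pair_sq u i)"
          if "n \<ge> n0" for n s
          using small[OF E(2) _ qn[OF that] _ _ u(1), of "convergent_num \<alpha> n" s]
            lyap E(1) coprime_convergent convergent_error[OF irr, of n] unfolding q_def by blast
      qed
      then obtain C' where C': "C' > 0" and low: "\<forall>\<^sub>F \<epsilon> in at_right 0.
        C' * \<epsilon> powr (- 2 + (1 + \<sigma>) / (1 + c / b)) * (1 + ln (1 / \<epsilon>) / c) powr (- (1 + \<sigma>)) \<le> poisson J.\<mu> \<epsilon> E"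
        by blast
      have dy: "filterlim (\<lambda>k. (1 / 2 :: real) ^ k) (at_right 0) sequentially"
        by real_asymp
      have "filterlim (\<lambda>k. ((1 / 2) ^ k) powr (2 - \<gamma>) * poisson N ((1 / 2) ^ k) E) at_top sequentially"
      proof (rule filterlim_at_top_mono)
        show "filterlim (\<lambda>k. C' * (((1 / 2) ^ k) powr (- d) * (1 + ln (1 / (1 / 2) ^ k) / c) powr (- (1 + \<sigma>)))) at_top sequentially"
          by (rule filterlim_compose[OF threshold_function_at_top[OF c C' \<sigma> d] dy])
        show "\<forall>\<^sub>F k in sequentially. C' * (((1 / 2) ^ k) powr (- d) * (1 + ln (1 / (1 / 2) ^ k) / c) powr (- (1 + \<sigma>)))
            \<le> ((1 / 2) ^ k) powr (2 - \<gamma>) * poisson N ((1 / 2) ^ k) E"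
          using eventually_compose_filterlim[OF low dy] elim(2)
        proof eventually_elim
          case (elim k)
          define e where "e = (1 / 2 :: real) ^ k"
          have e: "e > 0" by (simp add: e_def)
          have ex: "- d = (2 - \<gamma>) + (\<sigma> + (- 2 + (1 + \<sigma>) / (1 + c / b)))" by (simp add: d_def g0_def)
          have "C' * (e powr (- d) * (1 + ln (1 / e) / c) powr (- (1 + \<sigma>)))
              = e powr (2 - \<gamma>) * (e powr \<sigma> * (C' * e powr (- 2 + (1 + \<sigma>) / (1 + c / b)) * (1 + ln (1 / e) / c) powr (- (1 + \<sigma>))))"
            unfolding ex powr_add by (simp only: mult_ac)
          also have "\<dots> \<le> e powr (2 - \<gamma>) * (e powr \<sigma> * poisson J.\<mu> e E)"
            using elim(1) by (intro mult_left_mono) (auto simp: e_def)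
          also have "\<dots> \<le> e powr (2 - \<gamma>) * poisson N e E"
            using elim(2) by (intro mult_left_mono) (auto simp: e_def)
          finally show ?case by (simp only: e_def)
        qed
      qed
      then have "filterlim (\<lambda>\<epsilon>. \<epsilon> powr (2 - \<gamma>) * poisson N \<epsilon> E) at_top (at_right 0)"
      proof (rule dyadic_filterlim[rotated -1])
        show "poisson N y E \<le> poisson N x E" if "0 < x" "x \<le> y" for x y
          unfolding poisson_def
        proof (rule integral_mono)
          show "integrable N (\<lambda>t. 1 / ((t - E)\<^sup>2 + y\<^sup>2))" "integrable N (\<lambda>t. 1 / ((t - E)\<^sup>2 + x\<^sup>2))"
            using that by (auto intro!: poisson_integrable N)
          fix t
          show "1 / ((t - E)\<^sup>2 + y\<^sup>2) \<le> 1 / ((t - E)\<^sup>2 + x\<^sup>2)"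
            using that by (intro frac_le add_left_mono power_mono) (auto intro: add_nonneg_pos)
        qed
        show "0 \<le> poisson N x E" for x unfolding poisson_def by (intro integral_nonneg_AE) simp
      qed (use \<gamma> in auto)
      then have "filterlim (\<lambda>\<epsilon>. \<epsilon> powr (1 - \<gamma>) * cmod (borel_transform N (Complex E \<epsilon>))) at_top (at_right 0)"
      proof (rule filterlim_at_top_mono)
        show "\<forall>\<^sub>F \<epsilon> in at_right 0. \<epsilon> powr (2 - \<gamma>) * poisson N \<epsilon> E \<le> \<epsilon> powr (1 - \<gamma>) * cmod (borel_transform N (Complex E \<epsilon>))"
          using eventually_at_right_less[of "0 :: real"]
        proof eventually_elim
          case (elim \<epsilon>)
          have "\<epsilon> powr (2 - \<gamma>) = \<epsilon> powr (1 - \<gamma>) * \<epsilon>"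
            using elim powr_add[of \<epsilon> "1 - \<gamma>" 1] by simp
          then have "\<epsilon> powr (2 - \<gamma>) * poisson N \<epsilon> E = \<epsilon> powr (1 - \<gamma>) * (\<epsilon> * poisson N \<epsilon> E)" by simp
          also have "\<dots> \<le> \<epsilon> powr (1 - \<gamma>) * cmod (borel_transform N (Complex E \<epsilon>))"
            using elim by (intro mult_left_mono borel_transform_ge_poisson N) auto
          finally show ?case .
        qed
      qed
      then show ?case
        by (intro lim_imp_Liminf) (simp_all add: tendsto_PInfty_eq_at_top)
    qed
    then show "spectral_singular \<gamma> (measure_restrict (spectral_measure P) S)"
      unfolding spectral_singular_def N_def .
  qed
qed

end
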